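(* Let $\mathcal{A}$ be a locally noetherian Grothendieck category with an action of a group $G$. Then there exist bijections among the following sets: (i) the set of $G$-closed localizing subcategories of $\mathcal{A}$; (ii) the set of $G$-closed Serre subcategories of $\mathcal{A}_{\mathrm{noeth}}$; (iii) the set of open subsets of $\operatorname{Spec}^G\mathcal{A}$. The bijection between (i) and (iii) is given by $\mathcal{X}\mapsto\operatorname{Supp}^G\mathcal{X}:=\bigcup_{X\in\mathcal{X}}\operatorname{Supp}^G X$ and $\Phi\mapsto(\operatorname{Supp}^G)^{-1}(\Phi):=\{M\in\mathcal{A}\mid\operatorname{Supp}^G M\subseteq\Phi\}$, where $\mathcal{X}$ is a $G$-closed localizing subcategory of $\mathcal{A}$ and $\Phi$ is an open subset of $\operatorname{Spec}^G\mathcal{A}$.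
   Context: An action of $G$ on $\mathcal{A}$ is a group homomorphism from $G$ to the group of isomorphism classes of autoequivalences of $\mathcal{A}$, written $X\mapsto g\cdot X$. Subcategories are full and closed under isomorphisms; $\mathcal{X}$ is $G$-closed if $g\cdot X\in\mathcal{X}$ for all $g\in G$, $X\in\mathcal{X}$. $\mathcal{A}_{\mathrm{noeth}}$ is the full subcategory of noetherian objects. A Serre subcategory is an additive subcategory closed under subobjects, quotients and extensions; a localizing subcategory is a Serre subcategory closed under coproducts. An object $H\neq0$ is monoform if for every nonzero subobject $L$ of $H$, the objects $H$ and $H/L$ have no common nonzero subobject (up to isomorphism); two monoform objects are atom-equivalent if they have a common nonzero subobject; $\operatorname{Spec}\mathcal{A}$ is the set of atom-equivalence classes $\overline{H}$ of monoform objects. $\operatorname{Supp}M:=\{\overline{H}\mid H\text{ a monoform subquotient of }M\}$; these sets form an open basis of the topology on $\operatorname{Spec}\mathcal{A}$. $G$ acts on $\operatorname{Spec}\mathcal{A}$ by $g\cdot\overline{H}=\overline{g\cdot H}$; $\operatorname{Spec}^G\mathcal{A}$ is the quotient space, with quotient map $\pi_G$, and $\operatorname{Supp}^G M:=\pi_G(\operatorname{Supp}M)$. *)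

theory Defs
  imports "HOL-Algebra.Group_Action" "HOL-Analysis.Abstract_Topology"
begin

unbundle cardinal_syntax

section \<open>Categories\<close>

record ('o, 'a) cat =
  Obj :: "'o set"
  Arr :: "'a set"
  Dom :: "'a \<Rightarrow> 'o"
  Cod :: "'a \<Rightarrow> 'o"
  Ident :: "'o \<Rightarrow> 'a"
  Comp :: "'a \<Rightarrow> 'a \<Rightarrow> 'a"  (infixr \<open>\<cdot>\<index>\<close> 70)

definition Hom :: "('o, 'a) cat \<Rightarrow> 'o \<Rightarrow> 'o \<Rightarrow> 'a set" where
  "Hom C X Y = {f \<in> Arr C. Dom C f = X \<and> Cod C f = Y}"

locale category =
  fixes C :: "('o, 'a) cat" (structure)
  assumes Dom_in_Obj: "f \<in> Arr C \<Longrightarrow> Dom C f \<in> Obj C"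
    and Cod_in_Obj: "f \<in> Arr C \<Longrightarrow> Cod C f \<in> Obj C"
    and Ident_in_Hom: "X \<in> Obj C \<Longrightarrow> Ident C X \<in> Hom C X X"
    and Comp_in_Hom: "\<lbrakk>f \<in> Hom C X Y; g \<in> Hom C Y Z\<rbrakk> \<Longrightarrow> g \<cdot> f \<in> Hom C X Z"
    and Comp_Ident: "f \<in> Hom C X Y \<Longrightarrow> f \<cdot> Ident C X = f"
    and Ident_Comp: "f \<in> Hom C X Y \<Longrightarrow> Ident C Y \<cdot> f = f"
    and Comp_assoc:
      "\<lbrakk>f \<in> Hom C W X; g \<in> Hom C X Y; h \<in> Hom C Y Z\<rbrakk> \<Longrightarrow> (h \<cdot> g) \<cdot> f = h \<cdot> (g \<cdot> f)"

definition full_subcat :: "('o, 'a) cat \<Rightarrow> 'o set \<Rightarrow> ('o, 'a) cat" where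
  "full_subcat C S = C\<lparr>Obj := S, Arr := {f \<in> Arr C. Dom C f \<in> S \<and> Cod C f \<in> S}\<rparr>"

definition mono_arr :: "('o, 'a) cat \<Rightarrow> 'a \<Rightarrow> bool" where
  "mono_arr C f \<longleftrightarrow> f \<in> Arr C \<and>
    (\<forall>W. \<forall>g \<in> Hom C W (Dom C f). \<forall>h \<in> Hom C W (Dom C f). f \<cdot>\<^bsub>C\<^esub> g = f \<cdot>\<^bsub>C\<^esub> h \<longrightarrow> g = h)"

definition epi_arr :: "('o, 'a) cat \<Rightarrow> 'a \<Rightarrow> bool" where
  "epi_arr C f \<longleftrightarrow> f \<in> Arr C \<and>
    (\<forall>Z. \<forall>g \<in> Hom C (Cod C f) Z. \<forall>h \<in> Hom C (Cod C f) Z. g \<cdot>\<^bsub>C\<^esub> f = h \<cdot>\<^bsub>C\<^esub> f \<longrightarrow> g = h)"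

definition iso_arr :: "('o, 'a) cat \<Rightarrow> 'a \<Rightarrow> bool" where
  "iso_arr C f \<longleftrightarrow> f \<in> Arr C \<and>
    (\<exists>g \<in> Hom C (Cod C f) (Dom C f).
       g \<cdot>\<^bsub>C\<^esub> f = Ident C (Dom C f) \<and> f \<cdot>\<^bsub>C\<^esub> g = Ident C (Cod C f))"

definition iso_obj :: "('o, 'a) cat \<Rightarrow> 'o \<Rightarrow> 'o \<Rightarrow> bool" where
  "iso_obj C X Y \<longleftrightarrow> (\<exists>f \<in> Hom C X Y. iso_arr C f)"

definition zero_obj :: "('o, 'a) cat \<Rightarrow> 'o \<Rightarrow> bool" where
  "zero_obj C Z \<longleftrightarrow> Z \<in> Obj C \<and>
    (\<forall>X \<in> Obj C. (\<exists>!f. f \<in> Hom C X Z) \<and> (\<exists>!f. f \<in> Hom C Z X))"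

definition nonzero_obj :: "('o, 'a) cat \<Rightarrow> 'o \<Rightarrow> bool" where
  "nonzero_obj C X \<longleftrightarrow> X \<in> Obj C \<and> \<not> zero_obj C X"

definition zero_arr :: "('o, 'a) cat \<Rightarrow> 'a \<Rightarrow> bool" where
  "zero_arr C f \<longleftrightarrow> f \<in> Arr C \<and>
    (\<exists>Z g h. zero_obj C Z \<and> g \<in> Hom C (Dom C f) Z \<and> h \<in> Hom C Z (Cod C f) \<and> f = h \<cdot>\<^bsub>C\<^esub> g)"

text \<open>\<open>is_kernel C g k\<close>: the arrow \<open>k\<close> is a kernel of \<open>g\<close>;
  \<open>is_cokernel C f q\<close>: the arrow \<open>q\<close> is a cokernel of \<open>f\<close>.\<close>

definition is_kernel :: "('o, 'a) cat \<Rightarrow> 'a \<Rightarrow> 'a \<Rightarrow> bool" where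
  "is_kernel C g k \<longleftrightarrow> g \<in> Arr C \<and> k \<in> Arr C \<and> Cod C k = Dom C g \<and> zero_arr C (g \<cdot>\<^bsub>C\<^esub> k) \<and>
    (\<forall>W. \<forall>h \<in> Hom C W (Dom C g). zero_arr C (g \<cdot>\<^bsub>C\<^esub> h) \<longrightarrow>
       (\<exists>!u. u \<in> Hom C W (Dom C k) \<and> k \<cdot>\<^bsub>C\<^esub> u = h))"

definition is_cokernel :: "('o, 'a) cat \<Rightarrow> 'a \<Rightarrow> 'a \<Rightarrow> bool" where
  "is_cokernel C f q \<longleftrightarrow> f \<in> Arr C \<and> q \<in> Arr C \<and> Dom C q = Cod C f \<and> zero_arr C (q \<cdot>\<^bsub>C\<^esub> f) \<and>
    (\<forall>Z. \<forall>h \<in> Hom C (Cod C f) Z. zero_arr C (h \<cdot>\<^bsub>C\<^esub> f) \<longrightarrow>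
       (\<exists>!u. u \<in> Hom C (Cod C q) Z \<and> u \<cdot>\<^bsub>C\<^esub> q = h))"

text \<open>\<open>short_exact C f g\<close>: the sequence \<open>0 \<rightarrow> Dom f \<rightarrow> Cod f = Dom g \<rightarrow> Cod g \<rightarrow> 0\<close> is exact.\<close>

definition short_exact :: "('o, 'a) cat \<Rightarrow> 'a \<Rightarrow> 'a \<Rightarrow> bool" where
  "short_exact C f g \<longleftrightarrow> is_kernel C g f \<and> is_cokernel C f g"

definition is_coproduct ::
  "('o, 'a) cat \<Rightarrow> 'i set \<Rightarrow> ('i \<Rightarrow> 'o) \<Rightarrow> 'o \<Rightarrow> ('i \<Rightarrow> 'a) \<Rightarrow> bool" where
  "is_coproduct C I F P \<iota> \<longleftrightarrow> P \<in> Obj C \<and> (\<forall>i \<in> I. \<iota> i \<in> Hom C (F i) P) \<and>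
    (\<forall>Y \<in> Obj C. \<forall>f. (\<forall>i \<in> I. f i \<in> Hom C (F i) Y) \<longrightarrow>
       (\<exists>!u. u \<in> Hom C P Y \<and> (\<forall>i \<in> I. u \<cdot>\<^bsub>C\<^esub> \<iota> i = f i)))"


section \<open>Abelian and Grothendieck categories\<close>

definition preadditive_structure :: "('o, 'a) cat \<Rightarrow> ('a \<Rightarrow> 'a \<Rightarrow> 'a) \<Rightarrow> bool" where
  "preadditive_structure C add \<longleftrightarrow>
    (\<forall>X \<in> Obj C. \<forall>Y \<in> Obj C. \<exists>z. comm_group \<lparr>carrier = Hom C X Y, mult = add, one = z\<rparr>) \<and>
    (\<forall>X Y Z. \<forall>f \<in> Hom C X Y. \<forall>g \<in> Hom C Y Z. \<forall>h \<in> Hom C Y Z.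
       add g h \<cdot>\<^bsub>C\<^esub> f = add (g \<cdot>\<^bsub>C\<^esub> f) (h \<cdot>\<^bsub>C\<^esub> f)) \<and>
    (\<forall>X Y Z. \<forall>f \<in> Hom C X Y. \<forall>g \<in> Hom C X Y. \<forall>h \<in> Hom C Y Z.
       h \<cdot>\<^bsub>C\<^esub> add f g = add (h \<cdot>\<^bsub>C\<^esub> f) (h \<cdot>\<^bsub>C\<^esub> g))"

text \<open>The additive structure of an abelian category is unique, so only its existence is required.\<close>

locale abelian_category = category +
  assumes preadditive: "\<exists>add. preadditive_structure C add"
    and zero_obj_exists: "\<exists>Z. zero_obj C Z"
    and finite_coproducts:
      "\<lbrakk>finite (I :: nat set); \<forall>i \<in> I. F i \<in> Obj C\<rbrakk> \<Longrightarrow> \<exists>P \<iota>. is_coproduct C I F P \<iota>"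
    and kernels: "f \<in> Arr C \<Longrightarrow> \<exists>k. is_kernel C f k"
    and cokernels: "f \<in> Arr C \<Longrightarrow> \<exists>q. is_cokernel C f q"
    and mono_normal: "mono_arr C f \<Longrightarrow> \<exists>g. is_kernel C g f"
    and epi_normal: "epi_arr C f \<Longrightarrow> \<exists>g. is_cokernel C g f"

text \<open>Smallness: a set is small if it has fewer than \<open>\<kappa>\<close> elements, where \<open>\<kappa>\<close> is an uncountable
  regular cardinal. A strongly inaccessible \<open>\<kappa>\<close> gives the usual smallness with respect to a
  Grothendieck universe; the strong limit property is not needed in any of the notions below.
  Every small set is equipotent to a set of elements of \<open>Field \<kappa>\<close>, so that it suffices to use
  index sets in the underlying type of \<open>\<kappa>\<close>.\<close>

definition size_bound :: "'u rel \<Rightarrow> bool" where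
  "size_bound \<kappa> \<longleftrightarrow> Card_order \<kappa> \<and> regularCard \<kappa> \<and> natLeq <o \<kappa>"

definition small :: "'u rel \<Rightarrow> 'b set \<Rightarrow> bool" where
  "small \<kappa> A \<longleftrightarrow> |A| <o \<kappa>"

definition directed :: "'i set \<Rightarrow> ('i \<Rightarrow> 'i \<Rightarrow> bool) \<Rightarrow> bool" where
  "directed I leq \<longleftrightarrow> I \<noteq> {} \<and> (\<forall>i \<in> I. leq i i) \<and>
    (\<forall>i \<in> I. \<forall>j \<in> I. \<forall>k \<in> I. leq i j \<longrightarrow> leq j k \<longrightarrow> leq i k) \<and>
    (\<forall>i \<in> I. \<forall>j \<in> I. \<exists>k \<in> I. leq i k \<and> leq j k)"

definition direct_system ::
  "('o, 'a) cat \<Rightarrow> 'i set \<Rightarrow> ('i \<Rightarrow> 'i \<Rightarrow> bool) \<Rightarrow> ('i \<Rightarrow> 'o) \<Rightarrow> ('i \<Rightarrow> 'i \<Rightarrow> 'a) \<Rightarrow> bool" where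
  "direct_system C I leq F \<phi> \<longleftrightarrow> (\<forall>i \<in> I. F i \<in> Obj C) \<and>
    (\<forall>i \<in> I. \<forall>j \<in> I. leq i j \<longrightarrow> \<phi> i j \<in> Hom C (F i) (F j)) \<and>
    (\<forall>i \<in> I. \<phi> i i = Ident C (F i)) \<and>
    (\<forall>i \<in> I. \<forall>j \<in> I. \<forall>k \<in> I. leq i j \<longrightarrow> leq j k \<longrightarrow> \<phi> j k \<cdot>\<^bsub>C\<^esub> \<phi> i j = \<phi> i k)"

definition is_cocone ::
  "('o, 'a) cat \<Rightarrow> 'i set \<Rightarrow> ('i \<Rightarrow> 'i \<Rightarrow> bool) \<Rightarrow> ('i \<Rightarrow> 'o) \<Rightarrow> ('i \<Rightarrow> 'i \<Rightarrow> 'a) \<Rightarrow>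
    'o \<Rightarrow> ('i \<Rightarrow> 'a) \<Rightarrow> bool" where
  "is_cocone C I leq F \<phi> L l \<longleftrightarrow> L \<in> Obj C \<and> (\<forall>i \<in> I. l i \<in> Hom C (F i) L) \<and>
    (\<forall>i \<in> I. \<forall>j \<in> I. leq i j \<longrightarrow> l j \<cdot>\<^bsub>C\<^esub> \<phi> i j = l i)"

definition is_direct_limit ::
  "('o, 'a) cat \<Rightarrow> 'i set \<Rightarrow> ('i \<Rightarrow> 'i \<Rightarrow> bool) \<Rightarrow> ('i \<Rightarrow> 'o) \<Rightarrow> ('i \<Rightarrow> 'i \<Rightarrow> 'a) \<Rightarrow>
    'o \<Rightarrow> ('i \<Rightarrow> 'a) \<Rightarrow> bool" where
  "is_direct_limit C I leq F \<phi> L l \<longleftrightarrow> is_cocone C I leq F \<phi> L l \<and>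
    (\<forall>Y m. is_cocone C I leq F \<phi> Y m \<longrightarrow>
       (\<exists>!u. u \<in> Hom C L Y \<and> (\<forall>i \<in> I. u \<cdot>\<^bsub>C\<^esub> l i = m i)))"

definition system_morphism ::
  "('o, 'a) cat \<Rightarrow> 'i set \<Rightarrow> ('i \<Rightarrow> 'i \<Rightarrow> bool) \<Rightarrow> ('i \<Rightarrow> 'o) \<Rightarrow> ('i \<Rightarrow> 'i \<Rightarrow> 'a) \<Rightarrow>
    ('i \<Rightarrow> 'o) \<Rightarrow> ('i \<Rightarrow> 'i \<Rightarrow> 'a) \<Rightarrow> ('i \<Rightarrow> 'a) \<Rightarrow> bool" where
  "system_morphism C I leq F \<phi> F' \<phi>' \<alpha> \<longleftrightarrow> (\<forall>i \<in> I. \<alpha> i \<in> Hom C (F i) (F' i)) \<and>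
    (\<forall>i \<in> I. \<forall>j \<in> I. leq i j \<longrightarrow> \<alpha> j \<cdot>\<^bsub>C\<^esub> \<phi> i j = \<phi>' i j \<cdot>\<^bsub>C\<^esub> \<alpha> i)"

text \<open>Direct limits of small direct systems of short exact sequences are short exact. (The limits
  themselves exist as soon as small coproducts and cokernels do.)\<close>

definition exact_direct_limits :: "'u rel \<Rightarrow> ('o, 'a) cat \<Rightarrow> bool" where
  "exact_direct_limits \<kappa> C \<longleftrightarrow>
    (\<forall>(I :: 'u set) leq F \<phi> F' \<phi>' F'' \<phi>'' \<alpha> \<beta> L l L' l' L'' l'' a b.
       small \<kappa> I \<longrightarrow> directed I leq \<longrightarrow>
       direct_system C I leq F \<phi> \<longrightarrow> direct_system C I leq F' \<phi>' \<longrightarrow> direct_system C I leq F'' \<phi>'' \<longrightarrow>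
       system_morphism C I leq F \<phi> F' \<phi>' \<alpha> \<longrightarrow> system_morphism C I leq F' \<phi>' F'' \<phi>'' \<beta> \<longrightarrow>
       (\<forall>i \<in> I. short_exact C (\<alpha> i) (\<beta> i)) \<longrightarrow>
       is_direct_limit C I leq F \<phi> L l \<longrightarrow> is_direct_limit C I leq F' \<phi>' L' l' \<longrightarrow>
       is_direct_limit C I leq F'' \<phi>'' L'' l'' \<longrightarrow>
       a \<in> Hom C L L' \<longrightarrow> (\<forall>i \<in> I. a \<cdot>\<^bsub>C\<^esub> l i = l' i \<cdot>\<^bsub>C\<^esub> \<alpha> i) \<longrightarrow>
       b \<in> Hom C L' L'' \<longrightarrow> (\<forall>i \<in> I. b \<cdot>\<^bsub>C\<^esub> l' i = l'' i \<cdot>\<^bsub>C\<^esub> \<beta> i) \<longrightarrow>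
       short_exact C a b)"

definition generating_set :: "('o, 'a) cat \<Rightarrow> 'o set \<Rightarrow> bool" where
  "generating_set C S \<longleftrightarrow> S \<subseteq> Obj C \<and>
    (\<forall>X Y. \<forall>f \<in> Hom C X Y. \<forall>g \<in> Hom C X Y. f \<noteq> g \<longrightarrow>
       (\<exists>U \<in> S. \<exists>h \<in> Hom C U X. f \<cdot>\<^bsub>C\<^esub> h \<noteq> g \<cdot>\<^bsub>C\<^esub> h))"

locale grothendieck_category = abelian_category C
  for C :: "('o, 'a) cat" (structure) and \<kappa> :: "'u rel" +
  assumes size_bound: "size_bound \<kappa>"
    and locally_small: "\<lbrakk>X \<in> Obj C; Y \<in> Obj C\<rbrakk> \<Longrightarrow> small \<kappa> (Hom C X Y)"
    and small_coproducts:
      "\<lbrakk>small \<kappa> (I :: 'u set); \<forall>i \<in> I. F i \<in> Obj C\<rbrakk> \<Longrightarrow> \<exists>P \<iota>. is_coproduct C I F P \<iota>"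
    and exact_direct_limits: "exact_direct_limits \<kappa> C"
    and generator: "\<exists>U \<in> Obj C. generating_set C {U}"

text \<open>Subobjects of \<open>M\<close> are represented by monomorphisms into \<open>M\<close>, preordered by factorization.\<close>

definition mono_into :: "('o, 'a) cat \<Rightarrow> 'o \<Rightarrow> 'a \<Rightarrow> bool" where
  "mono_into C M m \<longleftrightarrow> mono_arr C m \<and> Cod C m = M"

definition sub_le :: "('o, 'a) cat \<Rightarrow> 'a \<Rightarrow> 'a \<Rightarrow> bool" where
  "sub_le C m n \<longleftrightarrow> (\<exists>u \<in> Hom C (Dom C m) (Dom C n). m = n \<cdot>\<^bsub>C\<^esub> u)"

definition noetherian :: "('o, 'a) cat \<Rightarrow> 'o \<Rightarrow> bool" where
  "noetherian C M \<longleftrightarrow> M \<in> Obj C \<and>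
    (\<forall>m :: nat \<Rightarrow> 'a. (\<forall>i. mono_into C M (m i)) \<and> (\<forall>i. sub_le C (m i) (m (Suc i))) \<longrightarrow>
       (\<exists>N. \<forall>i \<ge> N. sub_le C (m i) (m N)))"

definition noeth :: "('o, 'a) cat \<Rightarrow> ('o, 'a) cat" where
  "noeth C = full_subcat C {M. noetherian C M}"

locale locally_noetherian_category = grothendieck_category +
  assumes noetherian_generators:
    "\<exists>S. small \<kappa> S \<and> generating_set C S \<and> (\<forall>U \<in> S. noetherian C U)"


section \<open>Serre and localizing subcategories\<close>

text \<open>Full subcategories are given by their sets of objects.\<close>

definition serre_subcategory :: "('o, 'a) cat \<Rightarrow> 'o set \<Rightarrow> bool" where
  "serre_subcategory C \<X> \<longleftrightarrow> \<X> \<subseteq> Obj C \<and>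
    (\<forall>X Y. X \<in> \<X> \<and> iso_obj C X Y \<longrightarrow> Y \<in> \<X>) \<and>
    (\<forall>Z. zero_obj C Z \<longrightarrow> Z \<in> \<X>) \<and>
    (\<forall>(I :: nat set) F P \<iota>. finite I \<and> (\<forall>i \<in> I. F i \<in> \<X>) \<and> is_coproduct C I F P \<iota> \<longrightarrow> P \<in> \<X>) \<and>
    (\<forall>f. mono_arr C f \<and> Cod C f \<in> \<X> \<longrightarrow> Dom C f \<in> \<X>) \<and>
    (\<forall>f. epi_arr C f \<and> Dom C f \<in> \<X> \<longrightarrow> Cod C f \<in> \<X>) \<and>
    (\<forall>f g. short_exact C f g \<and> Dom C f \<in> \<X> \<and> Cod C g \<in> \<X> \<longrightarrow> Cod C f \<in> \<X>)"

definition localizing_subcategory :: "'u rel \<Rightarrow> ('o, 'a) cat \<Rightarrow> 'o set \<Rightarrow> bool" where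
  "localizing_subcategory \<kappa> C \<X> \<longleftrightarrow> serre_subcategory C \<X> \<and>
    (\<forall>(I :: 'u set) F P \<iota>. small \<kappa> I \<and> (\<forall>i \<in> I. F i \<in> \<X>) \<and> is_coproduct C I F P \<iota> \<longrightarrow> P \<in> \<X>)"


section \<open>The atom spectrum\<close>

definition common_subobject :: "('o, 'a) cat \<Rightarrow> 'o \<Rightarrow> 'o \<Rightarrow> bool" where
  "common_subobject C X Y \<longleftrightarrow>
    (\<exists>K f g. nonzero_obj C K \<and> f \<in> Hom C K X \<and> mono_arr C f \<and> g \<in> Hom C K Y \<and> mono_arr C g)"

definition monoform :: "('o, 'a) cat \<Rightarrow> 'o \<Rightarrow> bool" where
  "monoform C H \<longleftrightarrow> nonzero_obj C H \<and>
    (\<forall>m q. mono_into C H m \<and> nonzero_obj C (Dom C m) \<and> is_cokernel C m q \<longrightarrow>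
       \<not> common_subobject C H (Cod C q))"

definition atom :: "('o, 'a) cat \<Rightarrow> 'o \<Rightarrow> 'o set" where
  "atom C H = {H'. monoform C H' \<and> common_subobject C H H'}"

definition Spec :: "('o, 'a) cat \<Rightarrow> 'o set set" where
  "Spec C = atom C ` {H. monoform C H}"

definition subquotient :: "('o, 'a) cat \<Rightarrow> 'o \<Rightarrow> 'o \<Rightarrow> bool" where
  "subquotient C M H \<longleftrightarrow>
    (\<exists>m e. mono_into C M m \<and> epi_arr C e \<and> Dom C e = Dom C m \<and> Cod C e = H)"

definition Supp :: "('o, 'a) cat \<Rightarrow> 'o \<Rightarrow> 'o set set" where
  "Supp C M = atom C ` {H. monoform C H \<and> subquotient C M H}"

text \<open>The supports form a basis of a topology on \<^term>\<open>Spec C\<close>, which is therefore the topology they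
  generate; its underlying set is the union of all supports, that is, \<^term>\<open>Spec C\<close>.\<close>

definition Spec_top :: "('o, 'a) cat \<Rightarrow> 'o set topology" where
  "Spec_top C = topology_generated_by (Supp C ` Obj C)"


section \<open>Group actions\<close>

record ('o, 'a) endo =
  on_obj :: "'o \<Rightarrow> 'o"
  on_arr :: "'a \<Rightarrow> 'a"

definition endofunctor :: "('o, 'a) cat \<Rightarrow> ('o, 'a) endo \<Rightarrow> bool" where
  "endofunctor C F \<longleftrightarrow>
    (\<forall>X \<in> Obj C. on_obj F X \<in> Obj C) \<and>
    (\<forall>X Y. \<forall>f \<in> Hom C X Y. on_arr F f \<in> Hom C (on_obj F X) (on_obj F Y)) \<and>
    (\<forall>X \<in> Obj C. on_arr F (Ident C X) = Ident C (on_obj F X)) \<and>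
    (\<forall>X Y Z. \<forall>f \<in> Hom C X Y. \<forall>g \<in> Hom C Y Z. on_arr F (g \<cdot>\<^bsub>C\<^esub> f) = on_arr F g \<cdot>\<^bsub>C\<^esub> on_arr F f)"

definition id_endo :: "('o, 'a) endo" where
  "id_endo = \<lparr>on_obj = id, on_arr = id\<rparr>"

definition comp_endo :: "('o, 'a) endo \<Rightarrow> ('o, 'a) endo \<Rightarrow> ('o, 'a) endo" where
  "comp_endo F F' = \<lparr>on_obj = on_obj F \<circ> on_obj F', on_arr = on_arr F \<circ> on_arr F'\<rparr>"

definition nat_iso :: "('o, 'a) cat \<Rightarrow> ('o, 'a) endo \<Rightarrow> ('o, 'a) endo \<Rightarrow> bool" where
  "nat_iso C F F' \<longleftrightarrow> (\<exists>\<eta>.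
    (\<forall>X \<in> Obj C. \<eta> X \<in> Hom C (on_obj F X) (on_obj F' X) \<and> iso_arr C (\<eta> X)) \<and>
    (\<forall>X Y. \<forall>f \<in> Hom C X Y. \<eta> Y \<cdot>\<^bsub>C\<^esub> on_arr F f = on_arr F' f \<cdot>\<^bsub>C\<^esub> \<eta> X))"

definition autoequivalence :: "('o, 'a) cat \<Rightarrow> ('o, 'a) endo \<Rightarrow> bool" where
  "autoequivalence C F \<longleftrightarrow> endofunctor C F \<and>
    (\<exists>F'. endofunctor C F' \<and> nat_iso C (comp_endo F' F) id_endo \<and> nat_iso C (comp_endo F F') id_endo)"

definition autoeq_rel :: "('o, 'a) cat \<Rightarrow> ('o, 'a) endo rel" where
  "autoeq_rel C = {(F, F'). autoequivalence C F \<and> autoequivalence C F' \<and> nat_iso C F F'}"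

definition autoeq_group :: "('o, 'a) cat \<Rightarrow> ('o, 'a) endo set monoid" where
  "autoeq_group C =
    \<lparr>carrier = {F. autoequivalence C F} // autoeq_rel C,
     mult = (\<lambda>\<F> \<F>'. \<Union>F \<in> \<F>. \<Union>F' \<in> \<F>'. autoeq_rel C `` {comp_endo F F'}),
     one = autoeq_rel C `` {id_endo}\<rparr>"

definition category_action :: "('g, 'm) monoid_scheme \<Rightarrow> ('o, 'a) cat \<Rightarrow>
    ('g \<Rightarrow> ('o, 'a) endo set) \<Rightarrow> bool" where
  "category_action G C \<rho> \<longleftrightarrow> \<rho> \<in> hom G (autoeq_group C)"

text \<open>The object \<open>g \<cdot> X\<close> is determined up to isomorphism only, so we pick a representative of the
  class \<open>\<rho> g\<close>. All uses below are invariant under isomorphism.\<close>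

definition act :: "('g \<Rightarrow> ('o, 'a) endo set) \<Rightarrow> 'g \<Rightarrow> 'o \<Rightarrow> 'o" where
  "act \<rho> g X = on_obj (SOME F. F \<in> \<rho> g) X"

definition G_closed :: "('g, 'm) monoid_scheme \<Rightarrow> ('g \<Rightarrow> ('o, 'a) endo set) \<Rightarrow> 'o set \<Rightarrow> bool" where
  "G_closed G \<rho> \<X> \<longleftrightarrow> (\<forall>g \<in> carrier G. \<forall>X \<in> \<X>. act \<rho> g X \<in> \<X>)"

text \<open>The atom of \<open>g \<cdot> H\<close> does not depend on the representative \<open>H\<close> of the atom \<open>\<alpha>\<close>, so the union
  below is over a single set.\<close>

definition atom_act :: "('o, 'a) cat \<Rightarrow> ('g \<Rightarrow> ('o, 'a) endo set) \<Rightarrow> 'g \<Rightarrow> 'o set \<Rightarrow> 'o set" where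
  "atom_act C \<rho> g \<alpha> = (\<Union>H \<in> \<alpha>. atom C (act \<rho> g H))"

text \<open>The quotient map sends an atom to its orbit.\<close>

definition orbit_map :: "('g, 'm) monoid_scheme \<Rightarrow> ('o, 'a) cat \<Rightarrow> ('g \<Rightarrow> ('o, 'a) endo set) \<Rightarrow>
    'o set \<Rightarrow> 'o set set" where
  "orbit_map G C \<rho> = orbit G (atom_act C \<rho>)"

definition SpecG :: "('g, 'm) monoid_scheme \<Rightarrow> ('o, 'a) cat \<Rightarrow> ('g \<Rightarrow> ('o, 'a) endo set) \<Rightarrow>
    'o set set set" where
  "SpecG G C \<rho> = orbit_map G C \<rho> ` Spec C"

definition SpecG_top :: "('g, 'm) monoid_scheme \<Rightarrow> ('o, 'a) cat \<Rightarrow> ('g \<Rightarrow> ('o, 'a) endo set) \<Rightarrow>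
    'o set set topology" where
  "SpecG_top G C \<rho> = topology (\<lambda>\<Phi>. \<Phi> \<subseteq> SpecG G C \<rho> \<and>
     openin (Spec_top C) {\<alpha> \<in> topspace (Spec_top C). orbit_map G C \<rho> \<alpha> \<in> \<Phi>})"

lemma openin_SpecG_top:
  "openin (SpecG_top G C \<rho>) \<Phi> \<longleftrightarrow> \<Phi> \<subseteq> SpecG G C \<rho> \<and>
     openin (Spec_top C) {\<alpha> \<in> topspace (Spec_top C). orbit_map G C \<rho> \<alpha> \<in> \<Phi>}"
proof -
  let ?T = "Spec_top C" and ?q = "orbit_map G C \<rho>"
  have "istopology (\<lambda>\<Phi>. \<Phi> \<subseteq> SpecG G C \<rho> \<and> openin ?T {\<alpha> \<in> topspace ?T. ?q \<alpha> \<in> \<Phi>})"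
    unfolding istopology_def
  proof (intro conjI allI impI)
    fix S U
    assume "S \<subseteq> SpecG G C \<rho> \<and> openin ?T {\<alpha> \<in> topspace ?T. ?q \<alpha> \<in> S}"
      and "U \<subseteq> SpecG G C \<rho> \<and> openin ?T {\<alpha> \<in> topspace ?T. ?q \<alpha> \<in> U}"
    moreover have "{\<alpha> \<in> topspace ?T. ?q \<alpha> \<in> S \<inter> U} =
        {\<alpha> \<in> topspace ?T. ?q \<alpha> \<in> S} \<inter> {\<alpha> \<in> topspace ?T. ?q \<alpha> \<in> U}"
      by auto
    ultimately show "S \<inter> U \<subseteq> SpecG G C \<rho>" "openin ?T {\<alpha> \<in> topspace ?T. ?q \<alpha> \<in> S \<inter> U}"
      by (auto simp del: topology_generated_by_topspace)
  next
    fix K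
    assume K: "\<forall>S \<in> K. S \<subseteq> SpecG G C \<rho> \<and> openin ?T {\<alpha> \<in> topspace ?T. ?q \<alpha> \<in> S}"
    then show "\<Union>K \<subseteq> SpecG G C \<rho>" by blast
    have "{\<alpha> \<in> topspace ?T. ?q \<alpha> \<in> \<Union>K} = (\<Union>S \<in> K. {\<alpha> \<in> topspace ?T. ?q \<alpha> \<in> S})"
      by auto
    then show "openin ?T {\<alpha> \<in> topspace ?T. ?q \<alpha> \<in> \<Union>K}"
      using K by (metis (no_types, lifting) openin_Union imageE)
  qed
  then show ?thesis
    unfolding SpecG_top_def by (simp add: topology_inverse')
qed

definition SuppG :: "('g, 'm) monoid_scheme \<Rightarrow> ('o, 'a) cat \<Rightarrow> ('g \<Rightarrow> ('o, 'a) endo set) \<Rightarrow>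
    'o \<Rightarrow> 'o set set set" where
  "SuppG G C \<rho> M = orbit_map G C \<rho> ` Supp C M"

definition SuppG_sub :: "('g, 'm) monoid_scheme \<Rightarrow> ('o, 'a) cat \<Rightarrow> ('g \<Rightarrow> ('o, 'a) endo set) \<Rightarrow>
    'o set \<Rightarrow> 'o set set set" where
  "SuppG_sub G C \<rho> \<X> = (\<Union>X \<in> \<X>. SuppG G C \<rho> X)"

definition SuppG_inv :: "('g, 'm) monoid_scheme \<Rightarrow> ('o, 'a) cat \<Rightarrow> ('g \<Rightarrow> ('o, 'a) endo set) \<Rightarrow>
    'o set set set \<Rightarrow> 'o set" where
  "SuppG_inv G C \<rho> \<Phi> = {M \<in> Obj C. SuppG G C \<rho> M \<subseteq> \<Phi>}"

definition closed_localizing :: "'u rel \<Rightarrow> ('g, 'm) monoid_scheme \<Rightarrow> ('o, 'a) cat \<Rightarrow>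
    ('g \<Rightarrow> ('o, 'a) endo set) \<Rightarrow> 'o set set" where
  "closed_localizing \<kappa> G C \<rho> = {\<X>. localizing_subcategory \<kappa> C \<X> \<and> G_closed G \<rho> \<X>}"

definition closed_serre_noeth :: "('g, 'm) monoid_scheme \<Rightarrow> ('o, 'a) cat \<Rightarrow>
    ('g \<Rightarrow> ('o, 'a) endo set) \<Rightarrow> 'o set set" where
  "closed_serre_noeth G C \<rho> = {\<X>. serre_subcategory (noeth C) \<X> \<and> G_closed G \<rho> \<X>}"

definition SpecG_opens :: "('g, 'm) monoid_scheme \<Rightarrow> ('o, 'a) cat \<Rightarrow>
    ('g \<Rightarrow> ('o, 'a) endo set) \<Rightarrow> 'o set set set set" where
  "SpecG_opens G C \<rho> = {\<Phi>. openin (SpecG_top G C \<rho>) \<Phi>}"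

end

theory Submission
  imports Defs
begin

text \<open>
  A \<open>G\<close>-closed Serre subcategory \<open>\<X>\<close> has a \<open>G\<close>-stable open support \<open>Supp \<X>\<close>, so passing to orbits loses
  no information, and the point is that \<open>\<X>\<close> is determined by \<open>Supp \<X>\<close>. For a noetherian object \<open>M\<close> with
  \<open>Supp M \<subseteq> Supp \<X>\<close> and \<open>M \<notin> \<X>\<close>, choose a quotient \<open>Q \<notin> \<X>\<close> all of whose proper quotients lie in \<open>\<X>\<close>. It has a
  monoform subobject, whose atom occurs in a member of \<open>\<X>\<close>, so \<open>Q\<close> has a nonzero subobject \<open>K \<in> \<X>\<close>; as
  \<open>Q/K \<in> \<X>\<close>, also \<open>Q \<in> \<X>\<close>, a contradiction. An arbitrary object is a quotient of a coproduct of its noetherian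
  subobjects, which settles localizing subcategories.

  Conversely, \<open>{M. Supp M \<subseteq> U}\<close> is closed under coproducts because the support of a coproduct is the
  union of the supports of the summands: by exactness of direct limits a monoform subobject of a quotient
  of a coproduct meets the image of a finite subcoproduct. Every open set of atoms is a union of supports of
  noetherian objects, so it is recovered from this subcategory.

  Kernels, images and subobjects are handled by lifting arrows along epimorphisms, which replaces the
  choice of elements.
\<close>

section \<open>Arrows of an abelian category\<close>

context category
begin

text \<open>Containment of subobjects is tested by vanishing: an arrow lies in a subobject exactly
  when the cokernel of that subobject kills it, and vanishing may be checked after an epimorphism.
  Intersections, preimages and sums of subobjects therefore enter only as kernels and cokernels of
  explicit arrows.

  Coproducts are replaced by jointly epimorphic families, those for which an arrow killing every
  member is zero. This property passes to quotients, holds for coproducts in the ambient category as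
  well as for coproducts formed among the noetherian objects, and suffices to bound supports.

  Sets (i) and (ii) share one argument with a parameter \<open>N\<close>, the class of all objects
  or of the noetherian ones. The obstacle in (ii) is that its Serre conditions use the
  monomorphisms, epimorphisms and exact sequences of the subcategory itself; these can be compared
  with the ambient ones because kernels and cokernels of arrows between noetherian objects are again
  noetherian.\<close>

lemma Arr_in_Hom: "f \<in> Arr C \<Longrightarrow> f \<in> Hom C (Dom C f) (Cod C f)"
  by (simp add: Hom_def)

lemma HomD:
  assumes "f \<in> Hom C X Y"
  shows "f \<in> Arr C" "Dom C f = X" "Cod C f = Y" "X \<in> Obj C" "Y \<in> Obj C"
  using assms Dom_in_Obj Cod_in_Obj by (auto simp: Hom_def)

lemma mono_arr_iff:
  assumes "f \<in> Hom C X Y"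
  shows "mono_arr C f \<longleftrightarrow> (\<forall>W. \<forall>g \<in> Hom C W X. \<forall>h \<in> Hom C W X. f \<cdot> g = f \<cdot> h \<longrightarrow> g = h)"
  using HomD[OF assms] by (simp add: mono_arr_def)

lemma epi_arr_iff:
  assumes "f \<in> Hom C X Y"
  shows "epi_arr C f \<longleftrightarrow> (\<forall>Z. \<forall>g \<in> Hom C Y Z. \<forall>h \<in> Hom C Y Z. g \<cdot> f = h \<cdot> f \<longrightarrow> g = h)"
  using HomD[OF assms] by (simp add: epi_arr_def)

lemma mono_cancel:
  assumes "mono_arr C f" "f \<in> Hom C X Y" "g \<in> Hom C W X" "h \<in> Hom C W X" "f \<cdot> g = f \<cdot> h"
  shows "g = h"
  using assms mono_arr_iff by blast

lemma epi_cancel: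
  assumes "epi_arr C f" "f \<in> Hom C X Y" "g \<in> Hom C Y Z" "h \<in> Hom C Y Z" "g \<cdot> f = h \<cdot> f"
  shows "g = h"
  using assms epi_arr_iff by blast

lemma mono_comp:
  assumes "mono_arr C f" "mono_arr C g" "f \<in> Hom C X Y" "g \<in> Hom C Y Z"
  shows "mono_arr C (g \<cdot> f)"
  unfolding mono_arr_iff[OF Comp_in_Hom[OF assms(3,4)]]
proof (intro allI ballI impI)
  fix W u v assume uv: "u \<in> Hom C W X" "v \<in> Hom C W X" and "(g \<cdot> f) \<cdot> u = (g \<cdot> f) \<cdot> v"
  then have "g \<cdot> (f \<cdot> u) = g \<cdot> (f \<cdot> v)"
    using Comp_assoc[OF _ assms(3,4)] by auto
  then have "f \<cdot> u = f \<cdot> v"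
    using mono_cancel[OF assms(2,4)] Comp_in_Hom[OF _ assms(3)] uv by blast
  then show "u = v" using mono_cancel[OF assms(1,3)] uv by blast
qed

lemma epi_comp:
  assumes "epi_arr C f" "epi_arr C g" "f \<in> Hom C X Y" "g \<in> Hom C Y Z"
  shows "epi_arr C (g \<cdot> f)"
  unfolding epi_arr_iff[OF Comp_in_Hom[OF assms(3,4)]]
proof (intro allI ballI impI)
  fix W u v assume uv: "u \<in> Hom C Z W" "v \<in> Hom C Z W" and "u \<cdot> (g \<cdot> f) = v \<cdot> (g \<cdot> f)"
  then have "(u \<cdot> g) \<cdot> f = (v \<cdot> g) \<cdot> f"
    using Comp_assoc[OF assms(3,4)] by auto
  then have "u \<cdot> g = v \<cdot> g"
    using epi_cancel[OF assms(1,3)] Comp_in_Hom[OF assms(4)] uv by blast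
  then show "u = v" using epi_cancel[OF assms(2,4)] uv by blast
qed

lemma mono_of_comp:
  assumes "mono_arr C (g \<cdot> f)" "f \<in> Hom C X Y" "g \<in> Hom C Y Z"
  shows "mono_arr C f"
  unfolding mono_arr_iff[OF assms(2)]
proof (intro allI ballI impI)
  fix W u v assume uv: "u \<in> Hom C W X" "v \<in> Hom C W X" and "f \<cdot> u = f \<cdot> v"
  then have "(g \<cdot> f) \<cdot> u = (g \<cdot> f) \<cdot> v"
    using Comp_assoc[OF _ assms(2,3)] by auto
  then show "u = v" using mono_cancel[OF assms(1) Comp_in_Hom[OF assms(2,3)]] uv by blast
qed

lemma epi_of_comp:
  assumes "epi_arr C (g \<cdot> f)" "f \<in> Hom C X Y" "g \<in> Hom C Y Z"
  shows "epi_arr C g"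
  unfolding epi_arr_iff[OF assms(3)]
proof (intro allI ballI impI)
  fix W u v assume uv: "u \<in> Hom C Z W" "v \<in> Hom C Z W" and "u \<cdot> g = v \<cdot> g"
  then have "u \<cdot> (g \<cdot> f) = v \<cdot> (g \<cdot> f)"
    using Comp_assoc[OF assms(2,3)] by metis
  then show "u = v" using epi_cancel[OF assms(1) Comp_in_Hom[OF assms(2,3)]] uv by blast
qed

lemma iso_arr_iff:
  assumes "f \<in> Hom C X Y"
  shows "iso_arr C f \<longleftrightarrow> (\<exists>g \<in> Hom C Y X. g \<cdot> f = Ident C X \<and> f \<cdot> g = Ident C Y)"
  using HomD[OF assms] by (simp add: iso_arr_def)

lemma mono_Ident: "X \<in> Obj C \<Longrightarrow> mono_arr C (Ident C X)"
  unfolding mono_arr_iff[OF Ident_in_Hom] by (metis Ident_Comp)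

lemma epi_Ident: "X \<in> Obj C \<Longrightarrow> epi_arr C (Ident C X)"
  unfolding epi_arr_iff[OF Ident_in_Hom] by (metis Comp_Ident)

lemma iso_imp_mono: "iso_arr C f \<Longrightarrow> f \<in> Hom C X Y \<Longrightarrow> mono_arr C f"
  by (metis HomD(4) iso_arr_iff mono_Ident mono_of_comp)

lemma iso_imp_epi: "iso_arr C f \<Longrightarrow> f \<in> Hom C X Y \<Longrightarrow> epi_arr C f"
  by (metis HomD(5) iso_arr_iff epi_Ident epi_of_comp)

lemma iso_objE:
  assumes "iso_obj C X Y"
  obtains f where "f \<in> Hom C X Y" "mono_arr C f" "epi_arr C f" "iso_arr C f"
  using assms iso_imp_epi iso_imp_mono by (auto simp: iso_obj_def)

lemma iso_obj_sym: "iso_obj C X Y \<Longrightarrow> iso_obj C Y X"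
  unfolding iso_obj_def using iso_arr_iff by metis

lemma iso_obj_trans:
  assumes "iso_obj C X Y" "iso_obj C Y Z"
  shows "iso_obj C X Z"
proof -
  obtain f f' where f: "f \<in> Hom C X Y" "f' \<in> Hom C Y X" "f' \<cdot> f = Ident C X" "f \<cdot> f' = Ident C Y"
    using assms(1) iso_arr_iff by (auto simp: iso_obj_def)
  obtain g g' where g: "g \<in> Hom C Y Z" "g' \<in> Hom C Z Y" "g' \<cdot> g = Ident C Y" "g \<cdot> g' = Ident C Z"
    using assms(2) iso_arr_iff by (auto simp: iso_obj_def)
  have gf: "g \<cdot> f \<in> Hom C X Z" and fg: "f' \<cdot> g' \<in> Hom C Z X"
    using f g Comp_in_Hom by blast+
  have "(f' \<cdot> g') \<cdot> (g \<cdot> f) = f' \<cdot> (g' \<cdot> g) \<cdot> f"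
    using Comp_assoc[OF gf g(2) f(2)] Comp_assoc[OF f(1) g(1,2)] by simp
  then have 1: "(f' \<cdot> g') \<cdot> (g \<cdot> f) = Ident C X"
    using f g Ident_Comp by metis
  have "(g \<cdot> f) \<cdot> (f' \<cdot> g') = g \<cdot> (f \<cdot> f') \<cdot> g'"
    using Comp_assoc[OF fg f(1) g(1)] Comp_assoc[OF g(2) f(2,1)] by simp
  then have "(g \<cdot> f) \<cdot> (f' \<cdot> g') = Ident C Z"
    using f g Ident_Comp by metis
  with 1 gf fg show ?thesis
    unfolding iso_obj_def using iso_arr_iff by blast
qed

end

context abelian_category
begin

lemma zero_arr_comp_left:
  assumes "zero_arr C f" "f \<in> Hom C X Y" "g \<in> Hom C Y Z"
  shows "zero_arr C (g \<cdot> f)"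
proof -
  obtain N a b where N: "zero_obj C N" "a \<in> Hom C X N" "b \<in> Hom C N Y" "f = b \<cdot> a"
    using assms HomD by (metis zero_arr_def)
  then have "g \<cdot> f = (g \<cdot> b) \<cdot> a" "g \<cdot> b \<in> Hom C N Z"
    using Comp_assoc[OF _ _ assms(3)] Comp_in_Hom[OF _ assms(3)] by auto
  then show ?thesis
    using N HomD[OF Comp_in_Hom[OF assms(2,3)]] unfolding zero_arr_def by blast
qed

lemma zero_arr_comp_right:
  assumes "zero_arr C f" "f \<in> Hom C X Y" "g \<in> Hom C W X"
  shows "zero_arr C (f \<cdot> g)"
proof -
  obtain N a b where N: "zero_obj C N" "a \<in> Hom C X N" "b \<in> Hom C N Y" "f = b \<cdot> a"
    using assms HomD by (metis zero_arr_def)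
  then have "f \<cdot> g = b \<cdot> (a \<cdot> g)" "a \<cdot> g \<in> Hom C W N"
    using Comp_assoc[OF assms(3)] Comp_in_Hom[OF assms(3)] by auto
  then show ?thesis
    using N HomD[OF Comp_in_Hom[OF assms(3,2)]] unfolding zero_arr_def by blast
qed

lemma zero_arr_exists:
  assumes "X \<in> Obj C" "Y \<in> Obj C"
  obtains z where "z \<in> Hom C X Y" "zero_arr C z"
proof -
  obtain N where "zero_obj C N" using zero_obj_exists by blast
  then obtain a b where "a \<in> Hom C X N" "b \<in> Hom C N Y"
    using assms by (metis zero_obj_def)
  then show ?thesis
    using that[OF Comp_in_Hom[of a X N b Y]] \<open>zero_obj C N\<close> HomD[OF Comp_in_Hom[of a X N b Y]]
    unfolding zero_arr_def by metis
qed

lemma zero_obj_Hom_unique: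
  assumes "zero_obj C Z"
  shows "f \<in> Hom C X Z \<Longrightarrow> g \<in> Hom C X Z \<Longrightarrow> f = g"
    and "f \<in> Hom C Z X \<Longrightarrow> g \<in> Hom C Z X \<Longrightarrow> f = g"
  using assms HomD unfolding zero_obj_def by metis+

text \<open>The two arrows may factor through different zero objects; the unique arrow between these
  objects carries one factorization to the other.\<close>

lemma zero_arr_unique:
  assumes "zero_arr C f" "zero_arr C g" "f \<in> Hom C X Y" "g \<in> Hom C X Y"
  shows "f = g"
proof -
  obtain N a b where N: "zero_obj C N" "a \<in> Hom C X N" "b \<in> Hom C N Y" "f = b \<cdot> a"
    using assms HomD by (metis zero_arr_def)
  obtain P c d where P: "zero_obj C P" "c \<in> Hom C X P" "d \<in> Hom C P Y" "g = d \<cdot> c"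
    using assms HomD by (metis zero_arr_def)
  obtain u where u: "u \<in> Hom C N P"
    using N(1) P(1) by (metis zero_obj_def)
  have "u \<cdot> a = c" "d \<cdot> u = b"
    using zero_obj_Hom_unique N P u Comp_in_Hom by metis+
  then show ?thesis
    using N P u Comp_assoc by metis
qed

lemma zero_arr_zero_obj:
  assumes "zero_obj C X" "f \<in> Hom C X Y"
  shows "zero_arr C f"
  using assms HomD zero_arr_exists zero_obj_Hom_unique(2) by metis

lemma zero_arr_zero_obj':
  assumes "zero_obj C Y" "f \<in> Hom C X Y"
  shows "zero_arr C f"
  using assms HomD zero_arr_exists zero_obj_Hom_unique(1) by metis

text \<open>Composing with an identity that is zero makes every arrow into or out of
  \<open>X\<close> zero, so each of these Hom sets has exactly one element.\<close>

lemma zero_obj_iff_Ident: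
  assumes "X \<in> Obj C"
  shows "zero_obj C X \<longleftrightarrow> zero_arr C (Ident C X)"
proof
  assume "zero_obj C X"
  then show "zero_arr C (Ident C X)"
    using zero_arr_zero_obj Ident_in_Hom assms by blast
next
  assume z: "zero_arr C (Ident C X)"
  have l: "zero_arr C f" if "f \<in> Hom C X Y" for f Y
    using zero_arr_comp_left[OF z Ident_in_Hom[OF assms] that] Comp_Ident[OF that] by simp
  have r: "zero_arr C f" if "f \<in> Hom C Y X" for f Y
    using zero_arr_comp_right[OF z Ident_in_Hom[OF assms] that] Ident_Comp[OF that] by simp
  show "zero_obj C X"
    unfolding zero_obj_def
  proof (intro conjI ballI)
    fix Y assume Y: "Y \<in> Obj C"
    obtain a where a: "a \<in> Hom C X Y" "zero_arr C a" using zero_arr_exists[OF assms Y] .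
    obtain b where b: "b \<in> Hom C Y X" "zero_arr C b" using zero_arr_exists[OF Y assms] .
    show "\<exists>!f. f \<in> Hom C Y X" using b r zero_arr_unique by blast
    show "\<exists>!f. f \<in> Hom C X Y" using a l zero_arr_unique by blast
  qed (rule assms)
qed

section \<open>Subtraction of arrows and tests by vanishing\<close>

text \<open>Subtraction is the part of the additive structure that later proofs call on, and only to
  turn an equation of arrows into the vanishing of a single arrow.\<close>

lemma Hom_difference:
  obtains d where
    "\<And>X Y f g. f \<in> Hom C X Y \<Longrightarrow> g \<in> Hom C X Y \<Longrightarrow> d f g \<in> Hom C X Y"
    "\<And>X Y f g. f \<in> Hom C X Y \<Longrightarrow> g \<in> Hom C X Y \<Longrightarrow> zero_arr C (d f g) \<longleftrightarrow> f = g"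
    "\<And>X Y Z f g h. f \<in> Hom C X Y \<Longrightarrow> g \<in> Hom C X Y \<Longrightarrow> h \<in> Hom C Y Z \<Longrightarrow>
       h \<cdot> d f g = d (h \<cdot> f) (h \<cdot> g)"
    "\<And>W X Y f g h. f \<in> Hom C X Y \<Longrightarrow> g \<in> Hom C X Y \<Longrightarrow> h \<in> Hom C W X \<Longrightarrow>
       d f g \<cdot> h = d (f \<cdot> h) (g \<cdot> h)"
proof -
  obtain add where add: "preadditive_structure C add"
    using preadditive by blast
  then obtain z where z: "\<And>X Y. X \<in> Obj C \<Longrightarrow> Y \<in> Obj C \<Longrightarrow>
      comm_group \<lparr>carrier = Hom C X Y, mult = add, one = z X Y\<rparr>"
    unfolding preadditive_structure_def by metis
  define H where "H X Y = \<lparr>carrier = Hom C X Y, mult = add, one = z X Y\<rparr>" for X Y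
  have sel: "carrier (H X Y) = Hom C X Y" "mult (H X Y) = add" "one (H X Y) = z X Y" for X Y
    by (simp_all add: H_def)
  have grp: "group (H X Y)" if "f \<in> Hom C X Y" for f X Y
    using z[of X Y] HomD[OF that] unfolding H_def by (simp add: comm_group_def)
  have distl: "h \<cdot> add f g = add (h \<cdot> f) (h \<cdot> g)"
    if "f \<in> Hom C X Y" "g \<in> Hom C X Y" "h \<in> Hom C Y Z" for f g h X Y Z
    using add that unfolding preadditive_structure_def by blast
  have distr: "add f g \<cdot> h = add (f \<cdot> h) (g \<cdot> h)"
    if "f \<in> Hom C X Y" "g \<in> Hom C X Y" "h \<in> Hom C W X" for f g h X Y W
    using add that unfolding preadditive_structure_def by blast
  have oneH: "z X Y \<in> Hom C X Y" if "X \<in> Obj C" "Y \<in> Obj C" for X Y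
    using z[OF that] comm_group.axioms(2) group.is_monoid monoid.one_closed by fastforce
  \<comment> \<open>An idempotent of a group is its unit. By distributivity a composite with a unit
    is idempotent, which is how \<open>zl\<close> and \<open>zr\<close> follow.\<close>
  have idem: "f = z X Y" if "f \<in> Hom C X Y" "add f f = f" for f X Y
    using group.l_cancel_one[OF grp[OF that(1)], of f f] that by (simp add: sel)
  have add1: "add (z X Y) (z X Y) = z X Y" if "X \<in> Obj C" "Y \<in> Obj C" for X Y
    using monoid.l_one[OF group.is_monoid[OF grp[OF oneH[OF that]]], of "z X Y"] oneH[OF that]
    by (simp add: sel)
  have zl: "h \<cdot> z X Y = z X Z" if "h \<in> Hom C Y Z" "X \<in> Obj C" for h X Y Z
  proof (rule idem)
    show "h \<cdot> z X Y \<in> Hom C X Z"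
      using that oneH HomD(4)[OF that(1)] Comp_in_Hom by blast
    show "add (h \<cdot> z X Y) (h \<cdot> z X Y) = h \<cdot> z X Y"
      using distl[OF oneH oneH that(1)] add1 HomD(4)[OF that(1)] that by metis
  qed
  have zr: "z X Y \<cdot> h = z W Y" if "h \<in> Hom C W X" "Y \<in> Obj C" for h W X Y
  proof (rule idem)
    show "z X Y \<cdot> h \<in> Hom C W Y"
      using that oneH HomD(5)[OF that(1)] Comp_in_Hom by blast
    show "add (z X Y \<cdot> h) (z X Y \<cdot> h) = z X Y \<cdot> h"
      using distr[OF oneH oneH that(1)] add1 HomD(5)[OF that(1)] that by metis
  qed
  \<comment> \<open>Ties the group units to the categorical zero arrows: \<open>z X Y\<close> is
    \<open>z N Y\<close> composed with \<open>z X N\<close>, so it factors through the zero object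
    \<open>N\<close>.\<close>
  have zero: "zero_arr C f \<longleftrightarrow> f = z X Y" if f: "f \<in> Hom C X Y" for f X Y
  proof -
    obtain N where N: "zero_obj C N" "N \<in> Obj C" using zero_obj_exists by (auto simp: zero_obj_def)
    have XY: "X \<in> Obj C" "Y \<in> Obj C" using HomD[OF f] by auto
    have "zero_arr C (z N Y)"
      using zero_arr_zero_obj N oneH XY by blast
    then have "zero_arr C (z N Y \<cdot> z X N)"
      using zero_arr_comp_right oneH N XY by blast
    then have "zero_arr C (z X Y)"
      using zl[OF oneH[OF N(2) XY(2)] XY(1)] by simp
    then show ?thesis
      using zero_arr_unique f oneH XY by blast
  qed
  \<comment> \<open>The Hom group is read off from the domain and codomain, so that
    \<open>neg\<close> depends on the arrow alone.\<close>
  define neg where "neg f = inv\<^bsub>H (Dom C f) (Cod C f)\<^esub> f" for f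
  have neg: "neg f \<in> Hom C X Y" "add f (neg f) = z X Y" if "f \<in> Hom C X Y" for f X Y
    using group.inv_closed[OF grp[OF that], of f] group.r_inv[OF grp[OF that], of f] HomD[OF that] that
    by (simp_all add: sel neg_def)
  have neg_unique: "g = neg f" if "f \<in> Hom C X Y" "g \<in> Hom C X Y" "add f g = z X Y" for f g X Y
  proof -
    have "add f g = add f (neg f)" using that neg by metis
    then show ?thesis
      using monoid.Units_l_cancel[OF group.is_monoid[OF grp[OF that(1)]], of f g "neg f"]
        group.Units_eq[OF grp[OF that(1)]] neg[OF that(1)] that
      by (simp add: sel)
  qed
  have negneg: "neg (neg f) = f" if "f \<in> Hom C X Y" for f X Y
    using group.inv_inv[OF grp[OF that], of f] HomD[OF that] HomD[OF neg(1)[OF that]] that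
    by (simp add: neg_def sel)
  have negl: "h \<cdot> neg f = neg (h \<cdot> f)" if "f \<in> Hom C X Y" "h \<in> Hom C Y Z" for f h X Y Z
  proof (rule neg_unique)
    show "h \<cdot> f \<in> Hom C X Z" "h \<cdot> neg f \<in> Hom C X Z"
      using that neg(1) Comp_in_Hom by blast+
    show "add (h \<cdot> f) (h \<cdot> neg f) = z X Z"
      using distl[OF that(1) neg(1)[OF that(1)] that(2)] neg(2)[OF that(1)] zl[OF that(2)]
        HomD(4)[OF that(1)] by simp
  qed
  have negr: "neg f \<cdot> h = neg (f \<cdot> h)" if "f \<in> Hom C X Y" "h \<in> Hom C W X" for f h W X Y
  proof (rule neg_unique)
    show "f \<cdot> h \<in> Hom C W Y" "neg f \<cdot> h \<in> Hom C W Y"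
      using that neg(1) Comp_in_Hom by blast+
    show "add (f \<cdot> h) (neg f \<cdot> h) = z W Y"
      using distr[OF that(1) neg(1)[OF that(1)] that(2)] neg(2)[OF that(1)] zr[OF that(2)]
        HomD(5)[OF that(1)] by simp
  qed
  have addH: "add f g \<in> Hom C X Y" if "f \<in> Hom C X Y" "g \<in> Hom C X Y" for f g X Y
    using monoid.m_closed[OF group.is_monoid[OF grp[OF that(1)]], of f g] that by (simp add: sel)
  show thesis
  proof (rule that[of "\<lambda>f g. add f (neg g)"])
    fix X Y f g assume fg: "f \<in> Hom C X Y" "g \<in> Hom C X Y"
    show "add f (neg g) \<in> Hom C X Y" using fg addH neg by blast
    then show "zero_arr C (add f (neg g)) \<longleftrightarrow> f = g"
      using fg neg neg_unique negneg zero by metis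
  next
    fix X Y Z f g h assume "f \<in> Hom C X Y" "g \<in> Hom C X Y" "h \<in> Hom C Y Z"
    then show "h \<cdot> add f (neg g) = add (h \<cdot> f) (neg (h \<cdot> g))"
      using distl[OF _ neg(1)] negl by metis
  next
    fix W X Y f g h assume "f \<in> Hom C X Y" "g \<in> Hom C X Y" "h \<in> Hom C W X"
    then show "add f (neg g) \<cdot> h = add (f \<cdot> h) (neg (g \<cdot> h))"
      using distr[OF _ neg(1)] negr by metis
  qed
qed

text \<open>An arrow identifies \<open>g\<close> and \<open>h\<close> exactly when it kills their
  difference, so cancellation only has to be tested against zero.\<close>

lemma mono_iff_zero:
  assumes "f \<in> Hom C X Y"
  shows "mono_arr C f \<longleftrightarrow> (\<forall>W. \<forall>g \<in> Hom C W X. zero_arr C (f \<cdot> g) \<longrightarrow> zero_arr C g)"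
proof
  assume m: "mono_arr C f"
  show "\<forall>W. \<forall>g \<in> Hom C W X. zero_arr C (f \<cdot> g) \<longrightarrow> zero_arr C g"
  proof (intro allI ballI impI)
    fix W g assume g: "g \<in> Hom C W X" "zero_arr C (f \<cdot> g)"
    obtain z where z: "z \<in> Hom C W X" "zero_arr C z"
      using HomD[OF g(1)] zero_arr_exists by blast
    have "f \<cdot> g = f \<cdot> z"
      by (rule zero_arr_unique[OF g(2) zero_arr_comp_left[OF z(2,1) assms]
            Comp_in_Hom[OF g(1) assms] Comp_in_Hom[OF z(1) assms]])
    then show "zero_arr C g" using mono_cancel[OF m assms g(1) z(1)] z by simp
  qed
next
  assume *: "\<forall>W. \<forall>g \<in> Hom C W X. zero_arr C (f \<cdot> g) \<longrightarrow> zero_arr C g"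
  obtain d where d:
    "\<And>X Y f g. f \<in> Hom C X Y \<Longrightarrow> g \<in> Hom C X Y \<Longrightarrow> d f g \<in> Hom C X Y"
    "\<And>X Y f g. f \<in> Hom C X Y \<Longrightarrow> g \<in> Hom C X Y \<Longrightarrow> zero_arr C (d f g) \<longleftrightarrow> f = g"
    "\<And>X Y Z f g h. f \<in> Hom C X Y \<Longrightarrow> g \<in> Hom C X Y \<Longrightarrow> h \<in> Hom C Y Z \<Longrightarrow>
       h \<cdot> d f g = d (h \<cdot> f) (h \<cdot> g)"
    "\<And>W X Y f g h. f \<in> Hom C X Y \<Longrightarrow> g \<in> Hom C X Y \<Longrightarrow> h \<in> Hom C W X \<Longrightarrow>
       d f g \<cdot> h = d (f \<cdot> h) (g \<cdot> h)"
    by (fact Hom_difference)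
  show "mono_arr C f"
    unfolding mono_arr_iff[OF assms]
  proof (intro allI ballI impI)
    fix W g h assume g: "g \<in> Hom C W X" and h: "h \<in> Hom C W X" and "f \<cdot> g = f \<cdot> h"
    then have "zero_arr C (d (f \<cdot> g) (f \<cdot> h))"
      using d(2)[OF Comp_in_Hom[OF g assms] Comp_in_Hom[OF h assms]] by simp
    then have "zero_arr C (f \<cdot> d g h)"
      by (simp only: d(3)[OF g h assms])
    then have "zero_arr C (d g h)"
      using * d(1)[OF g h] by blast
    then show "g = h" using d(2)[OF g h] by blast
  qed
qed

lemma epi_iff_zero:
  assumes "f \<in> Hom C X Y"
  shows "epi_arr C f \<longleftrightarrow> (\<forall>Z. \<forall>g \<in> Hom C Y Z. zero_arr C (g \<cdot> f) \<longrightarrow> zero_arr C g)"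
proof
  assume m: "epi_arr C f"
  show "\<forall>Z. \<forall>g \<in> Hom C Y Z. zero_arr C (g \<cdot> f) \<longrightarrow> zero_arr C g"
  proof (intro allI ballI impI)
    fix Z g assume g: "g \<in> Hom C Y Z" "zero_arr C (g \<cdot> f)"
    obtain z where z: "z \<in> Hom C Y Z" "zero_arr C z"
      using HomD[OF g(1)] zero_arr_exists by blast
    have "g \<cdot> f = z \<cdot> f"
      by (rule zero_arr_unique[OF g(2) zero_arr_comp_right[OF z(2,1) assms]
            Comp_in_Hom[OF assms g(1)] Comp_in_Hom[OF assms z(1)]])
    then show "zero_arr C g" using epi_cancel[OF m assms g(1) z(1)] z by simp
  qed
next
  assume *: "\<forall>Z. \<forall>g \<in> Hom C Y Z. zero_arr C (g \<cdot> f) \<longrightarrow> zero_arr C g"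
  obtain d where d:
    "\<And>X Y f g. f \<in> Hom C X Y \<Longrightarrow> g \<in> Hom C X Y \<Longrightarrow> d f g \<in> Hom C X Y"
    "\<And>X Y f g. f \<in> Hom C X Y \<Longrightarrow> g \<in> Hom C X Y \<Longrightarrow> zero_arr C (d f g) \<longleftrightarrow> f = g"
    "\<And>X Y Z f g h. f \<in> Hom C X Y \<Longrightarrow> g \<in> Hom C X Y \<Longrightarrow> h \<in> Hom C Y Z \<Longrightarrow>
       h \<cdot> d f g = d (h \<cdot> f) (h \<cdot> g)"
    "\<And>W X Y f g h. f \<in> Hom C X Y \<Longrightarrow> g \<in> Hom C X Y \<Longrightarrow> h \<in> Hom C W X \<Longrightarrow>
       d f g \<cdot> h = d (f \<cdot> h) (g \<cdot> h)"
    by (fact Hom_difference)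
  show "epi_arr C f"
    unfolding epi_arr_iff[OF assms]
  proof (intro allI ballI impI)
    fix W g h assume g: "g \<in> Hom C Y W" and h: "h \<in> Hom C Y W" and "g \<cdot> f = h \<cdot> f"
    then have "zero_arr C (d (g \<cdot> f) (h \<cdot> f))"
      using d(2)[OF Comp_in_Hom[OF assms g] Comp_in_Hom[OF assms h]] by simp
    then have "zero_arr C (d g h \<cdot> f)"
      by (simp only: d(4)[OF g h assms])
    then have "zero_arr C (d g h)"
      using * d(1)[OF g h] by blast
    then show "g = h" using d(2)[OF g h] by blast
  qed
qed

lemma mono_zero_cancel:
  "mono_arr C f \<Longrightarrow> f \<in> Hom C X Y \<Longrightarrow> g \<in> Hom C W X \<Longrightarrow> zero_arr C (f \<cdot> g) \<Longrightarrow> zero_arr C g"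
  using mono_iff_zero by blast

lemma epi_zero_cancel:
  "epi_arr C f \<Longrightarrow> f \<in> Hom C X Y \<Longrightarrow> g \<in> Hom C Y Z \<Longrightarrow> zero_arr C (g \<cdot> f) \<Longrightarrow> zero_arr C g"
  using epi_iff_zero by blast

end

section \<open>Kernels, images and lifting along epimorphisms\<close>

context abelian_category
begin

lemma is_kernelD:
  assumes "is_kernel C f k" "f \<in> Hom C X Y"
  shows "k \<in> Hom C (Dom C k) X" "zero_arr C (f \<cdot> k)" "mono_arr C k"
    and "h \<in> Hom C W X \<Longrightarrow> zero_arr C (f \<cdot> h) \<Longrightarrow> \<exists>u \<in> Hom C W (Dom C k). k \<cdot> u = h"
proof -
  have f: "Dom C f = X" using HomD assms(2) by auto
  then show k: "k \<in> Hom C (Dom C k) X" "zero_arr C (f \<cdot> k)"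
    using assms(1) by (auto simp: is_kernel_def Hom_def)
  have uniq: "\<exists>!u. u \<in> Hom C W (Dom C k) \<and> k \<cdot> u = h"
    if "h \<in> Hom C W X" "zero_arr C (f \<cdot> h)" for h W
    using assms(1) that f by (auto simp: is_kernel_def)
  show "\<exists>u \<in> Hom C W (Dom C k). k \<cdot> u = h" if "h \<in> Hom C W X" "zero_arr C (f \<cdot> h)" for h W
    using uniq[OF that] by blast
  show "mono_arr C k"
    unfolding mono_arr_iff[OF k(1)]
  proof (intro allI ballI impI)
    fix W g h assume g: "g \<in> Hom C W (Dom C k)" and h: "h \<in> Hom C W (Dom C k)" and eq: "k \<cdot> g = k \<cdot> h"
    have "zero_arr C ((f \<cdot> k) \<cdot> g)"
      using zero_arr_comp_right k g Comp_in_Hom[OF k(1) assms(2)] by blast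
    then have "zero_arr C (f \<cdot> (k \<cdot> g))"
      using Comp_assoc[OF g k(1) assms(2)] by simp
    then show "g = h"
      using uniq[OF Comp_in_Hom[OF g k(1)]] g h eq by metis
  qed
qed

lemma is_cokernelD:
  assumes "is_cokernel C f q" "f \<in> Hom C X Y"
  shows "q \<in> Hom C Y (Cod C q)" "zero_arr C (q \<cdot> f)" "epi_arr C q"
    and "h \<in> Hom C Y Z \<Longrightarrow> zero_arr C (h \<cdot> f) \<Longrightarrow> \<exists>u \<in> Hom C (Cod C q) Z. u \<cdot> q = h"
proof -
  have f: "Cod C f = Y" using HomD assms(2) by auto
  then show k: "q \<in> Hom C Y (Cod C q)" "zero_arr C (q \<cdot> f)"
    using assms(1) by (auto simp: is_cokernel_def Hom_def)
  have uniq: "\<exists>!u. u \<in> Hom C (Cod C q) W \<and> u \<cdot> q = h"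
    if "h \<in> Hom C Y W" "zero_arr C (h \<cdot> f)" for h W
    using assms(1) that f by (auto simp: is_cokernel_def)
  show "\<exists>u \<in> Hom C (Cod C q) W. u \<cdot> q = h" if "h \<in> Hom C Y W" "zero_arr C (h \<cdot> f)" for h W
    using uniq[OF that] by blast
  show "epi_arr C q"
    unfolding epi_arr_iff[OF k(1)]
  proof (intro allI ballI impI)
    fix W g h assume g: "g \<in> Hom C (Cod C q) W" and h: "h \<in> Hom C (Cod C q) W"
      and eq: "g \<cdot> q = h \<cdot> q"
    have "zero_arr C (g \<cdot> (q \<cdot> f))"
      using zero_arr_comp_left k g Comp_in_Hom[OF assms(2) k(1)] by blast
    then have "zero_arr C ((g \<cdot> q) \<cdot> f)"
      using Comp_assoc[OF assms(2) k(1) g] by simp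
    then show "g = h"
      using uniq[OF Comp_in_Hom[OF k(1) g]] g h eq by metis
  qed
qed

lemma is_kernelI:
  assumes f: "f \<in> Hom C X Y" and k: "k \<in> Hom C K X" "mono_arr C k" "zero_arr C (f \<cdot> k)"
    and ex: "\<And>W h. h \<in> Hom C W X \<Longrightarrow> zero_arr C (f \<cdot> h) \<Longrightarrow> \<exists>u \<in> Hom C W K. k \<cdot> u = h"
  shows "is_kernel C f k"
  unfolding is_kernel_def HomD[OF f] HomD[OF k(1)]
  using HomD[OF f] HomD[OF k(1)] k ex mono_cancel[OF k(2,1)] by blast

lemma is_cokernelI:
  assumes f: "f \<in> Hom C X Y" and q: "q \<in> Hom C Y Q" "epi_arr C q" "zero_arr C (q \<cdot> f)"
    and ex: "\<And>Z h. h \<in> Hom C Y Z \<Longrightarrow> zero_arr C (h \<cdot> f) \<Longrightarrow> \<exists>u \<in> Hom C Q Z. u \<cdot> q = h"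
  shows "is_cokernel C f q"
  unfolding is_cokernel_def HomD[OF f] HomD[OF q(1)]
  using HomD[OF f] HomD[OF q(1)] q ex epi_cancel[OF q(2,1)] by blast

lemma kernelE:
  assumes "f \<in> Hom C X Y"
  obtains K k where "k \<in> Hom C K X" "mono_arr C k" "zero_arr C (f \<cdot> k)" "is_kernel C f k"
    "\<And>W h. h \<in> Hom C W X \<Longrightarrow> zero_arr C (f \<cdot> h) \<Longrightarrow> \<exists>u \<in> Hom C W K. k \<cdot> u = h"
proof -
  obtain k where k: "is_kernel C f k" using kernels HomD[OF assms] by blast
  show ?thesis using is_kernelD[OF k assms] k by (intro that)
qed

lemma cokernelE:
  assumes "f \<in> Hom C X Y"
  obtains Q q where "q \<in> Hom C Y Q" "epi_arr C q" "zero_arr C (q \<cdot> f)" "is_cokernel C f q"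
    "\<And>Z h. h \<in> Hom C Y Z \<Longrightarrow> zero_arr C (h \<cdot> f) \<Longrightarrow> \<exists>u \<in> Hom C Q Z. u \<cdot> q = h"
proof -
  obtain q where q: "is_cokernel C f q" using cokernels HomD[OF assms] by blast
  show ?thesis using is_cokernelD[OF q assms] q by (intro that)
qed

lemma zero_arr_assoc:
  assumes "f \<in> Hom C W X" "g \<in> Hom C X Y" "h \<in> Hom C Y Z"
  shows "zero_arr C (h \<cdot> g) \<Longrightarrow> zero_arr C (h \<cdot> (g \<cdot> f))"
    and "zero_arr C (g \<cdot> f) \<Longrightarrow> zero_arr C ((h \<cdot> g) \<cdot> f)"
proof -
  show "zero_arr C (h \<cdot> (g \<cdot> f))" if "zero_arr C (h \<cdot> g)"
    using zero_arr_comp_right[OF that Comp_in_Hom[OF assms(2,3)] assms(1)] Comp_assoc[OF assms] by simp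
  show "zero_arr C ((h \<cdot> g) \<cdot> f)" if "zero_arr C (g \<cdot> f)"
    using zero_arr_comp_left[OF that Comp_in_Hom[OF assms(1,2)] assms(3)] Comp_assoc[OF assms] by simp
qed

text \<open>Normality supplies only some arrow \<open>g\<close> with kernel \<open>m\<close>. As
  \<open>g\<close> kills \<open>m\<close>, it factors through \<open>c\<close>; hence whatever
  \<open>c\<close> kills is killed by \<open>g\<close> and factors through \<open>m\<close>.\<close>

lemma mono_is_kernel_of_cokernel:
  assumes m: "m \<in> Hom C K X" "mono_arr C m" and c: "is_cokernel C m c"
  shows "is_kernel C c m"
proof -
  note cD = is_cokernelD[OF c m(1)]
  obtain g where "is_kernel C g m" using mono_normal[OF m(2)] by blast
  moreover from this have "g \<in> Hom C X (Cod C g)"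
    using HomD(3)[OF m(1)] by (auto simp: is_kernel_def Hom_def)
  ultimately obtain Y where g: "g \<in> Hom C X Y" "is_kernel C g m" by blast
  note gD = is_kernelD[OF g(2,1), unfolded HomD[OF m(1)]]
  obtain u where u: "u \<in> Hom C (Cod C c) Y" "u \<cdot> c = g" using cD(4)[OF g(1) gD(2)] by blast
  show ?thesis
  proof (rule is_kernelI[OF cD(1) m cD(2)])
    fix W h assume h: "h \<in> Hom C W X" "zero_arr C (c \<cdot> h)"
    then have "zero_arr C (g \<cdot> h)" using zero_arr_assoc(2)[OF h(1) cD(1) u(1)] u by simp
    then show "\<exists>u \<in> Hom C W K. m \<cdot> u = h" using gD(4)[OF h(1)] by blast
  qed
qed

lemma epi_is_cokernel_of_kernel:
  assumes e: "e \<in> Hom C X Y" "epi_arr C e" and k: "is_kernel C e k"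
  shows "is_cokernel C k e"
proof -
  note kD = is_kernelD[OF k e(1)]
  obtain g where "is_cokernel C g e" using epi_normal[OF e(2)] by blast
  moreover from this have "g \<in> Hom C (Dom C g) X"
    using HomD(2)[OF e(1)] by (auto simp: is_cokernel_def Hom_def)
  ultimately obtain W where g: "g \<in> Hom C W X" "is_cokernel C g e" by blast
  note gD = is_cokernelD[OF g(2,1), unfolded HomD[OF e(1)]]
  obtain u where u: "u \<in> Hom C W (Dom C k)" "k \<cdot> u = g" using kD(4)[OF g(1) gD(2)] by blast
  show ?thesis
  proof (rule is_cokernelI[OF kD(1) e kD(2)])
    fix Z h assume h: "h \<in> Hom C X Z" "zero_arr C (h \<cdot> k)"
    then have "zero_arr C (h \<cdot> g)" using zero_arr_assoc(1)[OF u(1) kD(1) h(1)] u by simp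
    then show "\<exists>u \<in> Hom C Y Z. u \<cdot> e = h" using gD(4)[OF h(1)] by blast
  qed
qed

text \<open>A monomorphism is the kernel of its cokernel, so lying in the subobject \<open>m\<close>
  means vanishing in the quotient. This is the substitute for elementwise membership in the later
  chases.\<close>

lemma mono_factor_iff_zero:
  assumes m: "m \<in> Hom C K X" "mono_arr C m" and c: "is_cokernel C m c" and h: "h \<in> Hom C W X"
  shows "(\<exists>u \<in> Hom C W K. m \<cdot> u = h) \<longleftrightarrow> zero_arr C (c \<cdot> h)"
proof
  note cD = is_cokernelD[OF c m(1)]
  note kD = is_kernelD[OF mono_is_kernel_of_cokernel[OF m c] cD(1)]
  show "zero_arr C (c \<cdot> h)" if "\<exists>u \<in> Hom C W K. m \<cdot> u = h"
    using that zero_arr_assoc(1)[OF _ m(1) cD(1) cD(2)] by blast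
  show "\<exists>u \<in> Hom C W K. m \<cdot> u = h" if "zero_arr C (c \<cdot> h)"
    using kD(4)[OF h that] HomD[OF m(1)] by simp
qed

text \<open>\<open>c\<close> plays the part of a cokernel of the whole family, and its kernel
  \<open>m\<close> is the sum of the images. If \<open>u\<close> kills every \<open>e i\<close>, the
  subobject \<open>m \<cdot> k\<close> cut out by the kernel \<open>k\<close> of \<open>u\<close>
  still contains every \<open>f i\<close>, so it is all of \<open>m\<close>.\<close>

lemma family_image:
  assumes f: "\<And>i. i \<in> J \<Longrightarrow> f i \<in> Hom C (F i) N"
    and c: "c \<in> Hom C N Q" "\<And>i. i \<in> J \<Longrightarrow> zero_arr C (c \<cdot> f i)"
    and univ: "\<And>Y g. g \<in> Hom C N Y \<Longrightarrow> (\<And>i. i \<in> J \<Longrightarrow> zero_arr C (g \<cdot> f i)) \<Longrightarrow>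
      \<exists>u \<in> Hom C Q Y. u \<cdot> c = g"
    and m: "is_kernel C c m" "m \<in> Hom C K N"
  obtains e where "\<And>i. i \<in> J \<Longrightarrow> e i \<in> Hom C (F i) K" "\<And>i. i \<in> J \<Longrightarrow> m \<cdot> e i = f i"
    "\<And>Y u. u \<in> Hom C K Y \<Longrightarrow> (\<And>i. i \<in> J \<Longrightarrow> zero_arr C (u \<cdot> e i)) \<Longrightarrow> zero_arr C u"
proof -
  note mD = is_kernelD[OF m(1) c(1), unfolded HomD[OF m(2)]]
  have "\<forall>i \<in> J. \<exists>e. e \<in> Hom C (F i) K \<and> m \<cdot> e = f i"
    using mD(4)[OF f c(2)] by blast
  then obtain e where e: "\<And>i. i \<in> J \<Longrightarrow> e i \<in> Hom C (F i) K" "\<And>i. i \<in> J \<Longrightarrow> m \<cdot> e i = f i"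
    by metis
  have "zero_arr C u" if u: "u \<in> Hom C K Y" and z: "\<And>i. i \<in> J \<Longrightarrow> zero_arr C (u \<cdot> e i)" for u Y
  proof -
    obtain L k where k: "k \<in> Hom C L K" "mono_arr C k" "zero_arr C (u \<cdot> k)"
      "\<And>W h. h \<in> Hom C W K \<Longrightarrow> zero_arr C (u \<cdot> h) \<Longrightarrow> \<exists>v \<in> Hom C W L. k \<cdot> v = h"
      using kernelE[OF u] by metis
    have mk: "m \<cdot> k \<in> Hom C L N" "mono_arr C (m \<cdot> k)"
      using Comp_in_Hom[OF k(1) m(2)] mono_comp[OF k(2) mD(3) k(1) m(2)] by auto
    obtain R g where g: "g \<in> Hom C N R" "zero_arr C (g \<cdot> (m \<cdot> k))" "is_cokernel C (m \<cdot> k) g"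
      using cokernelE[OF mk(1)] by metis
    have "zero_arr C (g \<cdot> f i)" if i: "i \<in> J" for i
    proof -
      obtain v where v: "v \<in> Hom C (F i) L" "k \<cdot> v = e i" using k(4)[OF e(1) z] i by blast
      have "(m \<cdot> k) \<cdot> v = f i" using Comp_assoc[OF v(1) k(1) m(2)] v e(2) i by simp
      then show ?thesis using mono_factor_iff_zero[OF mk g(3) f[OF i]] v(1) by blast
    qed
    \<comment> \<open>\<open>g\<close> is the quotient by \<open>m \<cdot> k\<close>. Killing the
      family, it factors through \<open>c\<close> and so kills \<open>m\<close>; then
      \<open>m\<close> factors through \<open>m \<cdot> k\<close>, which gives \<open>k\<close> a
      right inverse.\<close>
    then obtain w where w: "w \<in> Hom C Q R" "w \<cdot> c = g" using univ[OF g(1)] by blast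
    have "zero_arr C (g \<cdot> m)" using zero_arr_assoc(2)[OF m(2) c(1) w(1) mD(2)] w by simp
    then obtain s where s: "s \<in> Hom C K L" "(m \<cdot> k) \<cdot> s = m"
      using mono_factor_iff_zero[OF mk g(3) m(2)] by blast
    have I: "Ident C K \<in> Hom C K K" using Ident_in_Hom HomD[OF m(2)] by simp
    have "m \<cdot> (k \<cdot> s) = m \<cdot> Ident C K"
      using Comp_assoc[OF s(1) k(1) m(2)] s Comp_Ident[OF m(2)] by simp
    then have "k \<cdot> s = Ident C K"
      using mono_cancel[OF mD(3) m(2) Comp_in_Hom[OF s(1) k(1)] I] by blast
    then have "u = (u \<cdot> k) \<cdot> s" using Comp_assoc[OF s(1) k(1) u] Comp_Ident[OF u] by simp
    then show ?thesis using zero_arr_comp_right[OF k(3) Comp_in_Hom[OF k(1) u] s(1)] by simp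
  qed
  with e show ?thesis using that by blast
qed

text \<open>The case of a family with one member, indexed by the unit type; joint epimorphy then
  says that \<open>e\<close> is epi.\<close>

lemma imageE:
  assumes f: "f \<in> Hom C X Y"
  obtains I e m where "e \<in> Hom C X I" "epi_arr C e" "m \<in> Hom C I Y" "mono_arr C m" "m \<cdot> e = f"
proof -
  obtain Q c where c: "c \<in> Hom C Y Q" "zero_arr C (c \<cdot> f)"
    "\<And>Z h. h \<in> Hom C Y Z \<Longrightarrow> zero_arr C (h \<cdot> f) \<Longrightarrow> \<exists>u \<in> Hom C Q Z. u \<cdot> c = h"
    using cokernelE[OF f] by metis
  obtain K m where m: "m \<in> Hom C K Y" "mono_arr C m" "is_kernel C c m"
    using kernelE[OF c(1)] by metis
  obtain e where e: "\<And>i. i \<in> {()} \<Longrightarrow> e i \<in> Hom C X K" "\<And>i. i \<in> {()} \<Longrightarrow> m \<cdot> e i = f"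
    "\<And>Y u. u \<in> Hom C K Y \<Longrightarrow> (\<And>i. i \<in> {()} \<Longrightarrow> zero_arr C (u \<cdot> e i)) \<Longrightarrow> zero_arr C u"
    using family_image[of "{()}" "\<lambda>_. f" "\<lambda>_. X" Y c Q m K] f c m by auto
  have e1: "e () \<in> Hom C X K" "m \<cdot> e () = f" using e by auto
  moreover have "epi_arr C (e ())"
    unfolding epi_iff_zero[OF e1(1)] using e(3) by auto
  ultimately show ?thesis using that m by blast
qed

text \<open>The pullback of \<open>e\<close> and \<open>y\<close>, realized as the kernel of the
  difference of \<open>e \<cdot> \<pi>X\<close> and \<open>y \<cdot> \<pi>W\<close> on the coproduct
  of \<open>X\<close> and \<open>W\<close>. The point is that the projection \<open>p\<close> to
  \<open>W\<close> is again epi, so an arrow into \<open>Y\<close> behaves like an element that can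
  be lifted to \<open>X\<close>.\<close>

lemma epi_lift:
  assumes e: "e \<in> Hom C X Y" "epi_arr C e" and y: "y \<in> Hom C W Y"
  obtains V p x where "p \<in> Hom C V W" "epi_arr C p" "x \<in> Hom C V X" "e \<cdot> x = y \<cdot> p"
proof -
  obtain d where d:
    "\<And>X Y f g. f \<in> Hom C X Y \<Longrightarrow> g \<in> Hom C X Y \<Longrightarrow> d f g \<in> Hom C X Y"
    "\<And>X Y f g. f \<in> Hom C X Y \<Longrightarrow> g \<in> Hom C X Y \<Longrightarrow> zero_arr C (d f g) \<longleftrightarrow> f = g"
    "\<And>X Y Z f g h. f \<in> Hom C X Y \<Longrightarrow> g \<in> Hom C X Y \<Longrightarrow> h \<in> Hom C Y Z \<Longrightarrow>
       h \<cdot> d f g = d (h \<cdot> f) (h \<cdot> g)"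
    "\<And>W X Y f g h. f \<in> Hom C X Y \<Longrightarrow> g \<in> Hom C X Y \<Longrightarrow> h \<in> Hom C W X \<Longrightarrow>
       d f g \<cdot> h = d (f \<cdot> h) (g \<cdot> h)"
    by (fact Hom_difference)
  have XW: "X \<in> Obj C" "W \<in> Obj C" "Y \<in> Obj C" using HomD e y by auto
  define F where "F i = (if i = 0 then X else W)" for i :: nat
  obtain P \<iota> where P: "is_coproduct C {0, 1 :: nat} F P \<iota>"
    using finite_coproducts[of "{0, 1}" F] XW by (auto simp: F_def)
  have \<iota>: "\<iota> 0 \<in> Hom C X P" "\<iota> 1 \<in> Hom C W P" and "P \<in> Obj C"
    using P by (auto simp: is_coproduct_def F_def)
  have cop: "\<exists>u \<in> Hom C P Z. u \<cdot> \<iota> 0 = a \<and> u \<cdot> \<iota> 1 = b"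
    if a: "a \<in> Hom C X Z" and b: "b \<in> Hom C W Z" for a b Z
  proof -
    have "\<exists>!u. u \<in> Hom C P Z \<and> (\<forall>i \<in> {0, 1 :: nat}. u \<cdot> \<iota> i = (if i = 0 then a else b))"
      using P a b HomD(5)[OF a] unfolding is_coproduct_def F_def
      by (elim conjE allE[of _ "\<lambda>i. if i = 0 then a else b"] ballE[of _ _ Z]) auto
    then show ?thesis by auto
  qed
  \<comment> \<open>The off-diagonal entries of the projections: the coproduct comes with injections
    only, and \<open>\<pi>X\<close>, \<open>\<pi>W\<close> are assembled from identities and
    zeros.\<close>
  obtain z where z: "z \<in> Hom C X W" "zero_arr C z" using zero_arr_exists[OF XW(1,2)] .
  obtain z' where z': "z' \<in> Hom C W X" "zero_arr C z'" using zero_arr_exists[OF XW(2,1)] .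
  obtain \<pi>X where \<pi>X: "\<pi>X \<in> Hom C P X" "\<pi>X \<cdot> \<iota> 0 = Ident C X" "\<pi>X \<cdot> \<iota> 1 = z'"
    using cop[OF Ident_in_Hom[OF XW(1)] z'(1)] by blast
  obtain \<pi>W where \<pi>W: "\<pi>W \<in> Hom C P W" "\<pi>W \<cdot> \<iota> 0 = z" "\<pi>W \<cdot> \<iota> 1 = Ident C W"
    using cop[OF z(1) Ident_in_Hom[OF XW(2)]] by blast
  note ex = Comp_in_Hom[OF \<pi>X(1) e(1)] and yw = Comp_in_Hom[OF \<pi>W(1) y]
  define s where "s = d (e \<cdot> \<pi>X) (y \<cdot> \<pi>W)"
  have s: "s \<in> Hom C P Y" unfolding s_def by (rule d(1)[OF ex yw])
  have s0: "s \<cdot> \<iota> 0 = d e (y \<cdot> z)"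
    unfolding s_def d(4)[OF ex yw \<iota>(1)] Comp_assoc[OF \<iota>(1) \<pi>X(1) e(1)] Comp_assoc[OF \<iota>(1) \<pi>W(1) y]
    using \<pi>X \<pi>W Comp_Ident[OF e(1)] by simp
  \<comment> \<open>On the summand \<open>X\<close> the difference \<open>s\<close> is
    \<open>e\<close> up to the zero arrow \<open>y \<cdot> z\<close>, so an arrow that kills
    \<open>s\<close> there kills the epimorphism \<open>e\<close>.\<close>
  have vzero: "zero_arr C v" if v: "v \<in> Hom C Y Z" and vs: "zero_arr C (v \<cdot> (s \<cdot> \<iota> 0))" for v Z
  proof -
    have yz: "y \<cdot> z \<in> Hom C X Y" "zero_arr C (y \<cdot> z)"
      using Comp_in_Hom[OF z(1) y] zero_arr_comp_left[OF z(2,1) y] by auto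
    have "zero_arr C (d (v \<cdot> e) (v \<cdot> (y \<cdot> z)))"
      using vs unfolding s0 d(3)[OF e(1) yz(1) v] .
    then have "v \<cdot> e = v \<cdot> (y \<cdot> z)"
      using d(2)[OF Comp_in_Hom[OF e(1) v] Comp_in_Hom[OF yz(1) v]] by blast
    then have "zero_arr C (v \<cdot> e)" using zero_arr_comp_left[OF yz(2,1) v] by simp
    then show ?thesis using epi_zero_cancel[OF e(2,1) v] by blast
  qed
  have "epi_arr C s"
    unfolding epi_iff_zero[OF s]
    using vzero zero_arr_assoc(2)[OF \<iota>(1) s] zero_arr_comp_right Comp_assoc[OF \<iota>(1) s] Comp_in_Hom[OF s] \<iota>(1)
    by metis
  obtain V k where k: "k \<in> Hom C V P" "zero_arr C (s \<cdot> k)" "is_kernel C s k"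
    using kernelE[OF s] by metis
  note coker = is_cokernelD[OF epi_is_cokernel_of_kernel[OF s \<open>epi_arr C s\<close> k(3)] k(1)]
  have "s \<cdot> k = d (e \<cdot> (\<pi>X \<cdot> k)) (y \<cdot> (\<pi>W \<cdot> k))"
    unfolding s_def d(4)[OF ex yw k(1)] Comp_assoc[OF k(1) \<pi>X(1) e(1)] Comp_assoc[OF k(1) \<pi>W(1) y] ..
  note x = Comp_in_Hom[OF k(1) \<pi>X(1)] and p = Comp_in_Hom[OF k(1) \<pi>W(1)]
  have eq: "e \<cdot> (\<pi>X \<cdot> k) = y \<cdot> (\<pi>W \<cdot> k)"
    using k(2) \<open>s \<cdot> k = _\<close> d(2)[OF Comp_in_Hom[OF x e(1)] Comp_in_Hom[OF p y]] by simp
  \<comment> \<open>If \<open>u\<close> kills \<open>\<pi>W \<cdot> k\<close>, then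
    \<open>u \<cdot> \<pi>W\<close> kills the kernel of \<open>s\<close> and factors as
    \<open>v \<cdot> s\<close>. Restriction to \<open>X\<close> shows that \<open>v\<close> is zero,
    and restriction to \<open>W\<close> returns \<open>u\<close>.\<close>
  have "zero_arr C u" if u: "u \<in> Hom C W Z" and up: "zero_arr C (u \<cdot> (\<pi>W \<cdot> k))" for u Z
  proof -
    note uw = Comp_in_Hom[OF \<pi>W(1) u]
    have "zero_arr C ((u \<cdot> \<pi>W) \<cdot> k)" using up Comp_assoc[OF k(1) \<pi>W(1) u] by simp
    then obtain v where v: "v \<in> Hom C Y Z" "v \<cdot> s = u \<cdot> \<pi>W"
      using coker(4)[OF uw] HomD[OF s] by auto
    have "v \<cdot> (s \<cdot> \<iota> 0) = u \<cdot> z"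
      using Comp_assoc[OF \<iota>(1) s v(1)] v Comp_assoc[OF \<iota>(1) \<pi>W(1) u] \<pi>W by simp
    then have "zero_arr C v" using vzero[OF v(1)] zero_arr_comp_left[OF z(2,1) u] by simp
    then have "zero_arr C (u \<cdot> \<pi>W)" using zero_arr_comp_right[OF _ v(1) s] v by simp
    then have "zero_arr C ((u \<cdot> \<pi>W) \<cdot> \<iota> 1)" using zero_arr_comp_right[OF _ uw \<iota>(2)] by blast
    then show ?thesis using Comp_assoc[OF \<iota>(2) \<pi>W(1) u] \<pi>W Comp_Ident[OF u] by simp
  qed
  then have "epi_arr C (\<pi>W \<cdot> k)" using epi_iff_zero[OF p] by blast
  then show ?thesis using that[OF p _ x eq] by blast
qed

text \<open>\<open>L\<close> is the kernel of the composite
  \<open>M \<rightarrow> Q \<rightarrow> Q/K\<close>. Lifting \<open>m\<close> along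
  \<open>e\<close> gives a cover of \<open>K\<close> that passes through \<open>L\<close>, which is
  why \<open>r\<close> is epi. The last clause makes \<open>L\<close> the full preimage, not merely
  some subobject lying over \<open>K\<close>.\<close>

lemma epi_preimage:
  assumes e: "e \<in> Hom C M Q" "epi_arr C e" and m: "m \<in> Hom C K Q" "mono_arr C m"
  obtains L n r where "n \<in> Hom C L M" "mono_arr C n" "r \<in> Hom C L K" "epi_arr C r" "e \<cdot> n = m \<cdot> r"
    "\<And>W h. h \<in> Hom C W M \<Longrightarrow> (\<exists>u \<in> Hom C W K. m \<cdot> u = e \<cdot> h) \<Longrightarrow> \<exists>v \<in> Hom C W L. n \<cdot> v = h"
proof -
  obtain R c where c: "c \<in> Hom C Q R" "is_cokernel C m c" using cokernelE[OF m(1)] by metis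
  note ce = Comp_in_Hom[OF e(1) c(1)]
  obtain L n where n: "n \<in> Hom C L M" "mono_arr C n" "zero_arr C ((c \<cdot> e) \<cdot> n)"
    "\<And>W h. h \<in> Hom C W M \<Longrightarrow> zero_arr C ((c \<cdot> e) \<cdot> h) \<Longrightarrow> \<exists>u \<in> Hom C W L. n \<cdot> u = h"
    using kernelE[OF ce] by metis
  note en = Comp_in_Hom[OF n(1) e(1)]
  have "zero_arr C (c \<cdot> (e \<cdot> n))" using n(3) Comp_assoc[OF n(1) e(1) c(1)] by simp
  then obtain r where r: "r \<in> Hom C L K" "m \<cdot> r = e \<cdot> n"
    using mono_factor_iff_zero[OF m c(2) en] by blast
  have fac: "\<exists>v \<in> Hom C W L. n \<cdot> v = h"
    if h: "h \<in> Hom C W M" and u: "\<exists>u \<in> Hom C W K. m \<cdot> u = e \<cdot> h" for W h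
    using n(4)[OF h] mono_factor_iff_zero[OF m c(2) Comp_in_Hom[OF h e(1)]] u
      Comp_assoc[OF h e(1) c(1)] by simp
  obtain V p x where px: "p \<in> Hom C V K" "epi_arr C p" "x \<in> Hom C V M" "e \<cdot> x = m \<cdot> p"
    using epi_lift[OF e m(1)] by metis
  obtain v where v: "v \<in> Hom C V L" "n \<cdot> v = x" using fac[OF px(3)] px by auto
  have "m \<cdot> (r \<cdot> v) = m \<cdot> p"
    using Comp_assoc[OF v(1) r(1) m(1)] Comp_assoc[OF v(1) n(1) e(1)] r v px by simp
  then have "r \<cdot> v = p" using mono_cancel[OF m(2,1) Comp_in_Hom[OF v(1) r(1)] px(1)] by blast
  then have "epi_arr C r" using epi_of_comp[OF _ v(1) r(1)] px(2) by simp
  then show ?thesis using that[OF n(1,2) r(1) _ r(2)[symmetric] fac] by blast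
qed

lemma nonzero_obj_mono:
  assumes "f \<in> Hom C K X" "mono_arr C f" "nonzero_obj C K"
  shows "\<not> zero_arr C f" "nonzero_obj C X"
proof -
  have K: "Ident C K \<in> Hom C K K" using HomD[OF assms(1)] Ident_in_Hom by blast
  show nz: "\<not> zero_arr C f"
    using mono_zero_cancel[OF assms(2,1) K] Comp_Ident[OF assms(1)] assms(3) zero_obj_iff_Ident
    by (auto simp: nonzero_obj_def)
  then show "nonzero_obj C X"
    using zero_arr_zero_obj'[OF _ assms(1)] HomD[OF assms(1)] by (auto simp: nonzero_obj_def)
qed

lemma nonzero_objI:
  assumes "f \<in> Hom C X Y" "\<not> zero_arr C f"
  shows "nonzero_obj C X" "nonzero_obj C Y"
  using assms HomD[OF assms(1)] zero_arr_zero_obj zero_arr_zero_obj' by (auto simp: nonzero_obj_def)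

lemma not_mono_kernelE:
  assumes "f \<in> Hom C X Y" "\<not> mono_arr C f"
  obtains K k where "k \<in> Hom C K X" "mono_arr C k" "zero_arr C (f \<cdot> k)" "nonzero_obj C K" "is_kernel C f k"
proof -
  obtain K k where k: "k \<in> Hom C K X" "mono_arr C k" "zero_arr C (f \<cdot> k)" "is_kernel C f k"
    "\<And>W h. h \<in> Hom C W X \<Longrightarrow> zero_arr C (f \<cdot> h) \<Longrightarrow> \<exists>u \<in> Hom C W K. k \<cdot> u = h"
    using kernelE[OF assms(1)] by metis
  obtain W g where g: "g \<in> Hom C W X" "zero_arr C (f \<cdot> g)" "\<not> zero_arr C g"
    using assms mono_iff_zero[OF assms(1)] by blast
  obtain u where u: "u \<in> Hom C W K" "k \<cdot> u = g" using k(5)[OF g(1,2)] by blast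
  have "\<not> zero_arr C u" using zero_arr_comp_left[OF _ u(1) k(1)] u g by auto
  then show ?thesis using that[OF k(1-3) _ k(4)] nonzero_objI(2)[OF u(1)] by blast
qed

end

section \<open>Monoform objects and supports\<close>

context abelian_category
begin

text \<open>The induced arrow \<open>L/K \<rightarrow> M/K\<close> for \<open>K \<subseteq> L \<subseteq> M\<close> is a monomorphism.\<close>

lemma induced_mono:
  assumes e: "e \<in> Hom C L H" "epi_arr C e" and l: "is_kernel C e l" "l \<in> Hom C K L"
    and m: "m \<in> Hom C L M" "mono_arr C m" and t: "is_cokernel C (m \<cdot> l) t" "t \<in> Hom C M N"
  obtains h where "h \<in> Hom C H N" "mono_arr C h" "h \<cdot> e = t \<cdot> m"
proof -
  note ml = Comp_in_Hom[OF l(2) m(1)] and tm = Comp_in_Hom[OF m(1) t(2)]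
  note lD = is_kernelD[OF l(1) e(1), unfolded HomD[OF l(2)]]
  note ml_mono = mono_comp[OF lD(3) m(2) l(2) m(1)]
  note tD = is_cokernelD[OF t(1) ml]
  have "zero_arr C ((t \<cdot> m) \<cdot> l)" using tD(2) Comp_assoc[OF l(2) m(1) t(2)] by simp
  then obtain h where h: "h \<in> Hom C H N" "h \<cdot> e = t \<cdot> m"
    using is_cokernelD(4)[OF epi_is_cokernel_of_kernel[OF e l(1)] l(2) tm] HomD[OF e(1)] by auto
  have "zero_arr C x" if x: "x \<in> Hom C W H" "zero_arr C (h \<cdot> x)" for x W
  proof -
    \<comment> \<open>A lift \<open>y\<close> of \<open>x\<close> to \<open>L\<close> vanishes in
      \<open>M/K\<close>, so it lies in \<open>K\<close>; then \<open>e\<close> kills it, and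
      \<open>x\<close> vanishes after the epimorphism \<open>p\<close>.\<close>
    obtain V p y where p: "p \<in> Hom C V W" "epi_arr C p" "y \<in> Hom C V L" "e \<cdot> y = x \<cdot> p"
      using epi_lift[OF e x(1)] by metis
    note my = Comp_in_Hom[OF p(3) m(1)]
    have "t \<cdot> (m \<cdot> y) = (h \<cdot> x) \<cdot> p"
      using Comp_assoc[OF p(3) m(1) t(2)] Comp_assoc[OF p(3) e(1) h(1)] Comp_assoc[OF p(1) x(1) h(1)]
        h p by simp
    then have "zero_arr C (t \<cdot> (m \<cdot> y))"
      using zero_arr_comp_right[OF x(2) Comp_in_Hom[OF x(1) h(1)] p(1)] by simp
    then obtain v where v: "v \<in> Hom C V K" "(m \<cdot> l) \<cdot> v = m \<cdot> y"
      using mono_factor_iff_zero[OF ml ml_mono t(1) my] by blast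
    have "m \<cdot> (l \<cdot> v) = m \<cdot> y" using v Comp_assoc[OF v(1) l(2) m(1)] by simp
    then have "l \<cdot> v = y" using mono_cancel[OF m(2,1) Comp_in_Hom[OF v(1) l(2)] p(3)] by blast
    then have "zero_arr C (e \<cdot> y)" using zero_arr_assoc(1)[OF v(1) l(2) e(1) lD(2)] by simp
    then show ?thesis using epi_zero_cancel[OF p(2,1) x(1)] p by simp
  qed
  then have "mono_arr C h" using mono_iff_zero[OF h(1)] by blast
  then show ?thesis using that h by blast
qed

lemma subquotientI:
  "m \<in> Hom C L M \<Longrightarrow> mono_arr C m \<Longrightarrow> e \<in> Hom C L H \<Longrightarrow> epi_arr C e \<Longrightarrow> subquotient C M H"
  unfolding subquotient_def mono_into_def using HomD by metis

lemma subquotientE: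
  assumes "subquotient C M H"
  obtains L m e where "m \<in> Hom C L M" "mono_arr C m" "e \<in> Hom C L H" "epi_arr C e"
  using assms that Arr_in_Hom unfolding subquotient_def mono_into_def epi_arr_def mono_arr_def by metis

text \<open>Write \<open>H\<close> as \<open>L/K\<close> with
  \<open>K \<subseteq> L \<subseteq> M\<close>; then \<open>H\<close> sits inside
  \<open>M/K\<close>. In the other direction, the preimage in \<open>M\<close> of a subobject of a
  quotient maps onto it. The second form suits supports, since sums of images in \<open>M\<close>
  can be pushed into the quotient.\<close>

lemma subquotient_iff_sub_of_quotient:
  "subquotient C M H \<longleftrightarrow>
    (\<exists>N t h. t \<in> Hom C M N \<and> epi_arr C t \<and> h \<in> Hom C H N \<and> mono_arr C h)"
proof
  assume "subquotient C M H"
  then obtain L m e where m: "m \<in> Hom C L M" "mono_arr C m" and e: "e \<in> Hom C L H" "epi_arr C e"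
    by (rule subquotientE)
  obtain K l where l: "l \<in> Hom C K L" "is_kernel C e l" using kernelE[OF e(1)] by metis
  obtain N t where t: "t \<in> Hom C M N" "epi_arr C t" "is_cokernel C (m \<cdot> l) t"
    using cokernelE[OF Comp_in_Hom[OF l(1) m(1)]] by metis
  show "\<exists>N t h. t \<in> Hom C M N \<and> epi_arr C t \<and> h \<in> Hom C H N \<and> mono_arr C h"
    using induced_mono[OF e l(2,1) m t(3,1)] t by blast
next
  assume "\<exists>N t h. t \<in> Hom C M N \<and> epi_arr C t \<and> h \<in> Hom C H N \<and> mono_arr C h"
  then obtain N t h where t: "t \<in> Hom C M N" "epi_arr C t" and h: "h \<in> Hom C H N" "mono_arr C h"
    by blast
  show "subquotient C M H" using epi_preimage[OF t h] subquotientI by metis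
qed

lemma subquotient_mono: "m \<in> Hom C L M \<Longrightarrow> mono_arr C m \<Longrightarrow> subquotient C M L"
  using subquotientI Ident_in_Hom epi_Ident HomD(4) by blast

lemma subquotient_epi: "e \<in> Hom C M H \<Longrightarrow> epi_arr C e \<Longrightarrow> subquotient C M H"
  using subquotientI Ident_in_Hom mono_Ident HomD(4) by blast

text \<open>The subobject \<open>K\<close> of \<open>N\<close> is a quotient of its preimage
  \<open>P\<close> in \<open>L\<close>, so the two steps compose into one.\<close>

lemma subquotient_trans:
  assumes "subquotient C M N" "subquotient C N H"
  shows "subquotient C M H"
proof -
  obtain L m e where m: "m \<in> Hom C L M" "mono_arr C m" and e: "e \<in> Hom C L N" "epi_arr C e"
    using assms(1) by (rule subquotientE)
  obtain K n r where n: "n \<in> Hom C K N" "mono_arr C n" and r: "r \<in> Hom C K H" "epi_arr C r"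
    using assms(2) by (rule subquotientE)
  obtain P a b where a: "a \<in> Hom C P L" "mono_arr C a" and b: "b \<in> Hom C P K" "epi_arr C b"
    using epi_preimage[OF e n] by metis
  show ?thesis
    by (rule subquotientI[OF Comp_in_Hom[OF a(1) m(1)] mono_comp[OF a(2) m(2) a(1) m(1)]
        Comp_in_Hom[OF b(1) r(1)] epi_comp[OF b(2) r(2) b(1) r(1)]])
qed

section \<open>Monoform objects and atom equivalence\<close>

text \<open>An arrow criterion that transports well to subobjects and along functors. A nonzero
  kernel \<open>L\<close> of \<open>f\<close> would embed the image \<open>K/L\<close> in
  \<open>H/L\<close>, giving \<open>H\<close> and \<open>H/L\<close> a common subobject. Conversely,
  a common subobject of \<open>H\<close> and \<open>H/L\<close> has a preimage in \<open>H\<close>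
  carrying a nonzero arrow to \<open>H\<close> that kills \<open>L\<close>.\<close>

lemma monoform_iff:
  "monoform C H \<longleftrightarrow> nonzero_obj C H \<and>
    (\<forall>K k f. k \<in> Hom C K H \<and> mono_arr C k \<and> f \<in> Hom C K H \<longrightarrow> zero_arr C f \<or> mono_arr C f)"
proof (intro iffI conjI allI impI)
  assume H: "monoform C H"
  then show "nonzero_obj C H" by (simp add: monoform_def)
  fix K k f assume kf: "k \<in> Hom C K H \<and> mono_arr C k \<and> f \<in> Hom C K H"
  then have k: "k \<in> Hom C K H" "mono_arr C k" and f: "f \<in> Hom C K H" by auto
  show "zero_arr C f \<or> mono_arr C f"
  proof (rule ccontr)
    assume nf: "\<not> (zero_arr C f \<or> mono_arr C f)"
    obtain I e m where e: "e \<in> Hom C K I" "epi_arr C e" and m: "m \<in> Hom C I H" "mono_arr C m"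
      and me: "m \<cdot> e = f"
      using imageE[OF f] by metis
    have "\<not> mono_arr C e" using nf mono_comp[OF _ m(2) e(1) m(1)] me by auto
    then obtain L l where l: "l \<in> Hom C L K" "mono_arr C l" "nonzero_obj C L" "is_kernel C e l"
      using not_mono_kernelE[OF e(1)] by metis
    note kl = Comp_in_Hom[OF l(1) k(1)]
    obtain Q q where q: "q \<in> Hom C H Q" "is_cokernel C (k \<cdot> l) q"
      using cokernelE[OF kl] by metis
    obtain h where h: "h \<in> Hom C I Q" "mono_arr C h"
      using induced_mono[OF e l(4,1) k q(2,1)] by metis
    have "\<not> zero_arr C m" using nf zero_arr_comp_right[OF _ m(1) e(1)] me by auto
    then have "common_subobject C H Q"
      unfolding common_subobject_def using nonzero_objI[OF m(1)] m h by blast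
    moreover have "mono_into C H (k \<cdot> l) \<and> nonzero_obj C (Dom C (k \<cdot> l))"
      using mono_comp[OF l(2) k(2) l(1) k(1)] HomD[OF kl] l(3) by (simp add: mono_into_def)
    ultimately show False
      using H q HomD(3)[OF q(1)] unfolding monoform_def by blast
  qed
next
  assume H: "nonzero_obj C H \<and>
    (\<forall>K k f. k \<in> Hom C K H \<and> mono_arr C k \<and> f \<in> Hom C K H \<longrightarrow> zero_arr C f \<or> mono_arr C f)"
  show "monoform C H"
    unfolding monoform_def
  proof (intro conjI allI impI notI)
    show "nonzero_obj C H" using H by blast
    fix m q
    assume *: "mono_into C H m \<and> nonzero_obj C (Dom C m) \<and> is_cokernel C m q"
      and com: "common_subobject C H (Cod C q)"
    define L where "L = Dom C m"
    have m: "m \<in> Hom C L H" "mono_arr C m" and "nonzero_obj C L"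
      using * by (auto simp: L_def mono_into_def mono_arr_def Hom_def)
    then have m_nz: "\<not> zero_arr C m" using nonzero_obj_mono by blast
    obtain Q where q: "q \<in> Hom C H Q" "zero_arr C (q \<cdot> m)" "epi_arr C q" and Q: "Cod C q = Q"
      using is_cokernelD(1-3)[OF _ m(1)] * by metis
    obtain K a b where K: "nonzero_obj C K" and a: "a \<in> Hom C K H" "mono_arr C a"
      and b: "b \<in> Hom C K Q" "mono_arr C b"
      using com unfolding common_subobject_def Q by blast
    obtain P n r where n: "n \<in> Hom C P H" "mono_arr C n" and r: "r \<in> Hom C P K" "epi_arr C r"
      and eq: "q \<cdot> n = b \<cdot> r"
      and fac: "\<And>W h. h \<in> Hom C W H \<Longrightarrow> (\<exists>u \<in> Hom C W K. b \<cdot> u = q \<cdot> h) \<Longrightarrow> \<exists>v \<in> Hom C W P. n \<cdot> v = h"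
      using epi_preimage[OF q(1,3) b] by metis
    note ar = Comp_in_Hom[OF r(1) a(1)]
    obtain z where z: "z \<in> Hom C L K" "zero_arr C z"
      using zero_arr_exists HomD[OF m(1)] HomD[OF b(1)] by metis
    \<comment> \<open>\<open>q\<close> kills \<open>m\<close>, so \<open>L\<close> lies in the
      preimage \<open>P\<close> through some \<open>v\<close>, and \<open>r\<close> kills
      \<open>v\<close>. But \<open>a \<cdot> r\<close> is nonzero, hence mono by hypothesis, which
      forces \<open>v\<close> and then \<open>m\<close> to vanish.\<close>
    have "b \<cdot> z = q \<cdot> m"
      by (rule zero_arr_unique[OF zero_arr_comp_left[OF z(2,1) b(1)] q(2)
            Comp_in_Hom[OF z(1) b(1)] Comp_in_Hom[OF m(1) q(1)]])
    then obtain v where v: "v \<in> Hom C L P" "n \<cdot> v = m" using fac[OF m(1)] z by blast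
    have "b \<cdot> (r \<cdot> v) = q \<cdot> m"
      using Comp_assoc[OF v(1) r(1) b(1)] Comp_assoc[OF v(1) n(1) q(1)] eq v by simp
    then have "zero_arr C (r \<cdot> v)"
      using mono_zero_cancel[OF b(2,1) Comp_in_Hom[OF v(1) r(1)]] q by simp
    moreover have "\<not> zero_arr C (a \<cdot> r)"
      using epi_zero_cancel[OF r(2,1) a(1)] nonzero_obj_mono[OF a K] by blast
    then have "mono_arr C (a \<cdot> r)" using H n ar by blast
    then have "mono_arr C r" using mono_of_comp[OF _ r(1) a(1)] by blast
    ultimately have "zero_arr C v" using mono_zero_cancel[OF _ r(1) v(1)] by blast
    then show False using zero_arr_comp_left[OF _ v(1) n(1)] v m_nz by simp
  qed
qed

lemma monoform_nonzero: "monoform C H \<Longrightarrow> nonzero_obj C H"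
  by (simp add: monoform_def)

lemma monoform_subobject:
  assumes "monoform C H" "k \<in> Hom C K H" "mono_arr C k" "nonzero_obj C K"
  shows "monoform C K"
  unfolding monoform_iff
proof (intro conjI allI impI)
  fix L l f assume *: "l \<in> Hom C L K \<and> mono_arr C l \<and> f \<in> Hom C L K"
  then have l: "l \<in> Hom C L K" "mono_arr C l" and f: "f \<in> Hom C L K" by auto
  have "zero_arr C (k \<cdot> f) \<or> mono_arr C (k \<cdot> f)"
    using assms(1) Comp_in_Hom[OF l(1) assms(2)] mono_comp[OF l(2) assms(3) l(1) assms(2)]
      Comp_in_Hom[OF f assms(2)] unfolding monoform_iff by blast
  then show "zero_arr C f \<or> mono_arr C f"
    using mono_zero_cancel[OF assms(3,2) f] mono_of_comp[OF _ f assms(2)] by blast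
qed (rule assms)

text \<open>If \<open>L \<rightarrow> H/K\<close> were mono, \<open>H\<close> and \<open>H/K\<close>
  would share \<open>L\<close>. So it has a nonzero kernel, which is the intersection of
  \<open>L\<close> and \<open>K\<close>.\<close>

lemma monoform_uniform:
  assumes H: "monoform C H" and k: "k \<in> Hom C K H" "mono_arr C k" "nonzero_obj C K"
    and l: "l \<in> Hom C L H" "mono_arr C l" "nonzero_obj C L"
  shows "common_subobject C K L"
proof -
  obtain Q q where q: "q \<in> Hom C H Q" "is_cokernel C k q" using cokernelE[OF k(1)] by metis
  note ql = Comp_in_Hom[OF l(1) q(1)]
  have "\<not> mono_arr C (q \<cdot> l)"
  proof
    assume "mono_arr C (q \<cdot> l)"
    then have "common_subobject C H Q"
      unfolding common_subobject_def using l ql by blast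
    then show False
      using H q k HomD[OF q(1)] HomD[OF k(1)] by (auto simp: monoform_def mono_into_def)
  qed
  then obtain P p where p: "p \<in> Hom C P L" "mono_arr C p" "zero_arr C ((q \<cdot> l) \<cdot> p)" "nonzero_obj C P"
    using not_mono_kernelE[OF ql] by metis
  note lp = Comp_in_Hom[OF p(1) l(1)]
  have "zero_arr C (q \<cdot> (l \<cdot> p))" using p Comp_assoc[OF p(1) l(1) q(1)] by simp
  then obtain u where u: "u \<in> Hom C P K" "k \<cdot> u = l \<cdot> p"
    using mono_factor_iff_zero[OF k(1,2) q(2) lp] by blast
  have "mono_arr C u"
    using mono_of_comp[OF _ u(1) k(1)] u mono_comp[OF p(2) l(2) p(1) l(1)] by simp
  then show ?thesis unfolding common_subobject_def using p u by blast
qed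

lemma common_subobject_sym: "common_subobject C X Y \<Longrightarrow> common_subobject C Y X"
  unfolding common_subobject_def by blast

lemma common_subobject_mono:
  assumes "common_subobject C X Y" "f \<in> Hom C Y Z" "mono_arr C f"
  shows "common_subobject C X Z"
  using assms Comp_in_Hom mono_comp unfolding common_subobject_def by blast

lemma common_subobjectI:
  "k \<in> Hom C K X \<Longrightarrow> mono_arr C k \<Longrightarrow> nonzero_obj C K \<Longrightarrow> common_subobject C K X"
  unfolding common_subobject_def using Ident_in_Hom mono_Ident HomD(4) by blast

lemma common_subobject_refl: "nonzero_obj C X \<Longrightarrow> common_subobject C X X"
  using common_subobjectI[OF Ident_in_Hom mono_Ident] unfolding nonzero_obj_def by blast

text \<open>Both witnesses are nonzero subobjects of the monoform \<open>Y\<close> and hence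
  meet.\<close>

lemma common_subobject_trans:
  assumes "monoform C Y" "common_subobject C X Y" "common_subobject C Y Z"
  shows "common_subobject C X Z"
proof -
  obtain K a b where K: "nonzero_obj C K" "a \<in> Hom C K X" "mono_arr C a" "b \<in> Hom C K Y" "mono_arr C b"
    using assms(2) unfolding common_subobject_def by blast
  obtain L c d where L: "nonzero_obj C L" "c \<in> Hom C L Y" "mono_arr C c" "d \<in> Hom C L Z" "mono_arr C d"
    using assms(3) unfolding common_subobject_def by blast
  have "common_subobject C K L" using monoform_uniform[OF assms(1)] K L by blast
  then show ?thesis using common_subobject_mono common_subobject_sym K L by blast
qed

lemma atom_eq_iff:
  assumes "monoform C H" "monoform C H'"
  shows "atom C H = atom C H' \<longleftrightarrow> common_subobject C H H'"
proof
  assume "atom C H = atom C H'"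
  then show "common_subobject C H H'"
    using common_subobject_refl monoform_nonzero assms unfolding atom_def by blast
next
  assume "common_subobject C H H'"
  then show "atom C H = atom C H'"
    using common_subobject_trans[OF assms(1)] common_subobject_trans[OF assms(2)] common_subobject_sym
    unfolding atom_def by blast
qed

text \<open>What makes supports computable: a monoform subquotient may be shrunk to any nonzero
  subobject without losing its atom.\<close>

lemma atom_subobject:
  assumes "monoform C H" "k \<in> Hom C K H" "mono_arr C k" "nonzero_obj C K"
  shows "atom C K = atom C H"
  using atom_eq_iff[OF monoform_subobject[OF assms] assms(1)] common_subobjectI assms by blast

section \<open>Supports under subquotients, extensions and finite sums\<close>

lemma SuppI: "monoform C H \<Longrightarrow> subquotient C M H \<Longrightarrow> atom C H \<in> Supp C M"
  by (auto simp: Supp_def)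

lemma Supp_subquotient: "subquotient C M N \<Longrightarrow> Supp C N \<subseteq> Supp C M"
  using subquotient_trans by (auto simp: Supp_def)

lemma Supp_iso: "iso_obj C X Y \<Longrightarrow> Supp C X = Supp C Y"
  by (meson Supp_subquotient iso_objE iso_obj_sym subquotient_epi subset_antisym)

lemma Supp_zero_obj:
  assumes "zero_obj C Z"
  shows "Supp C Z = {}"
proof -
  have "\<not> nonzero_obj C H" if sq: "subquotient C Z H" for H
  proof -
    obtain L m e where m: "m \<in> Hom C L Z" "mono_arr C m" and e: "e \<in> Hom C L H" "epi_arr C e"
      using subquotientE[OF sq] by metis
    have "zero_arr C m" using zero_arr_zero_obj' assms m by blast
    then have "\<not> nonzero_obj C L" using nonzero_obj_mono m by blast
    then have "zero_arr C e" using nonzero_objI e by blast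
    then have "zero_arr C (Ident C H)"
      using epi_zero_cancel[OF e(2,1) Ident_in_Hom] Ident_Comp[OF e(1)] HomD[OF e(1)] by simp
    then show ?thesis using zero_obj_iff_Ident by (auto simp: nonzero_obj_def)
  qed
  then show ?thesis using monoform_nonzero by (auto simp: Supp_def)
qed

text \<open>Pass to a quotient \<open>N\<close> of \<open>M\<close> containing \<open>H\<close>; let
  \<open>I\<close> be the image of \<open>A\<close> in \<open>N\<close> and \<open>R = N/I\<close>,
  a quotient of \<open>B\<close>. Either \<open>H\<close> embeds in \<open>R\<close>, or a nonzero
  part of \<open>H\<close> lies in \<open>I\<close>, a quotient of \<open>A\<close>, and this part
  carries the same atom.\<close>

lemma Supp_extension:
  assumes f: "f \<in> Hom C A M" and g: "g \<in> Hom C M B" "is_cokernel C f g"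
  shows "Supp C M \<subseteq> Supp C A \<union> Supp C B"
proof
  fix \<alpha> assume "\<alpha> \<in> Supp C M"
  then obtain H where H: "monoform C H" "subquotient C M H" and \<alpha>: "\<alpha> = atom C H"
    by (auto simp: Supp_def)
  note gD = is_cokernelD[OF g(2) f, unfolded HomD[OF g(1)]]
  obtain N t h where t: "t \<in> Hom C M N" "epi_arr C t" and h: "h \<in> Hom C H N" "mono_arr C h"
    using H(2) subquotient_iff_sub_of_quotient by blast
  obtain I e m where e: "e \<in> Hom C A I" "epi_arr C e" and m: "m \<in> Hom C I N" "mono_arr C m"
    and me: "m \<cdot> e = t \<cdot> f"
    using imageE[OF Comp_in_Hom[OF f t(1)]] by metis
  obtain R c where c: "c \<in> Hom C N R" "epi_arr C c" "zero_arr C (c \<cdot> m)" "is_cokernel C m c"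
    using cokernelE[OF m(1)] by metis
  note ct = Comp_in_Hom[OF t(1) c(1)] and ch = Comp_in_Hom[OF h(1) c(1)]
  have "(c \<cdot> t) \<cdot> f = c \<cdot> (m \<cdot> e)" using Comp_assoc[OF f t(1) c(1)] me by simp
  then have "zero_arr C ((c \<cdot> t) \<cdot> f)" using zero_arr_assoc(1)[OF e(1) m(1) c(1,3)] by simp
  then obtain w where w: "w \<in> Hom C B R" "w \<cdot> g = c \<cdot> t" using gD(4)[OF ct] by blast
  have w_epi: "epi_arr C w"
    using epi_of_comp[OF _ g(1) w(1)] w epi_comp[OF t(2) c(2) t(1) c(1)] by simp
  show "\<alpha> \<in> Supp C A \<union> Supp C B"
  proof (cases "mono_arr C (c \<cdot> h)")
    case True
    then have "subquotient C B H" using subquotient_iff_sub_of_quotient w w_epi ch by blast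
    then show ?thesis using SuppI H \<alpha> by blast
  next
    case False
    then obtain K k where k: "k \<in> Hom C K H" "mono_arr C k" "zero_arr C ((c \<cdot> h) \<cdot> k)" "nonzero_obj C K"
      using not_mono_kernelE[OF ch] by metis
    have "zero_arr C (c \<cdot> (h \<cdot> k))" using k Comp_assoc[OF k(1) h(1) c(1)] by simp
    then obtain v where v: "v \<in> Hom C K I" "m \<cdot> v = h \<cdot> k"
      using mono_factor_iff_zero[OF m c(4) Comp_in_Hom[OF k(1) h(1)]] by blast
    have "mono_arr C v"
      using mono_of_comp[OF _ v(1) m(1)] v mono_comp[OF k(2) h(2) k(1) h(1)] by simp
    then have "subquotient C A K" using subquotient_iff_sub_of_quotient v e by blast
    then have "atom C K \<in> Supp C A" using SuppI monoform_subobject[OF H(1) k(1,2,4)] by blast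
    then show ?thesis using atom_subobject[OF H(1) k(1,2,4)] \<alpha> by simp
  qed
qed

text \<open>Joint epimorphy, unlike being a family of coproduct injections, survives passage to a
  quotient. The induction divides \<open>M\<close> by the image of \<open>f j\<close> and applies
  the hypothesis to the remaining arrows.\<close>

lemma Supp_jointly_epi_finite:
  assumes "finite J" "\<And>i. i \<in> J \<Longrightarrow> f i \<in> Hom C (F i) M" "M \<in> Obj C"
    and "\<And>Y u. u \<in> Hom C M Y \<Longrightarrow> (\<And>i. i \<in> J \<Longrightarrow> zero_arr C (u \<cdot> f i)) \<Longrightarrow> zero_arr C u"
  shows "Supp C M \<subseteq> (\<Union>i \<in> J. Supp C (F i))"
  using assms
proof (induction J arbitrary: M f rule: finite_induct)
  case empty
  have "zero_arr C (Ident C M)" using empty(3)[OF Ident_in_Hom] empty(2) by blast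
  then show ?case using Supp_zero_obj zero_obj_iff_Ident empty(2) by blast
next
  case (insert j J)
  have fj: "f j \<in> Hom C (F j) M" and f: "f i \<in> Hom C (F i) M" if "i \<in> J" for i
    using insert.prems that by auto
  obtain Q c where c: "c \<in> Hom C M Q" "epi_arr C c" "zero_arr C (c \<cdot> f j)" "is_cokernel C (f j) c"
    using cokernelE[of "f j" "F j" M] insert.prems(1) by (metis insertI1)
  have "Supp C Q \<subseteq> (\<Union>i \<in> J. Supp C (F i))"
  proof (rule insert.IH[of "\<lambda>i. c \<cdot> f i"])
    show "c \<cdot> f i \<in> Hom C (F i) Q" if "i \<in> J" for i using Comp_in_Hom c f that by blast
    show "Q \<in> Obj C" using HomD c by blast
    fix Y u assume u: "u \<in> Hom C Q Y" and z: "\<And>i. i \<in> J \<Longrightarrow> zero_arr C (u \<cdot> (c \<cdot> f i))"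
    have "zero_arr C ((u \<cdot> c) \<cdot> f i)" if i: "i \<in> insert j J" for i
      using Comp_assoc[OF insert.prems(1)[OF i] c(1) u] z
        zero_arr_assoc(2)[OF insert.prems(1)[OF i] c(1) u] c(3) i by auto
    then have "zero_arr C (u \<cdot> c)" using insert.prems(3)[OF Comp_in_Hom[OF c(1) u]] by blast
    then show "zero_arr C u" using epi_zero_cancel[OF c(2,1) u] by blast
  qed
  moreover have "Supp C M \<subseteq> Supp C (F j) \<union> Supp C Q"
    using Supp_extension[OF _ c(1,4)] insert.prems(1) by blast
  ultimately show ?case by blast
qed

end

section \<open>Noetherian objects\<close>

text \<open>The part of the Serre conditions that matters below, for a full subcategory with object set \<open>N\<close>
  but with all monomorphisms, epimorphisms and exact sequences taken in the ambient category.\<close>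

definition serre_within :: "('o, 'a) cat \<Rightarrow> 'o set \<Rightarrow> 'o set \<Rightarrow> bool" where
  "serre_within C N \<X> \<longleftrightarrow> \<X> \<subseteq> N \<and> (\<forall>Z. zero_obj C Z \<longrightarrow> Z \<in> \<X>) \<and>
    (\<forall>K Y k. k \<in> Hom C K Y \<and> mono_arr C k \<and> Y \<in> \<X> \<longrightarrow> K \<in> \<X>) \<and>
    (\<forall>Y Q e. e \<in> Hom C Y Q \<and> epi_arr C e \<and> Y \<in> \<X> \<longrightarrow> Q \<in> \<X>) \<and>
    (\<forall>A B D f g. f \<in> Hom C A B \<and> mono_arr C f \<and> g \<in> Hom C B D \<and> is_cokernel C f g \<and>
       A \<in> \<X> \<and> D \<in> \<X> \<and> B \<in> N \<longrightarrow> B \<in> \<X>)"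

lemma serre_withinD:
  assumes "serre_within C N \<X>"
  shows "\<X> \<subseteq> N" "zero_obj C Z \<Longrightarrow> Z \<in> \<X>"
    and "k \<in> Hom C K Y \<Longrightarrow> mono_arr C k \<Longrightarrow> Y \<in> \<X> \<Longrightarrow> K \<in> \<X>"
    and "e \<in> Hom C Y Q \<Longrightarrow> epi_arr C e \<Longrightarrow> Y \<in> \<X> \<Longrightarrow> Q \<in> \<X>"
    and "f \<in> Hom C A B \<Longrightarrow> mono_arr C f \<Longrightarrow> g \<in> Hom C B D \<Longrightarrow> is_cokernel C f g \<Longrightarrow>
       A \<in> \<X> \<Longrightarrow> D \<in> \<X> \<Longrightarrow> B \<in> N \<Longrightarrow> B \<in> \<X>"
  using assms unfolding serre_within_def by blast+

context abelian_category
begin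

lemma mono_intoE:
  assumes "mono_into C M m"
  obtains K where "m \<in> Hom C K M" "mono_arr C m" "Dom C m = K"
  using assms that by (auto simp: mono_into_def mono_arr_def Hom_def)

lemma sub_le_iff:
  assumes "m \<in> Hom C K X" "n \<in> Hom C L X"
  shows "sub_le C m n \<longleftrightarrow> (\<exists>u \<in> Hom C K L. n \<cdot> u = m)"
  using HomD[OF assms(1)] HomD[OF assms(2)] by (auto simp: sub_le_def)

lemma sub_le_iff_zero:
  assumes "m \<in> Hom C K X" "n \<in> Hom C L X" "mono_arr C n" "is_cokernel C n c"
  shows "sub_le C m n \<longleftrightarrow> zero_arr C (c \<cdot> m)"
  using sub_le_iff[OF assms(1,2)] mono_factor_iff_zero[OF assms(2,3,4,1)] by simp

lemma noetherian_Obj: "noetherian C M \<Longrightarrow> M \<in> Obj C"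
  by (simp add: noetherian_def)

lemma noetherian_stable:
  assumes "noetherian C M" "\<And>i. m i \<in> Hom C (K i) M" "\<And>i. mono_arr C (m i)"
    and "\<And>i. sub_le C (m i) (m (Suc i))"
  obtains N where "\<And>i. i \<ge> N \<Longrightarrow> sub_le C (m i) (m N)"
proof -
  have "\<forall>i. mono_into C M (m i)"
    using assms(3) HomD(3)[OF assms(2)] by (simp add: mono_into_def)
  then show ?thesis using assms(1,4) that unfolding noetherian_def by blast
qed

lemma noetherianI:
  assumes "M \<in> Obj C"
    and "\<And>m K. (\<And>i :: nat. m i \<in> Hom C (K i) M) \<Longrightarrow> (\<And>i. mono_arr C (m i)) \<Longrightarrow>
      (\<And>i. sub_le C (m i) (m (Suc i))) \<Longrightarrow> \<exists>N. \<forall>i \<ge> N. sub_le C (m i) (m N)"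
  shows "noetherian C M"
  unfolding noetherian_def
proof (intro conjI allI impI)
  fix m :: "nat \<Rightarrow> 'b"
  assume m: "(\<forall>i. mono_into C M (m i)) \<and> (\<forall>i. sub_le C (m i) (m (Suc i)))"
  show "\<exists>N. \<forall>i \<ge> N. sub_le C (m i) (m N)"
    by (rule assms(2)[of m "\<lambda>i. Dom C (m i)"])
      (use m in \<open>auto simp: mono_into_def mono_arr_def Hom_def\<close>)
qed (rule assms)

lemma noetherian_subobject:
  assumes M: "noetherian C M" and k: "k \<in> Hom C L M" "mono_arr C k"
  shows "noetherian C L"
proof (rule noetherianI)
  show "L \<in> Obj C" using HomD k by blast
  fix m K assume m: "\<And>i :: nat. m i \<in> Hom C (K i) L" "\<And>i. mono_arr C (m i)"
    "\<And>i. sub_le C (m i) (m (Suc i))"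
  have km: "k \<cdot> m i \<in> Hom C (K i) M" "mono_arr C (k \<cdot> m i)" for i
    using Comp_in_Hom[OF m(1) k(1)] mono_comp[OF m(2) k(2) m(1) k(1)] by auto
  have le: "sub_le C (k \<cdot> m i) (k \<cdot> m j) \<longleftrightarrow> sub_le C (m i) (m j)" for i j
  proof -
    have "(k \<cdot> m j) \<cdot> u = k \<cdot> m i \<longleftrightarrow> m j \<cdot> u = m i" if u: "u \<in> Hom C (K i) (K j)" for u
      using Comp_assoc[OF u m(1) k(1)] mono_cancel[OF k(2,1) Comp_in_Hom[OF u m(1)] m(1)] by auto
    then show ?thesis
      unfolding sub_le_iff[OF km(1) km(1)] sub_le_iff[OF m(1) m(1)] by auto
  qed
  obtain N where "\<And>i. i \<ge> N \<Longrightarrow> sub_le C (k \<cdot> m i) (k \<cdot> m N)"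
    using noetherian_stable[OF M, of "\<lambda>i. k \<cdot> m i"] km m(3) le by auto
  then show "\<exists>N. \<forall>i \<ge> N. sub_le C (m i) (m N)" using le by blast
qed

text \<open>Preimages under \<open>e\<close> turn an ascending chain in \<open>Q\<close> into one in
  \<open>M\<close>, and the order of the preimages determines the order of the original
  subobjects.\<close>

lemma noetherian_quotient:
  assumes M: "noetherian C M" and e: "e \<in> Hom C M Q" "epi_arr C e"
  shows "noetherian C Q"
proof (rule noetherianI)
  show "Q \<in> Obj C" using HomD e by blast
  fix m K assume m: "\<And>i :: nat. m i \<in> Hom C (K i) Q" "\<And>i. mono_arr C (m i)"
    "\<And>i. sub_le C (m i) (m (Suc i))"
  have "\<forall>i. \<exists>L n r. n \<in> Hom C L M \<and> mono_arr C n \<and> r \<in> Hom C L (K i) \<and> epi_arr C r \<and> e \<cdot> n = m i \<cdot> r \<and>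
    (\<forall>W h. h \<in> Hom C W M \<longrightarrow> (\<exists>u \<in> Hom C W (K i). m i \<cdot> u = e \<cdot> h) \<longrightarrow> (\<exists>v \<in> Hom C W L. n \<cdot> v = h))"
  proof
    fix i show "\<exists>L n r. n \<in> Hom C L M \<and> mono_arr C n \<and> r \<in> Hom C L (K i) \<and> epi_arr C r \<and> e \<cdot> n = m i \<cdot> r \<and>
      (\<forall>W h. h \<in> Hom C W M \<longrightarrow> (\<exists>u \<in> Hom C W (K i). m i \<cdot> u = e \<cdot> h) \<longrightarrow> (\<exists>v \<in> Hom C W L. n \<cdot> v = h))"
      by (rule epi_preimage[OF e m(1)[of i] m(2)[of i]]) blast
  qed
  then obtain L n r where nr: "\<forall>i. n i \<in> Hom C (L i) M \<and> mono_arr C (n i) \<and> r i \<in> Hom C (L i) (K i) \<and>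
    epi_arr C (r i) \<and> e \<cdot> n i = m i \<cdot> r i \<and> (\<forall>W h. h \<in> Hom C W M \<longrightarrow>
      (\<exists>u \<in> Hom C W (K i). m i \<cdot> u = e \<cdot> h) \<longrightarrow> (\<exists>v \<in> Hom C W (L i). n i \<cdot> v = h))"
    unfolding choice_iff by (elim exE) (rule that)
  then have n: "\<And>i. n i \<in> Hom C (L i) M" "\<And>i. mono_arr C (n i)"
    and r: "\<And>i. r i \<in> Hom C (L i) (K i)" "\<And>i. epi_arr C (r i)" and eq: "\<And>i. e \<cdot> n i = m i \<cdot> r i"
    and fac: "\<And>i W h. h \<in> Hom C W M \<Longrightarrow> (\<exists>u \<in> Hom C W (K i). m i \<cdot> u = e \<cdot> h) \<Longrightarrow>
      \<exists>v \<in> Hom C W (L i). n i \<cdot> v = h"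
    by auto
  have le1: "sub_le C (n i) (n j)" if le: "sub_le C (m i) (m j)" for i j
  proof -
    obtain u where u: "u \<in> Hom C (K i) (K j)" "m j \<cdot> u = m i"
      using le sub_le_iff[OF m(1) m(1)] by blast
    have "m j \<cdot> (u \<cdot> r i) = e \<cdot> n i" using Comp_assoc[OF r(1) u(1) m(1)] u eq by simp
    then show ?thesis
      unfolding sub_le_iff[OF n(1) n(1)] using fac[OF n(1)] Comp_in_Hom[OF r(1) u(1)] by blast
  qed
  \<comment> \<open>\<open>K i\<close> is covered by its preimage through the epimorphism
    \<open>r i\<close>, so it is enough that the quotient by \<open>m j\<close> kills
    \<open>m i \<cdot> r i\<close>.\<close>
  have le2: "sub_le C (m i) (m j)" if le: "sub_le C (n i) (n j)" for i j
  proof -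
    obtain u where u: "u \<in> Hom C (L i) (L j)" "n j \<cdot> u = n i"
      using le sub_le_iff[OF n(1) n(1)] by blast
    obtain R c where c: "c \<in> Hom C Q R" "is_cokernel C (m j) c" "zero_arr C (c \<cdot> m j)"
      using cokernelE[OF m(1)] by metis
    have "m i \<cdot> r i = m j \<cdot> (r j \<cdot> u)"
      using Comp_assoc[OF u(1) n(1) e(1)] Comp_assoc[OF u(1) r(1) m(1)] u eq by metis
    then have "zero_arr C ((c \<cdot> m i) \<cdot> r i)"
      using zero_arr_assoc(1)[OF Comp_in_Hom[OF u(1) r(1)] m(1) c(1,3)] Comp_assoc[OF r(1) m(1) c(1)]
      by simp
    then show ?thesis
      using epi_zero_cancel[OF r(2) r(1) Comp_in_Hom[OF m(1) c(1)]] sub_le_iff_zero[OF m(1) m(1) m(2) c(2)]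
      by blast
  qed
  obtain N where "\<And>i. i \<ge> N \<Longrightarrow> sub_le C (n i) (n N)"
    using noetherian_stable[of M n L] M n m(3) le1 by blast
  then show "\<exists>N. \<forall>i \<ge> N. sub_le C (m i) (m N)" using le2 by blast
qed

text \<open>An endless chain of proper quotients would have ascending kernels in \<open>M\<close>,
  and these stabilize. A mono epimorphism gives no proper quotient, so the conclusion means that
  \<open>P\<close> fails on all proper quotients of \<open>Q\<close>.\<close>

lemma noetherian_maximal_quotient:
  assumes M: "noetherian C M" and q0: "q0 \<in> Hom C M Q0" "epi_arr C q0" "P q0"
  obtains Q q where "q \<in> Hom C M Q" "epi_arr C q" "P q"
    "\<And>R r. r \<in> Hom C Q R \<Longrightarrow> epi_arr C r \<Longrightarrow> P (r \<cdot> q) \<Longrightarrow> mono_arr C r"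
proof (rule ccontr)
  note witness = that
  assume contra: "\<not> thesis"
  define good where "good q \<longleftrightarrow> q \<in> Hom C M (Cod C q) \<and> epi_arr C q \<and> P q" for q
  define step where "step q q' \<longleftrightarrow> (\<exists>r \<in> Hom C (Cod C q) (Cod C q'). \<not> mono_arr C r \<and> q' = r \<cdot> q)" for q q'
  have "\<exists>s. \<forall>n. good (s n) \<and> step (s n) (s (Suc n))"
  proof (rule dependent_nat_choice)
    show "\<exists>q. good q" using q0 HomD(3)[OF q0(1)] unfolding good_def by blast
    fix q assume q: "good q"
    then obtain R r where r: "r \<in> Hom C (Cod C q) R" "epi_arr C r" "P (r \<cdot> q)" "\<not> mono_arr C r"
      using contra witness unfolding good_def by metis
    have "r \<cdot> q \<in> Hom C M R" "epi_arr C (r \<cdot> q)"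
      using Comp_in_Hom epi_comp q r unfolding good_def by blast+
    then have "good (r \<cdot> q) \<and> step q (r \<cdot> q)"
      using r HomD(3)[of "r \<cdot> q" M R] unfolding good_def step_def by auto
    then show "\<exists>q'. good q' \<and> step q q'" by blast
  qed
  then obtain s where s: "\<And>n. good (s n)" "\<And>n. step (s n) (s (Suc n))" by blast
  have q: "s n \<in> Hom C M (Cod C (s n))" "epi_arr C (s n)" for n
    using s(1)[of n] by (auto simp: good_def)
  have "\<forall>n. \<exists>k. is_kernel C (s n) k" using kernels HomD[OF q(1)] by blast
  then obtain k where k: "\<And>n. is_kernel C (s n) (k n)" by metis
  note kD = is_kernelD[OF k q(1)]
  obtain r where r: "\<And>n. r n \<in> Hom C (Cod C (s n)) (Cod C (s (Suc n)))"
    "\<And>n. \<not> mono_arr C (r n)" "\<And>n. s (Suc n) = r n \<cdot> s n"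
    using s(2) unfolding step_def by metis
  have "sub_le C (k n) (k (Suc n))" for n
    unfolding sub_le_iff[OF kD(1) kD(1)]
    using kD(4)[OF kD(1), of "Suc n" n] zero_arr_assoc(2)[OF kD(1) q(1) r(1) kD(2)] r(3) by simp
  then obtain N where N: "\<And>i. i \<ge> N \<Longrightarrow> sub_le C (k i) (k N)"
    using noetherian_stable[of M k "\<lambda>n. Dom C (k n)"] M kD(1,3) by blast
  then obtain u where u: "u \<in> Hom C (Dom C (k (Suc N))) (Dom C (k N))" "k N \<cdot> u = k (Suc N)"
    using sub_le_iff[OF kD(1) kD(1)] le_SucI by blast
  \<comment> \<open>Equal kernels let \<open>s N\<close> factor back through
    \<open>s (Suc N)\<close>; this gives \<open>r N\<close> a left inverse and makes it
    mono.\<close>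
  have "zero_arr C (s N \<cdot> k (Suc N))"
    using zero_arr_assoc(1)[OF u(1) kD(1) q(1) kD(2)] u by simp
  then obtain v where v: "v \<in> Hom C (Cod C (s (Suc N))) (Cod C (s N))" "v \<cdot> s (Suc N) = s N"
    using is_cokernelD(4)[OF epi_is_cokernel_of_kernel[OF q k] kD(1) q(1)] by blast
  have I: "Ident C (Cod C (s N)) \<in> Hom C (Cod C (s N)) (Cod C (s N))"
    using Ident_in_Hom HomD[OF q(1)] by blast
  have "(v \<cdot> r N) \<cdot> s N = Ident C (Cod C (s N)) \<cdot> s N"
    using Comp_assoc[OF q(1) r(1) v(1)] v r(3)[of N] Ident_Comp[OF q(1)] by simp
  then have "v \<cdot> r N = Ident C (Cod C (s N))"
    using epi_cancel[OF q(2,1) Comp_in_Hom[OF r(1) v(1)] I] by blast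
  then show False using mono_of_comp[OF _ r(1) v(1)] r(2) mono_Ident HomD[OF I] by metis
qed

text \<open>If \<open>L\<close> is maximal among the subobjects of \<open>M\<close> such that \<open>M/L\<close> and \<open>M\<close> have a common
  nonzero subobject \<open>H\<close>, then \<open>H\<close> is monoform.\<close>

lemma noetherian_monoform_subobject:
  assumes M: "noetherian C M" "nonzero_obj C M"
  obtains H h where "monoform C H" "h \<in> Hom C H M" "mono_arr C h"
proof -
  have I: "Ident C M \<in> Hom C M M" "epi_arr C (Ident C M)"
    using Ident_in_Hom epi_Ident M by (auto simp: nonzero_obj_def)
  \<comment> \<open>The search for a maximal subobject starts at zero, that is, at the quotient
    \<open>M\<close> itself.\<close>
  have "common_subobject C (Cod C (Ident C M)) M"
    using common_subobject_refl M(2) HomD(3)[OF I(1)] by simp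
  then obtain Q q where q: "q \<in> Hom C M Q" "epi_arr C q" "common_subobject C (Cod C q) M"
    and max: "\<And>R r. r \<in> Hom C Q R \<Longrightarrow> epi_arr C r \<Longrightarrow> common_subobject C (Cod C (r \<cdot> q)) M \<Longrightarrow> mono_arr C r"
    using noetherian_maximal_quotient[OF M(1) I, of "\<lambda>q. common_subobject C (Cod C q) M"] by metis
  have "common_subobject C Q M" using q HomD(3)[OF q(1)] by simp
  then obtain H a b where H: "nonzero_obj C H" and a: "a \<in> Hom C H Q" "mono_arr C a"
    and b: "b \<in> Hom C H M" "mono_arr C b"
    unfolding common_subobject_def by blast
  have "monoform C H"
    unfolding monoform_def
  proof (intro conjI allI impI notI)
    fix m t assume *: "mono_into C H m \<and> nonzero_obj C (Dom C m) \<and> is_cokernel C m t"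
      and com: "common_subobject C H (Cod C t)"
    then obtain L where m: "m \<in> Hom C L H" "mono_arr C m" and L: "nonzero_obj C L"
      using mono_intoE by metis
    note tD = is_cokernelD[OF conjunct2[OF conjunct2[OF *]] m(1)]
    note am = Comp_in_Hom[OF m(1) a(1)]
    obtain R r where r: "r \<in> Hom C Q R" "epi_arr C r" "zero_arr C (r \<cdot> (a \<cdot> m))" "is_cokernel C (a \<cdot> m) r"
      using cokernelE[OF am] by metis
    \<comment> \<open>For the subobject \<open>L\<close> of \<open>H\<close> at hand,
      \<open>H/L\<close> embeds in \<open>R = Q/L\<close>. A common subobject of \<open>H\<close>
      and \<open>H/L\<close> would make \<open>R\<close> a candidate as well; but \<open>r\<close>
      kills the nonzero \<open>L\<close>, against maximality.\<close>
    have "is_kernel C t m" using mono_is_kernel_of_cokernel[OF m] * by blast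
    then obtain h where "h \<in> Hom C (Cod C t) R" "mono_arr C h"
      using induced_mono[OF tD(1,3) _ m(1) a r(4,1)] by metis
    then have "common_subobject C H R" using common_subobject_mono com by blast
    then have "common_subobject C R M"
      using common_subobject_mono[OF _ b] common_subobject_sym by blast
    then have "mono_arr C r" using max[OF r(1,2)] HomD(3)[OF Comp_in_Hom[OF q(1) r(1)]] by simp
    then have "zero_arr C (a \<cdot> m)" using mono_zero_cancel[OF _ r(1) am r(3)] by blast
    moreover have "mono_arr C (a \<cdot> m)" using mono_comp[OF m(2) a(2) m(1) a(1)] .
    ultimately show False using nonzero_obj_mono(1)[OF am _ L] by blast
  qed (rule H)
  then show ?thesis using that b by blast
qed

text \<open>\<open>N\<close> is the class in which extensions are taken, later all objects or the
  noetherian ones. The quotient \<open>Q\<close> of \<open>M\<close> is noetherian and so belongs to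
  \<open>N\<close>, which makes the final extension step legitimate in both settings.\<close>

lemma noetherian_in_serre_within:
  assumes M: "noetherian C M" and \<X>: "serre_within C N \<X>" and N: "\<And>X. noetherian C X \<Longrightarrow> X \<in> N"
    and supp: "Supp C M \<subseteq> (\<Union>Y \<in> \<X>. Supp C Y)"
  shows "M \<in> \<X>"
proof (rule ccontr)
  assume "M \<notin> \<X>"
  note \<X>D = serre_withinD[OF \<X>]
  have I: "Ident C M \<in> Hom C M M" "epi_arr C (Ident C M)"
    using Ident_in_Hom epi_Ident noetherian_Obj[OF M] by auto
  obtain Q q where q: "q \<in> Hom C M Q" "epi_arr C q" "Cod C q \<notin> \<X>"
    and max: "\<And>R r. r \<in> Hom C Q R \<Longrightarrow> epi_arr C r \<Longrightarrow> Cod C (r \<cdot> q) \<notin> \<X> \<Longrightarrow> mono_arr C r"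
    using noetherian_maximal_quotient[OF M I, of "\<lambda>q. Cod C q \<notin> \<X>"] \<open>M \<notin> \<X>\<close> HomD(3)[OF I(1)] by metis
  have Q: "Q \<notin> \<X>" "noetherian C Q" using q HomD(3)[OF q(1)] noetherian_quotient[OF M] by auto
  then have "nonzero_obj C Q" using \<X>D(2) noetherian_Obj by (auto simp: nonzero_obj_def)
  then obtain H h where H: "monoform C H" and h: "h \<in> Hom C H Q" "mono_arr C h"
    using noetherian_monoform_subobject[OF Q(2)] by metis
  have "atom C H \<in> Supp C M"
    using SuppI[OF H subquotient_trans[OF subquotient_epi[OF q(1,2)] subquotient_mono[OF h]]] .
  then obtain Y H' where Y: "Y \<in> \<X>" and H': "monoform C H'" "subquotient C Y H'" "atom C H = atom C H'"
    using supp by (auto simp: Supp_def)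
  then obtain K a b where K: "nonzero_obj C K" and a: "a \<in> Hom C K H" "mono_arr C a"
    and b: "b \<in> Hom C K H'" "mono_arr C b"
    using atom_eq_iff[OF H] unfolding common_subobject_def by blast
  \<comment> \<open>\<open>K\<close> embeds in a subquotient of \<open>Y\<close>, so the Serre
    conditions reach it.\<close>
  have "K \<in> \<X>"
    using subquotientE[OF H'(2)] \<X>D(3,4) Y b by metis
  note ha = Comp_in_Hom[OF a(1) h(1)] and ham = mono_comp[OF a(2) h(2) a(1) h(1)]
  obtain R r where r: "r \<in> Hom C Q R" "epi_arr C r" "zero_arr C (r \<cdot> (h \<cdot> a))" "is_cokernel C (h \<cdot> a) r"
    using cokernelE[OF ha] by metis
  have "\<not> mono_arr C r"
    using mono_zero_cancel[OF _ r(1) ha r(3)] nonzero_obj_mono(1)[OF ha ham K] by blast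
  then have "R \<in> \<X>" using max[OF r(1,2)] HomD(3)[OF Comp_in_Hom[OF q(1) r(1)]] by auto
  then have "Q \<in> \<X>" using \<X>D(5)[OF ha ham r(1,4) \<open>K \<in> \<X>\<close>] N[OF Q(2)] by blast
  then show False using Q by blast
qed

end

section \<open>Direct limits and supports of small jointly epimorphic families\<close>

lemma is_coproductD:
  assumes "is_coproduct C I F P \<iota>" "Y \<in> Obj C" "\<And>i. i \<in> I \<Longrightarrow> f i \<in> Hom C (F i) Y"
  shows "\<exists>!u. u \<in> Hom C P Y \<and> (\<forall>i \<in> I. u \<cdot>\<^bsub>C\<^esub> \<iota> i = f i)"
  using assms by (simp add: is_coproduct_def)

context abelian_category
begin

text \<open>The quotient of \<open>N\<close> by a finite sum of images, obtained by dividing out one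
  image at a time, so that the sum itself never has to be formed.\<close>

lemma finite_family_cokernel:
  assumes "finite J" "\<And>i. i \<in> J \<Longrightarrow> f i \<in> Hom C (F i) N" "N \<in> Obj C"
  shows "\<exists>Q c. c \<in> Hom C N Q \<and> epi_arr C c \<and> (\<forall>i \<in> J. zero_arr C (c \<cdot> f i)) \<and>
    (\<forall>Y g. g \<in> Hom C N Y \<and> (\<forall>i \<in> J. zero_arr C (g \<cdot> f i)) \<longrightarrow> (\<exists>u \<in> Hom C Q Y. u \<cdot> c = g))"
  using assms(1,2)
proof (induction J rule: finite_induct)
  case empty
  have "\<exists>u \<in> Hom C N Y. u \<cdot> Ident C N = g" if "g \<in> Hom C N Y" for Y g
    using Comp_Ident[OF that] that by blast
  then show ?case using Ident_in_Hom epi_Ident assms(3) by blast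
next
  case (insert j J)
  then obtain Q c where c: "c \<in> Hom C N Q" "epi_arr C c" and z: "\<forall>i \<in> J. zero_arr C (c \<cdot> f i)"
    and univ: "\<forall>Y g. g \<in> Hom C N Y \<and> (\<forall>i \<in> J. zero_arr C (g \<cdot> f i)) \<longrightarrow> (\<exists>u \<in> Hom C Q Y. u \<cdot> c = g)"
    by auto
  have fj: "f j \<in> Hom C (F j) N" using insert.prems by blast
  obtain R q where q: "q \<in> Hom C Q R" "epi_arr C q" "zero_arr C (q \<cdot> (c \<cdot> f j))"
    "\<And>Z h. h \<in> Hom C Q Z \<Longrightarrow> zero_arr C (h \<cdot> (c \<cdot> f j)) \<Longrightarrow> \<exists>u \<in> Hom C R Z. u \<cdot> q = h"
    using cokernelE[OF Comp_in_Hom[OF fj c(1)]] by metis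
  have "zero_arr C ((q \<cdot> c) \<cdot> f i)" if i: "i \<in> insert j J" for i
    using i q(3) z zero_arr_assoc(2)[OF insert.prems[OF i] c(1) q(1)]
      Comp_assoc[OF insert.prems[OF i] c(1) q(1)] by auto
  moreover have "\<exists>u \<in> Hom C R Y. u \<cdot> (q \<cdot> c) = g"
    if g: "g \<in> Hom C N Y" and gz: "\<forall>i \<in> insert j J. zero_arr C (g \<cdot> f i)" for Y g
  proof -
    obtain u where u: "u \<in> Hom C Q Y" "u \<cdot> c = g" using univ g gz by blast
    then have "zero_arr C (u \<cdot> (c \<cdot> f j))" using gz Comp_assoc[OF fj c(1) u(1)] by simp
    then obtain v where v: "v \<in> Hom C R Y" "v \<cdot> q = u" using q(4)[OF u(1)] by blast
    then show ?thesis using Comp_assoc[OF c(1) q(1) v(1)] u by auto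
  qed
  ultimately show ?case
    using Comp_in_Hom[OF c(1) q(1)] epi_comp[OF c(2) q(2) c(1) q(1)] by blast
qed

text \<open>The uniqueness half of the universal property, applied to \<open>u\<close> and a zero
  arrow.\<close>

lemma coproduct_jointly_epi:
  assumes "is_coproduct C I F P \<iota>" "u \<in> Hom C P Y" "\<And>i. i \<in> I \<Longrightarrow> zero_arr C (u \<cdot> \<iota> i)"
  shows "zero_arr C u"
proof -
  have \<iota>: "\<iota> i \<in> Hom C (F i) P" if "i \<in> I" for i using assms(1) that by (simp add: is_coproduct_def)
  obtain z where z: "z \<in> Hom C P Y" "zero_arr C z" using zero_arr_exists HomD[OF assms(2)] by metis
  have eq: "z \<cdot> \<iota> i = u \<cdot> \<iota> i" if i: "i \<in> I" for i
    using zero_arr_unique[OF zero_arr_comp_right[OF z(2,1) \<iota>[OF i]] assms(3)[OF i]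
        Comp_in_Hom[OF \<iota>[OF i] z(1)] Comp_in_Hom[OF \<iota>[OF i] assms(2)]] .
  have "\<exists>!v. v \<in> Hom C P Y \<and> (\<forall>i \<in> I. v \<cdot> \<iota> i = u \<cdot> \<iota> i)"
    by (rule is_coproductD[OF assms(1) HomD(5)[OF assms(2)] Comp_in_Hom[OF \<iota> assms(2)]])
  then have "u = z" using assms(2) z(1) eq by blast
  then show ?thesis using z by simp
qed

end

section \<open>Small sets, exact direct limits and infinite sums\<close>

context grothendieck_category
begin

lemma Cinfinite_bound: "Card_order \<kappa>" "regularCard \<kappa>" "cinfinite \<kappa>"
  using size_bound natLeq_cinfinite cinfinite_mono ordLess_imp_ordLeq
  unfolding size_bound_def by blast+

lemma small_subset: "small \<kappa> B \<Longrightarrow> A \<subseteq> B \<Longrightarrow> small \<kappa> A"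
  unfolding small_def using card_of_mono1 ordLeq_ordLess_trans by blast

lemma small_image: "small \<kappa> A \<Longrightarrow> small \<kappa> (f ` A)"
  unfolding small_def using card_of_image ordLeq_ordLess_trans by blast

text \<open>Regularity of \<open>\<kappa>\<close> is what bounds the union.\<close>

lemma small_UN: "small \<kappa> I \<Longrightarrow> (\<And>i. i \<in> I \<Longrightarrow> small \<kappa> (A i)) \<Longrightarrow> small \<kappa> (\<Union>i \<in> I. A i)"
  unfolding small_def
  using card_of_UNION_ordLess_infinite_Field_regularCard[of \<kappa> I A] Cinfinite_bound by blast

lemma small_UNIV_nat: "small \<kappa> (UNIV :: nat set)"
  unfolding small_def using size_bound card_of_nat ordIso_ordLess_trans
  unfolding size_bound_def by blast

text \<open>A subset with \<open>n + 1\<close> elements adds one point to a subset with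
  \<open>n\<close> elements, so each layer is small by regularity. There are countably many layers,
  and \<open>\<kappa>\<close> is uncountable.\<close>

lemma small_finite_subsets:
  assumes "small \<kappa> I"
  shows "small \<kappa> {J. J \<subseteq> I \<and> finite J}"
proof -
  have "small \<kappa> {J. J \<subseteq> I \<and> finite J \<and> card J = n}" for n
  proof (induction n)
    case 0
    have "{J. J \<subseteq> I \<and> finite J \<and> card J = 0} \<subseteq> (\<lambda>_. {}) ` (UNIV :: nat set)" by auto
    then show ?case using small_image[OF small_UNIV_nat] small_subset by blast
  next
    case (Suc n)
    have "{J. J \<subseteq> I \<and> finite J \<and> card J = Suc n} \<subseteq>
      (\<Union>J \<in> {J. J \<subseteq> I \<and> finite J \<and> card J = n}. (\<lambda>x. insert x J) ` I)" (is "_ \<subseteq> ?B")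
    proof
      fix J assume J: "J \<in> {J. J \<subseteq> I \<and> finite J \<and> card J = Suc n}"
      then obtain x K where "J = insert x K" "x \<notin> K" "card K = n" "finite K"
        by (auto simp: card_Suc_eq_finite)
      then show "J \<in> ?B" using J by auto
    qed
    moreover have "small \<kappa> ?B" by (intro small_UN[OF Suc] small_image[OF assms])
    ultimately show ?case using small_subset by blast
  qed
  then have "small \<kappa> (\<Union>n. {J. J \<subseteq> I \<and> finite J \<and> card J = n})"
    by (intro small_UN[OF small_UNIV_nat])
  then show ?thesis by (rule small_subset) auto
qed

text \<open>Coproducts and exact direct limits are available over index sets in the type of
  \<open>\<kappa>\<close>; this moves any small family there.\<close>

lemma small_bij:
  assumes "small \<kappa> A"
  obtains D :: "'u set" and K where "small \<kappa> D" "bij_betw K D A"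
proof -
  have "|A| \<le>o |Field \<kappa>|"
    using assms card_of_Field_ordIso[OF Cinfinite_bound(1)] ordLess_imp_ordLeq ordIso_symmetric
      ordLeq_ordIso_trans unfolding small_def by blast
  then obtain f where f: "inj_on f A" "f ` A \<subseteq> Field \<kappa>"
    unfolding card_of_ordLeq[symmetric] by blast
  then have "bij_betw (inv_into A f) (f ` A) A" by (intro bij_betw_inv_into) (simp add: bij_betw_def)
  then show ?thesis using that[OF small_image[OF assms]] by blast
qed

text \<open>If a subobject \<open>H\<close> of \<open>N\<close> meets none of the finite sums \<open>N\<^sub>J\<close> of a generating
  family of subobjects, then the limit of \<open>0 \<rightarrow> H \<rightarrow> N/N\<^sub>J \<rightarrow> N/(N\<^sub>J + H) \<rightarrow> 0\<close> is
  \<open>0 \<rightarrow> H \<rightarrow> 0 \<rightarrow> 0 \<rightarrow> 0\<close>, so \<open>H\<close> is zero by exactness.\<close>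

lemma directed_union_meets_subobject:
  assumes I: "small \<kappa> I" and f: "\<And>i. i \<in> I \<Longrightarrow> f i \<in> Hom C (F i) N"
    and epi: "\<And>Y u. u \<in> Hom C N Y \<Longrightarrow> (\<And>i. i \<in> I \<Longrightarrow> zero_arr C (u \<cdot> f i)) \<Longrightarrow> zero_arr C u"
    and h: "h \<in> Hom C H N" "nonzero_obj C H"
  shows "\<exists>J Q c. finite J \<and> J \<subseteq> I \<and> c \<in> Hom C N Q \<and> (\<forall>i \<in> J. zero_arr C (c \<cdot> f i)) \<and>
    (\<forall>Y g. g \<in> Hom C N Y \<and> (\<forall>i \<in> J. zero_arr C (g \<cdot> f i)) \<longrightarrow> (\<exists>u \<in> Hom C Q Y. u \<cdot> c = g)) \<and>
    \<not> mono_arr C (c \<cdot> h)"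
proof (rule ccontr)
  assume contra: "\<not> ?thesis"
  have N: "N \<in> Obj C" using HomD h by blast
  \<comment> \<open>\<open>D\<close> codes the finite subsets \<open>K i\<close> of \<open>I\<close>
    by elements of the type over which direct limits are exact.\<close>
  obtain D :: "'u set" and K where D: "small \<kappa> D" "bij_betw K D {J. J \<subseteq> I \<and> finite J}"
    using small_bij[OF small_finite_subsets[OF I]] by metis
  have K: "K i \<subseteq> I" "finite (K i)" if "i \<in> D" for i using D(2) that by (auto simp: bij_betw_def)
  have K_surj: "\<exists>i \<in> D. K i = J" if "J \<subseteq> I" "finite J" for J
  proof -
    have "J \<in> K ` D" using D(2) that by (simp add: bij_betw_def)
    then show ?thesis by blast
  qed
  define leq where "leq i j \<longleftrightarrow> K i \<subseteq> K j" for i j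
  have "directed D leq"
    unfolding directed_def
  proof (intro conjI ballI impI)
    show "D \<noteq> {}" using K_surj[of "{}"] by auto
    fix i j assume ij: "i \<in> D" "j \<in> D"
    obtain k where "k \<in> D" "K k = K i \<union> K j" using K_surj[of "K i \<union> K j"] K ij by auto
    then show "\<exists>k \<in> D. leq i k \<and> leq j k" by (auto simp: leq_def)
  qed (auto simp: leq_def)
  then have upper: "\<exists>k \<in> D. leq i k \<and> leq j k" if "i \<in> D" "j \<in> D" for i j
    using that unfolding directed_def by blast
  \<comment> \<open>The quotient \<open>N/N\<^sub>J\<close> for \<open>J = K i\<close>, together
    with its universal property, which later yields the transition arrows.\<close>
  have "\<forall>i. \<exists>Q c. i \<in> D \<longrightarrow> c \<in> Hom C N Q \<and> epi_arr C c \<and> (\<forall>x \<in> K i. zero_arr C (c \<cdot> f x)) \<and>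
    (\<forall>Y g. g \<in> Hom C N Y \<and> (\<forall>x \<in> K i. zero_arr C (g \<cdot> f x)) \<longrightarrow> (\<exists>u \<in> Hom C Q Y. u \<cdot> c = g))"
  proof (intro allI)
    fix i
    show "\<exists>Q c. i \<in> D \<longrightarrow> c \<in> Hom C N Q \<and> epi_arr C c \<and> (\<forall>x \<in> K i. zero_arr C (c \<cdot> f x)) \<and>
      (\<forall>Y g. g \<in> Hom C N Y \<and> (\<forall>x \<in> K i. zero_arr C (g \<cdot> f x)) \<longrightarrow> (\<exists>u \<in> Hom C Q Y. u \<cdot> c = g))"
    proof (cases "i \<in> D")
      case True
      have "\<exists>Q c. c \<in> Hom C N Q \<and> epi_arr C c \<and> (\<forall>x \<in> K i. zero_arr C (c \<cdot> f x)) \<and>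
        (\<forall>Y g. g \<in> Hom C N Y \<and> (\<forall>x \<in> K i. zero_arr C (g \<cdot> f x)) \<longrightarrow> (\<exists>u \<in> Hom C Q Y. u \<cdot> c = g))"
        by (rule finite_family_cokernel[where F = F, OF K(2)[OF True] _ N]) (use f K(1)[OF True] in blast)
      then show ?thesis by (elim exE) (intro exI impI)
    qed blast
  qed
  then obtain Q c where Qc: "\<forall>i. i \<in> D \<longrightarrow> c i \<in> Hom C N (Q i) \<and> epi_arr C (c i) \<and>
    (\<forall>x \<in> K i. zero_arr C (c i \<cdot> f x)) \<and>
    (\<forall>Y g. g \<in> Hom C N Y \<and> (\<forall>x \<in> K i. zero_arr C (g \<cdot> f x)) \<longrightarrow> (\<exists>u \<in> Hom C (Q i) Y. u \<cdot> c i = g))"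
    unfolding choice_iff by (elim exE) (rule that)
  have c: "c i \<in> Hom C N (Q i)" "epi_arr C (c i)" and cz: "\<And>x. x \<in> K i \<Longrightarrow> zero_arr C (c i \<cdot> f x)"
    and cu: "\<And>Y g. g \<in> Hom C N Y \<Longrightarrow> (\<And>x. x \<in> K i \<Longrightarrow> zero_arr C (g \<cdot> f x)) \<Longrightarrow> \<exists>u \<in> Hom C (Q i) Y. u \<cdot> c i = g"
    if "i \<in> D" for i
    using Qc that by blast+
  define \<alpha> where "\<alpha> i = c i \<cdot> h" for i
  have \<alpha>: "\<alpha> i \<in> Hom C H (Q i)" if "i \<in> D" for i using Comp_in_Hom[OF h(1) c(1)[OF that]] by (simp add: \<alpha>_def)
  \<comment> \<open>Here the assumption for contradiction enters: \<open>H\<close> meets none of the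
    finite sums, so it embeds in each quotient.\<close>
  have \<alpha>_mono: "mono_arr C (\<alpha> i)" if i: "i \<in> D" for i
  proof (rule ccontr)
    assume "\<not> mono_arr C (\<alpha> i)"
    then have "finite (K i) \<and> K i \<subseteq> I \<and> c i \<in> Hom C N (Q i) \<and> (\<forall>x \<in> K i. zero_arr C (c i \<cdot> f x)) \<and>
      (\<forall>Y g. g \<in> Hom C N Y \<and> (\<forall>x \<in> K i. zero_arr C (g \<cdot> f x)) \<longrightarrow> (\<exists>u \<in> Hom C (Q i) Y. u \<cdot> c i = g)) \<and>
      \<not> mono_arr C (c i \<cdot> h)"
      using K[OF i] Qc i by (simp add: \<alpha>_def)
    with contra show False by (elim notE) (intro exI)
  qed
  have "\<forall>i \<in> D. \<exists>q. is_cokernel C (\<alpha> i) q" using cokernels HomD(1)[OF \<alpha>] by blast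
  then obtain \<beta> where \<beta>_coker: "\<And>i. i \<in> D \<Longrightarrow> is_cokernel C (\<alpha> i) (\<beta> i)" by metis
  define B where "B i = Cod C (\<beta> i)" for i
  note \<beta>D = is_cokernelD[OF \<beta>_coker \<alpha>, folded B_def]
  have "\<forall>i j. \<exists>\<phi>. i \<in> D \<longrightarrow> j \<in> D \<longrightarrow> leq i j \<longrightarrow> \<phi> \<in> Hom C (Q i) (Q j) \<and> \<phi> \<cdot> c i = c j"
    using cu[OF _ c(1) cz] unfolding leq_def by blast
  then obtain \<phi> where "\<forall>i j. i \<in> D \<longrightarrow> j \<in> D \<longrightarrow> leq i j \<longrightarrow> \<phi> i j \<in> Hom C (Q i) (Q j) \<and> \<phi> i j \<cdot> c i = c j"
    unfolding choice_iff by (elim exE) (rule that)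
  then have \<phi>: "\<phi> i j \<in> Hom C (Q i) (Q j)" "\<phi> i j \<cdot> c i = c j" if "i \<in> D" "j \<in> D" "leq i j" for i j
    using that by blast+
  have \<phi>\<alpha>: "\<phi> i j \<cdot> \<alpha> i = \<alpha> j" if ij: "i \<in> D" "j \<in> D" "leq i j" for i j
    using Comp_assoc[OF h(1) c(1)[OF ij(1)] \<phi>(1)[OF ij]] \<phi>(2)[OF ij] by (simp add: \<alpha>_def)
  have "\<exists>\<psi>. \<psi> \<in> Hom C (B i) (B j) \<and> \<psi> \<cdot> \<beta> i = \<beta> j \<cdot> \<phi> i j" if ij: "i \<in> D" "j \<in> D" "leq i j" for i j
  proof -
    have "zero_arr C ((\<beta> j \<cdot> \<phi> i j) \<cdot> \<alpha> i)"
      using Comp_assoc[OF \<alpha>[OF ij(1)] \<phi>(1)[OF ij] \<beta>D(1)[OF ij(2,2)]] \<phi>\<alpha>[OF ij] \<beta>D(2)[OF ij(2,2)] by simp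
    then show ?thesis
      using \<beta>D(4)[OF ij(1,1) Comp_in_Hom[OF \<phi>(1)[OF ij] \<beta>D(1)[OF ij(2,2)]]] by blast
  qed
  then have "\<forall>i j. \<exists>\<psi>. i \<in> D \<longrightarrow> j \<in> D \<longrightarrow> leq i j \<longrightarrow> \<psi> \<in> Hom C (B i) (B j) \<and> \<psi> \<cdot> \<beta> i = \<beta> j \<cdot> \<phi> i j"
    by blast
  then obtain \<psi> where "\<forall>i j. i \<in> D \<longrightarrow> j \<in> D \<longrightarrow> leq i j \<longrightarrow> \<psi> i j \<in> Hom C (B i) (B j) \<and> \<psi> i j \<cdot> \<beta> i = \<beta> j \<cdot> \<phi> i j"
    unfolding choice_iff by (elim exE) (rule that)
  then have \<psi>: "\<psi> i j \<in> Hom C (B i) (B j)" "\<psi> i j \<cdot> \<beta> i = \<beta> j \<cdot> \<phi> i j" if "i \<in> D" "j \<in> D" "leq i j" for i j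
    using that by blast+
  have refl: "leq i i" for i by (simp add: leq_def)
  have trans: "leq i j \<Longrightarrow> leq j k \<Longrightarrow> leq i k" for i j k by (auto simp: leq_def)
  have HO: "H \<in> Obj C" using HomD h by blast
  note HI = Ident_in_Hom[OF HO]
  have sysH: "direct_system C D leq (\<lambda>_. H) (\<lambda>_ _. Ident C H)"
    using HO HI Comp_Ident[OF HI] by (simp add: direct_system_def)
  have QO: "Q i \<in> Obj C" and BO: "B i \<in> Obj C" if "i \<in> D" for i
    using HomD(5)[OF c(1)[OF that]] HomD(5)[OF \<beta>D(1)[OF that that]] by auto
  have \<phi>id: "\<phi> i i = Ident C (Q i)" if i: "i \<in> D" for i
    using epi_cancel[OF c(2,1)[OF i] \<phi>(1)[OF i i refl] Ident_in_Hom[OF QO[OF i]]]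
      \<phi>(2)[OF i i refl] Ident_Comp[OF c(1)[OF i]] by simp
  have \<phi>comp: "\<phi> j k \<cdot> \<phi> i j = \<phi> i k" if ijk: "i \<in> D" "j \<in> D" "k \<in> D" "leq i j" "leq j k" for i j k
  proof (rule epi_cancel[OF c(2,1)[OF ijk(1)]])
    show "\<phi> j k \<cdot> \<phi> i j \<in> Hom C (Q i) (Q k)" "\<phi> i k \<in> Hom C (Q i) (Q k)"
      using Comp_in_Hom \<phi>(1) ijk trans by blast+
    show "(\<phi> j k \<cdot> \<phi> i j) \<cdot> c i = \<phi> i k \<cdot> c i"
      using Comp_assoc[OF c(1)[OF ijk(1)] \<phi>(1)[OF ijk(1,2,4)] \<phi>(1)[OF ijk(2,3,5)]] \<phi>(2) ijk trans by metis
  qed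
  have sysQ: "direct_system C D leq Q \<phi>"
    using QO \<phi>(1) \<phi>id \<phi>comp by (simp add: direct_system_def)
  have \<psi>id: "\<psi> i i = Ident C (B i)" if i: "i \<in> D" for i
    using epi_cancel[OF \<beta>D(3,1)[OF i i] \<psi>(1)[OF i i refl] Ident_in_Hom[OF BO[OF i]]]
      \<psi>(2)[OF i i refl] Ident_Comp[OF \<beta>D(1)[OF i i]] \<phi>id[OF i] Comp_Ident[OF \<beta>D(1)[OF i i]] by simp
  have \<psi>comp: "\<psi> j k \<cdot> \<psi> i j = \<psi> i k" if ijk: "i \<in> D" "j \<in> D" "k \<in> D" "leq i j" "leq j k" for i j k
  proof (rule epi_cancel[OF \<beta>D(3,1)[OF ijk(1,1)]])
    note ik = trans[OF ijk(4,5)]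
    show "\<psi> j k \<cdot> \<psi> i j \<in> Hom C (B i) (B k)" "\<psi> i k \<in> Hom C (B i) (B k)"
      using Comp_in_Hom \<psi>(1) ijk ik by blast+
    have "(\<psi> j k \<cdot> \<psi> i j) \<cdot> \<beta> i = \<psi> j k \<cdot> (\<beta> j \<cdot> \<phi> i j)"
      using Comp_assoc[OF \<beta>D(1)[OF ijk(1,1)] \<psi>(1)[OF ijk(1,2,4)] \<psi>(1)[OF ijk(2,3,5)]] \<psi>(2)[OF ijk(1,2,4)] by simp
    also have "\<dots> = (\<beta> k \<cdot> \<phi> j k) \<cdot> \<phi> i j"
      using Comp_assoc[OF \<phi>(1)[OF ijk(1,2,4)] \<beta>D(1)[OF ijk(2,2)] \<psi>(1)[OF ijk(2,3,5)]] \<psi>(2)[OF ijk(2,3,5)] by simp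
    also have "\<dots> = \<beta> k \<cdot> \<phi> i k"
      using Comp_assoc[OF \<phi>(1)[OF ijk(1,2,4)] \<phi>(1)[OF ijk(2,3,5)] \<beta>D(1)[OF ijk(3,3)]] \<phi>comp[OF ijk] by simp
    finally show "(\<psi> j k \<cdot> \<psi> i j) \<cdot> \<beta> i = \<psi> i k \<cdot> \<beta> i" using \<psi>(2)[OF ijk(1,3) ik] by simp
  qed
  have sysB: "direct_system C D leq B \<psi>"
    using BO \<psi>(1) \<psi>id \<psi>comp by (simp add: direct_system_def)
  have mor\<alpha>: "system_morphism C D leq (\<lambda>_. H) (\<lambda>_ _. Ident C H) Q \<phi> \<alpha>"
    using \<alpha> \<phi>\<alpha> Comp_Ident[OF \<alpha>] by (simp add: system_morphism_def)
  have mor\<beta>: "system_morphism C D leq Q \<phi> B \<psi> \<beta>"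
    using \<beta>D(1) \<psi>(2) by (simp add: system_morphism_def)
  have ex: "\<forall>i \<in> D. short_exact C (\<alpha> i) (\<beta> i)"
    using mono_is_kernel_of_cokernel[OF \<alpha> \<alpha>_mono \<beta>_coker] \<beta>_coker by (auto simp: short_exact_def)
  \<comment> \<open>Exactness is stated for given limits, so all three are exhibited. For the
    constant system, directedness forces the legs of a cocone to coincide.\<close>
  have limH: "is_direct_limit C D leq (\<lambda>_. H) (\<lambda>_ _. Ident C H) H (\<lambda>_. Ident C H)"
    unfolding is_direct_limit_def
  proof (intro conjI allI impI)
    show "is_cocone C D leq (\<lambda>_. H) (\<lambda>_ _. Ident C H) H (\<lambda>_. Ident C H)"
      using HO HI Comp_Ident[OF HI] by (simp add: is_cocone_def)
    fix Y m assume m: "is_cocone C D leq (\<lambda>_. H) (\<lambda>_ _. Ident C H) Y m"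
    have mH: "m i \<in> Hom C H Y" if "i \<in> D" for i using m that by (simp add: is_cocone_def)
    have step: "m i = m j" if "i \<in> D" "j \<in> D" "leq i j" for i j
      using m that Comp_Ident[OF mH[OF that(2)]] by (simp add: is_cocone_def)
    obtain i0 where i0: "i0 \<in> D" using K_surj[of "{}"] by auto
    have "m i = m i0" if i: "i \<in> D" for i
    proof -
      obtain k where "k \<in> D" "leq i k" "leq i0 k" using upper[OF i i0] by blast
      then show ?thesis using step i i0 by metis
    qed
    then have "\<forall>i \<in> D. m i0 \<cdot> Ident C H = m i" using Comp_Ident[OF mH[OF i0]] by simp
    moreover have "u = m i0" if "u \<in> Hom C H Y" "\<forall>i \<in> D. u \<cdot> Ident C H = m i" for u
      using that i0 Comp_Ident[OF that(1)] by simp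
    ultimately show "\<exists>!u. u \<in> Hom C H Y \<and> (\<forall>i \<in> D. u \<cdot> Ident C H = m i)"
      using mH[OF i0] by blast
  qed
  obtain Z where Z: "zero_obj C Z" using zero_obj_exists by blast
  have ZO: "Z \<in> Obj C" using Z by (simp add: zero_obj_def)
  \<comment> \<open>The composite \<open>m i \<cdot> c i\<close> is the same for all
    \<open>i\<close>. For each \<open>x\<close> it can be computed at an index \<open>j\<close> with
    \<open>K j = {x}\<close>, where \<open>c j\<close> kills \<open>f x\<close>; so it kills the
    whole family and vanishes.\<close>
  have cocone0: "zero_arr C (m i)" if m: "is_cocone C D leq Q \<phi> Y m" and i: "i \<in> D" for Y m i
  proof -
    have mQ: "m i \<in> Hom C (Q i) Y" if "i \<in> D" for i using m that by (simp add: is_cocone_def)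
    have step: "m i \<cdot> c i = m j \<cdot> c j" if ij: "i \<in> D" "j \<in> D" "leq i j" for i j
    proof -
      have "m j \<cdot> \<phi> i j = m i" using m ij by (simp add: is_cocone_def)
      then show ?thesis using Comp_assoc[OF c(1)[OF ij(1)] \<phi>(1)[OF ij] mQ[OF ij(2)]] \<phi>(2)[OF ij] by simp
    qed
    have "zero_arr C (m i \<cdot> c i)"
    proof (rule epi[OF Comp_in_Hom[OF c(1)[OF i] mQ[OF i]]])
      fix x assume x: "x \<in> I"
      obtain j where j: "j \<in> D" "K j = {x}" using K_surj[of "{x}"] x by auto
      obtain k where k: "k \<in> D" "leq i k" "leq j k"
        using upper[OF i j(1)] by blast
      have "m i \<cdot> c i = m j \<cdot> c j" using step i j k by metis
      moreover have "zero_arr C ((m j \<cdot> c j) \<cdot> f x)"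
        using zero_arr_assoc(2)[OF f[OF x] c(1)[OF j(1)] mQ[OF j(1)]] cz[OF j(1)] j by simp
      ultimately show "zero_arr C ((m i \<cdot> c i) \<cdot> f x)" by simp
    qed
    then show ?thesis using epi_zero_cancel[OF c(2,1)[OF i] mQ[OF i]] by blast
  qed
  \<comment> \<open>Composing with the epimorphisms \<open>\<beta> i\<close> turns a cocone on the
    last system into one on the middle system, which is zero.\<close>
  have coconeB0: "zero_arr C (m i)" if m: "is_cocone C D leq B \<psi> Y m" and i: "i \<in> D" for Y m i
  proof -
    have mB: "m i \<in> Hom C (B i) Y" if "i \<in> D" for i using m that by (simp add: is_cocone_def)
    have "is_cocone C D leq Q \<phi> Y (\<lambda>i. m i \<cdot> \<beta> i)"
      unfolding is_cocone_def
    proof (intro conjI ballI impI)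
      show "Y \<in> Obj C" using m by (simp add: is_cocone_def)
      show "m i \<cdot> \<beta> i \<in> Hom C (Q i) Y" if "i \<in> D" for i using Comp_in_Hom[OF \<beta>D(1)[OF that that] mB[OF that]] .
      fix i j assume ij: "i \<in> D" "j \<in> D" "leq i j"
      have "m j \<cdot> \<psi> i j = m i" using m ij by (simp add: is_cocone_def)
      then show "(m j \<cdot> \<beta> j) \<cdot> \<phi> i j = m i \<cdot> \<beta> i"
        using Comp_assoc[OF \<phi>(1)[OF ij] \<beta>D(1)[OF ij(2,2)] mB[OF ij(2)]]
          Comp_assoc[OF \<beta>D(1)[OF ij(1,1)] \<psi>(1)[OF ij] mB[OF ij(2)]] \<psi>(2)[OF ij] by simp
    qed
    then show ?thesis using cocone0 i epi_zero_cancel[OF \<beta>D(3,1)[OF i i] mB[OF i]] by blast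
  qed
  \<comment> \<open>The arrow to a zero object is unique; naming it supplies both the legs of the
    limit cocones and the arrows between the limits.\<close>
  define toZ where "toZ X = (SOME z. z \<in> Hom C X Z)" for X
  have toZ: "toZ X \<in> Hom C X Z" if "X \<in> Obj C" for X
    using someI_ex[of "\<lambda>z. z \<in> Hom C X Z"] Z that unfolding toZ_def zero_obj_def by blast
  have limZ: "is_direct_limit C D leq E \<epsilon> Z (\<lambda>i. toZ (E i))"
    if sys: "direct_system C D leq E \<epsilon>" and zero: "\<And>Y m i. is_cocone C D leq E \<epsilon> Y m \<Longrightarrow> i \<in> D \<Longrightarrow> zero_arr C (m i)"
    for E \<epsilon>
    unfolding is_direct_limit_def
  proof (intro conjI allI impI)
    have E: "E i \<in> Obj C" if "i \<in> D" for i using sys that by (simp add: direct_system_def)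
    show "is_cocone C D leq E \<epsilon> Z (\<lambda>i. toZ (E i))"
      unfolding is_cocone_def
    proof (intro conjI ballI impI ZO)
      show "toZ (E i) \<in> Hom C (E i) Z" if "i \<in> D" for i using toZ E that by blast
      fix i j assume ij: "i \<in> D" "j \<in> D" "leq i j"
      then have "\<epsilon> i j \<in> Hom C (E i) (E j)" using sys by (simp add: direct_system_def)
      then show "toZ (E j) \<cdot> \<epsilon> i j = toZ (E i)"
        using zero_obj_Hom_unique(1)[OF Z Comp_in_Hom] toZ E ij by blast
    qed
    fix Y m assume m: "is_cocone C D leq E \<epsilon> Y m"
    then have "Y \<in> Obj C" and mE: "\<And>i. i \<in> D \<Longrightarrow> m i \<in> Hom C (E i) Y" by (auto simp: is_cocone_def)
    then obtain u where u: "u \<in> Hom C Z Y" using Z by (auto simp: zero_obj_def)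
    have "u \<cdot> toZ (E i) = m i" if i: "i \<in> D" for i
    proof (rule zero_arr_unique[OF _ zero[OF m i] _ mE[OF i]])
      show "zero_arr C (u \<cdot> toZ (E i))"
        using zero_arr_comp_right[OF zero_arr_zero_obj[OF Z u] u toZ[OF E[OF i]]] .
      show "u \<cdot> toZ (E i) \<in> Hom C (E i) Y" using Comp_in_Hom[OF toZ[OF E[OF i]] u] .
    qed
    then show "\<exists>!u. u \<in> Hom C Z Y \<and> (\<forall>i \<in> D. u \<cdot> toZ (E i) = m i)"
      using u zero_obj_Hom_unique(2)[OF Z] by blast
  qed
  have limQ: "is_direct_limit C D leq Q \<phi> Z (\<lambda>i. toZ (Q i))"
    by (rule limZ) (fact sysQ cocone0)+
  have limB: "is_direct_limit C D leq B \<psi> Z (\<lambda>i. toZ (B i))"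
    by (rule limZ) (fact sysB coconeB0)+
  have toZ_comp: "toZ Y \<cdot> g = toZ X" if g: "g \<in> Hom C X Y" for g X Y
    using zero_obj_Hom_unique(1)[OF Z Comp_in_Hom[OF g toZ] toZ] HomD[OF g] by blast
  have 1: "\<forall>i \<in> D. toZ H \<cdot> Ident C H = toZ (Q i) \<cdot> \<alpha> i" and 2: "\<forall>i \<in> D. toZ Z \<cdot> toZ (Q i) = toZ (B i) \<cdot> \<beta> i"
    using toZ_comp[OF \<alpha>] toZ_comp[OF HI] toZ_comp[OF \<beta>D(1)] toZ_comp[OF toZ[OF QO]] by auto
  \<comment> \<open>The limit sequence is \<open>H \<rightarrow> Z \<rightarrow> Z\<close>. Its
    first arrow is a kernel and hence mono, which is impossible for a nonzero
    \<open>H\<close>.\<close>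
  have "short_exact C (toZ H) (toZ Z)"
    by (rule exact_direct_limits[unfolded exact_direct_limits_def, rule_format,
        OF D(1) \<open>directed D leq\<close> sysH sysQ sysB mor\<alpha> mor\<beta> _ limH limQ limB
        toZ[OF HO] _ toZ[OF ZO]])
      (use ex 1 2 in blast)+
  then have "mono_arr C (toZ H)"
    using is_kernelD(3) toZ[OF ZO] unfolding short_exact_def by blast
  then show False using nonzero_obj_mono(2)[OF toZ[OF HO] _ h(2)] Z by (simp add: nonzero_obj_def)
qed

text \<open>Inside a quotient \<open>N\<close> of \<open>M\<close> that contains \<open>H\<close>,
  some finite subfamily has a sum of images \<open>P\<close> that meets \<open>H\<close> in a
  nonzero \<open>L\<close>. The finite case bounds the support of \<open>P\<close>, and
  \<open>L\<close> has the atom of \<open>H\<close>.\<close>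

lemma Supp_jointly_epi:
  assumes I: "small \<kappa> I" and f: "\<And>i. i \<in> I \<Longrightarrow> f i \<in> Hom C (F i) M"
    and epi: "\<And>Y u. u \<in> Hom C M Y \<Longrightarrow> (\<And>i. i \<in> I \<Longrightarrow> zero_arr C (u \<cdot> f i)) \<Longrightarrow> zero_arr C u"
  shows "Supp C M \<subseteq> (\<Union>i \<in> I. Supp C (F i))"
proof
  fix \<alpha> assume "\<alpha> \<in> Supp C M"
  then obtain H where H: "monoform C H" "subquotient C M H" and \<alpha>: "\<alpha> = atom C H"
    by (auto simp: Supp_def)
  obtain N t h where t: "t \<in> Hom C M N" "epi_arr C t" and h: "h \<in> Hom C H N" "mono_arr C h"
    using H(2) subquotient_iff_sub_of_quotient by blast
  have tf: "t \<cdot> f i \<in> Hom C (F i) N" if "i \<in> I" for i using Comp_in_Hom[OF f t(1)] that by blast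
  have tf_epi: "zero_arr C u" if u: "u \<in> Hom C N Y" and z: "\<And>i. i \<in> I \<Longrightarrow> zero_arr C (u \<cdot> (t \<cdot> f i))" for u Y
  proof -
    have "zero_arr C (u \<cdot> t)"
      using epi[OF Comp_in_Hom[OF t(1) u]] z Comp_assoc[OF f t(1) u] by simp
    then show ?thesis using epi_zero_cancel[OF t(2,1) u] by blast
  qed
  have "\<exists>J Q c. finite J \<and> J \<subseteq> I \<and> c \<in> Hom C N Q \<and> (\<forall>i \<in> J. zero_arr C (c \<cdot> (t \<cdot> f i))) \<and>
    (\<forall>Y g. g \<in> Hom C N Y \<and> (\<forall>i \<in> J. zero_arr C (g \<cdot> (t \<cdot> f i))) \<longrightarrow> (\<exists>u \<in> Hom C Q Y. u \<cdot> c = g)) \<and>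
    \<not> mono_arr C (c \<cdot> h)"
    by (rule directed_union_meets_subobject[of I "\<lambda>i. t \<cdot> f i" F N h H])
      (fact I tf tf_epi h(1) monoform_nonzero[OF H(1)])+
  then obtain J Q c where J: "finite J" "J \<subseteq> I" and c: "c \<in> Hom C N Q" "\<forall>i \<in> J. zero_arr C (c \<cdot> (t \<cdot> f i))"
    and univ: "\<forall>Y g. g \<in> Hom C N Y \<and> (\<forall>i \<in> J. zero_arr C (g \<cdot> (t \<cdot> f i))) \<longrightarrow> (\<exists>u \<in> Hom C Q Y. u \<cdot> c = g)"
    and nm: "\<not> mono_arr C (c \<cdot> h)"
    by (elim exE conjE) (rule that)
  have cu: "\<exists>u \<in> Hom C Q Y. u \<cdot> c = g"
    if "g \<in> Hom C N Y" "\<And>i. i \<in> J \<Longrightarrow> zero_arr C (g \<cdot> (t \<cdot> f i))" for Y g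
    using univ that by blast
  have fJ: "t \<cdot> f i \<in> Hom C (F i) N" if "i \<in> J" for i using tf J that by blast
  \<comment> \<open>The kernel of \<open>c\<close> is the sum of the images over \<open>J\<close>;
    \<open>family_image\<close> shows that the finitely many arrows are jointly epimorphic on
    it.\<close>
  obtain P m where m: "m \<in> Hom C P N" "mono_arr C m" "is_kernel C c m"
    "\<And>W h. h \<in> Hom C W N \<Longrightarrow> zero_arr C (c \<cdot> h) \<Longrightarrow> \<exists>u \<in> Hom C W P. m \<cdot> u = h"
    using kernelE[OF c(1)] by metis
  obtain e where e: "\<And>i. i \<in> J \<Longrightarrow> e i \<in> Hom C (F i) P" "\<And>i. i \<in> J \<Longrightarrow> m \<cdot> e i = t \<cdot> f i"
    "\<And>Y u. u \<in> Hom C P Y \<Longrightarrow> (\<And>i. i \<in> J \<Longrightarrow> zero_arr C (u \<cdot> e i)) \<Longrightarrow> zero_arr C u"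
    using family_image[of J "\<lambda>i. t \<cdot> f i" F N c Q m P] fJ c cu m(3,1) by blast
  have P: "Supp C P \<subseteq> (\<Union>i \<in> J. Supp C (F i))"
    by (rule Supp_jointly_epi_finite[of J e F P]) (fact J(1) e(1) HomD(4)[OF m(1)] e(3))+
  note ch = Comp_in_Hom[OF h(1) c(1)]
  obtain L k where k: "k \<in> Hom C L H" "mono_arr C k" "zero_arr C ((c \<cdot> h) \<cdot> k)" "nonzero_obj C L"
    using not_mono_kernelE[OF ch nm] by metis
  have "zero_arr C (c \<cdot> (h \<cdot> k))" using k Comp_assoc[OF k(1) h(1) c(1)] by simp
  then obtain v where v: "v \<in> Hom C L P" "m \<cdot> v = h \<cdot> k" using m(4)[OF Comp_in_Hom[OF k(1) h(1)]] by blast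
  have "mono_arr C v" using mono_of_comp[OF _ v(1) m(1)] v mono_comp[OF k(2) h(2) k(1) h(1)] by simp
  then have "atom C L \<in> Supp C P"
    using SuppI[OF monoform_subobject[OF H(1) k(1,2,4)] subquotient_mono[OF v(1)]] by blast
  then have "\<alpha> \<in> Supp C P" using \<alpha> atom_subobject[OF H(1) k(1,2,4)] by simp
  then show "\<alpha> \<in> (\<Union>i \<in> I. Supp C (F i))" using P J(2) by blast
qed

end

section \<open>Noetherian subobjects in a locally noetherian category\<close>

context locally_noetherian_category
begin

text \<open>A noetherian generator separates the identity of \<open>X\<close> from zero, and the
  image of the separating arrow is a nonzero quotient of that generator.\<close>

lemma nonzero_noetherian_subobject:
  assumes "nonzero_obj C X"
  obtains K k where "k \<in> Hom C K X" "mono_arr C k" "nonzero_obj C K" "noetherian C K"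
proof -
  have X: "X \<in> Obj C" using assms by (simp add: nonzero_obj_def)
  obtain S where S: "generating_set C S" "\<forall>U \<in> S. noetherian C U"
    using noetherian_generators by blast
  obtain z where z: "z \<in> Hom C X X" "zero_arr C z" using zero_arr_exists X by metis
  have "Ident C X \<noteq> z" using z assms zero_obj_iff_Ident by (auto simp: nonzero_obj_def)
  then obtain U h where U: "U \<in> S" "h \<in> Hom C U X" "Ident C X \<cdot> h \<noteq> z \<cdot> h"
    using S(1) Ident_in_Hom[OF X] z(1) unfolding generating_set_def by blast
  have "\<not> zero_arr C h"
    using U(3) Ident_Comp[OF U(2)] zero_arr_unique[OF _ zero_arr_comp_right[OF z(2,1) U(2)] U(2) Comp_in_Hom[OF U(2) z(1)]]
    by auto
  obtain I e m where e: "e \<in> Hom C U I" "epi_arr C e" and m: "m \<in> Hom C I X" "mono_arr C m" "m \<cdot> e = h"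
    using imageE[OF U(2)] by metis
  have "\<not> zero_arr C m" using zero_arr_comp_right[OF _ m(1) e(1)] m \<open>\<not> zero_arr C h\<close> by auto
  then show ?thesis
    using that[OF m(1,2)] nonzero_objI(1)[OF m(1)] noetherian_quotient[OF _ e] S(2) U(1) by blast
qed

text \<open>The coproduct is indexed by the arrows from noetherian generators to \<open>M\<close>,
  which form a small set by local smallness. Each arrow contributes its image, a noetherian
  subobject of \<open>M\<close>.\<close>

lemma localizing_determined_by_noetherian_subobjects:
  assumes \<X>: "localizing_subcategory \<kappa> C \<X>" and M: "M \<in> Obj C"
    and sub: "\<And>K k. k \<in> Hom C K M \<Longrightarrow> mono_arr C k \<Longrightarrow> noetherian C K \<Longrightarrow> K \<in> \<X>"
  shows "M \<in> \<X>"
proof -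
  obtain S where S: "small \<kappa> S" "generating_set C S" "\<forall>U \<in> S. noetherian C U"
    using noetherian_generators by blast
  define A where "A = (\<Union>U \<in> S. Hom C U M)"
  have "small \<kappa> A"
    unfolding A_def
  proof (rule small_UN[OF S(1)])
    show "small \<kappa> (Hom C U M)" if "U \<in> S" for U
      using locally_small M S(2) that unfolding generating_set_def by blast
  qed
  then obtain D :: "'c set" and g where D: "small \<kappa> D" "bij_betw g D A" by (rule small_bij)
  have "\<forall>f. \<exists>I m. f \<in> A \<longrightarrow> I \<in> \<X> \<and> m \<in> Hom C I M \<and> (\<exists>e \<in> Hom C (Dom C f) I. m \<cdot> e = f)"
  proof
    fix f
    show "\<exists>I m. f \<in> A \<longrightarrow> I \<in> \<X> \<and> m \<in> Hom C I M \<and> (\<exists>e \<in> Hom C (Dom C f) I. m \<cdot> e = f)"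
    proof (cases "f \<in> A")
      case True
      then obtain U where U: "U \<in> S" "f \<in> Hom C U M" by (auto simp: A_def)
      obtain I e m where e: "e \<in> Hom C U I" "epi_arr C e" and m: "m \<in> Hom C I M" "mono_arr C m" "m \<cdot> e = f"
        using imageE[OF U(2)] by metis
      have "noetherian C I" using noetherian_quotient[OF _ e] S(3) U(1) by blast
      then show ?thesis using sub[OF m(1,2)] m e HomD(2)[OF U(2)] by blast
    qed blast
  qed
  then obtain I m where "\<forall>f. f \<in> A \<longrightarrow> I f \<in> \<X> \<and> m f \<in> Hom C (I f) M \<and> (\<exists>e \<in> Hom C (Dom C f) (I f). m f \<cdot> e = f)"
    unfolding choice_iff by (elim exE) (rule that)
  then have I: "I f \<in> \<X>" and m: "m f \<in> Hom C (I f) M" and e: "\<exists>e \<in> Hom C (Dom C f) (I f). m f \<cdot> e = f"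
    if "f \<in> A" for f
    using that by blast+
  have gA: "g i \<in> A" if "i \<in> D" for i using D(2) that by (auto simp: bij_betw_def)
  have IO: "\<forall>i \<in> D. I (g i) \<in> Obj C" using HomD(4)[OF m[OF gA]] by blast
  obtain P \<iota> where P: "is_coproduct C D (\<lambda>i. I (g i)) P \<iota>" using small_coproducts[OF D(1) IO] by blast
  have closed: "Q \<in> \<X>" if "small \<kappa> J" "\<And>i. i \<in> J \<Longrightarrow> F i \<in> \<X>" "is_coproduct C J F Q \<iota>"
    for J :: "'c set" and F Q \<iota>
    using \<X> that unfolding localizing_subcategory_def by blast
  have "P \<in> \<X>" by (rule closed[OF D(1) _ P]) (rule I[OF gA])
  have \<iota>: "\<iota> i \<in> Hom C (I (g i)) P" if "i \<in> D" for i using P that by (simp add: is_coproduct_def)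
  have "\<exists>!u. u \<in> Hom C P M \<and> (\<forall>i \<in> D. u \<cdot> \<iota> i = m (g i))"
    by (rule is_coproductD[OF P M m[OF gA]])
  then obtain u where u: "u \<in> Hom C P M" "\<And>i. i \<in> D \<Longrightarrow> u \<cdot> \<iota> i = m (g i)" by blast
  \<comment> \<open>A nonzero \<open>v\<close> would be separated from zero by some arrow
    \<open>f\<close> from a generator. But \<open>f\<close> factors through its image, which is a
    summand of \<open>P\<close>, and \<open>v\<close> kills that summand.\<close>
  have "zero_arr C v" if v: "v \<in> Hom C M Y" and vu: "zero_arr C (v \<cdot> u)" for v Y
  proof (rule ccontr)
    assume nz: "\<not> zero_arr C v"
    obtain z where z: "z \<in> Hom C M Y" "zero_arr C z" using zero_arr_exists HomD[OF v] by metis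
    have "v \<noteq> z" using nz z by blast
    then obtain U f where U: "U \<in> S" "f \<in> Hom C U M" "v \<cdot> f \<noteq> z \<cdot> f"
      using S(2) v z(1) unfolding generating_set_def by blast
    then have fA: "f \<in> A" by (auto simp: A_def)
    then obtain i where i: "i \<in> D" "g i = f" using D(2) by (auto simp: bij_betw_def)
    obtain e where e: "e \<in> Hom C U (I f)" "m f \<cdot> e = f" using e[OF fA] HomD[OF U(2)] by auto
    have mi: "m f \<in> Hom C (I f) M" "u \<cdot> \<iota> i = m f" and \<iota>i: "\<iota> i \<in> Hom C (I f) P"
      using m[OF fA] u(2)[OF i(1)] \<iota>[OF i(1)] i by auto
    have "zero_arr C (v \<cdot> m f)"
      using zero_arr_comp_right[OF vu Comp_in_Hom[OF u(1) v] \<iota>i] Comp_assoc[OF \<iota>i u(1) v] mi by simp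
    then have "zero_arr C (v \<cdot> f)" using zero_arr_assoc(1)[OF e(1) mi(1) v] e by simp
    then show False
      using U(3) zero_arr_unique[OF _ zero_arr_comp_right[OF z(2,1) U(2)] Comp_in_Hom[OF U(2) v] Comp_in_Hom[OF U(2) z(1)]]
      by blast
  qed
  then have "epi_arr C u" using epi_iff_zero[OF u(1)] by blast
  moreover have "\<forall>f. epi_arr C f \<and> Dom C f \<in> \<X> \<longrightarrow> Cod C f \<in> \<X>"
    using \<X> unfolding localizing_subcategory_def serre_subcategory_def by (elim conjE)
  ultimately show ?thesis using \<open>P \<in> \<X>\<close> HomD[OF u(1)] by metis
qed

end

section \<open>Serre subcategories of full subcategories\<close>

lemma full_subcat_sel [simp]:
  "Obj (full_subcat C N) = N"
  "Arr (full_subcat C N) = {f \<in> Arr C. Dom C f \<in> N \<and> Cod C f \<in> N}"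
  "Dom (full_subcat C N) = Dom C" "Cod (full_subcat C N) = Cod C"
  "Ident (full_subcat C N) = Ident C" "Comp (full_subcat C N) = Comp C"
  by (simp_all add: full_subcat_def)

lemma Hom_full_subcat: "f \<in> Hom (full_subcat C N) X Y \<longleftrightarrow> f \<in> Hom C X Y \<and> X \<in> N \<and> Y \<in> N"
  by (auto simp: Hom_def)

lemma Hom_full_subcat_eq: "X \<in> N \<Longrightarrow> Y \<in> N \<Longrightarrow> Hom (full_subcat C N) X Y = Hom C X Y"
  by (auto simp: Hom_def)

text \<open>Makes \<open>C\<close> itself the case \<open>N = Obj C\<close> of the comparison that
  follows.\<close>

lemma (in category) full_subcat_Obj: "full_subcat C (Obj C) = C"
  by (rule cat.equality) (auto simp: Dom_in_Obj Cod_in_Obj)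

text \<open>Kernels of arrows between objects of \<open>N\<close> are subobjects and cokernels are
  quotients, so both stay in \<open>N\<close>. This makes the notions intrinsic to the full
  subcategory comparable with those of \<open>C\<close>.\<close>

locale subquotient_closed = abelian_category +
  fixes N
  assumes N_Obj: "N \<subseteq> Obj C"
    and N_zero: "zero_obj C Z \<Longrightarrow> Z \<in> N"
    and N_sub: "\<lbrakk>k \<in> Hom C K X; mono_arr C k; X \<in> N\<rbrakk> \<Longrightarrow> K \<in> N"
    and N_quot: "\<lbrakk>e \<in> Hom C X Q; epi_arr C e; X \<in> N\<rbrakk> \<Longrightarrow> Q \<in> N"
begin

abbreviation D where "D \<equiv> full_subcat C N"

lemma zero_obj_full: "zero_obj D Z \<longleftrightarrow> zero_obj C Z"
proof
  assume Z: "zero_obj D Z"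
  then have ZN: "Z \<in> N" and "\<exists>!f. f \<in> Hom D Z Z" by (auto simp: zero_obj_def)
  then have uniq: "\<exists>!f. f \<in> Hom C Z Z" by (simp add: Hom_full_subcat)
  have ZO: "Z \<in> Obj C" using ZN N_Obj by blast
  obtain z where "z \<in> Hom C Z Z" "zero_arr C z" using zero_arr_exists[OF ZO ZO] .
  then have "zero_arr C (Ident C Z)" using uniq Ident_in_Hom[OF ZO] by metis
  then show "zero_obj C Z" using zero_obj_iff_Ident[OF ZO] by blast
next
  assume Z: "zero_obj C Z"
  then have "\<forall>X \<in> N. (\<exists>!f. f \<in> Hom C X Z) \<and> (\<exists>!f. f \<in> Hom C Z X)"
    using N_Obj unfolding zero_obj_def by blast
  then show "zero_obj D Z" using N_zero[OF Z] by (simp add: zero_obj_def Hom_full_subcat_eq)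
qed

lemma zero_arr_full: "zero_arr D f \<longleftrightarrow> f \<in> Arr D \<and> zero_arr C f"
proof
  assume "zero_arr D f"
  then show "f \<in> Arr D \<and> zero_arr C f"
    unfolding zero_arr_def zero_obj_full Hom_full_subcat full_subcat_sel by blast
next
  assume f: "f \<in> Arr D \<and> zero_arr C f"
  then obtain Z g h where "zero_obj C Z" "g \<in> Hom C (Dom C f) Z" "h \<in> Hom C Z (Cod C f)" "f = h \<cdot> g"
    unfolding zero_arr_def by blast
  then show "zero_arr D f"
    using f N_zero[of Z] unfolding zero_arr_def zero_obj_full Hom_full_subcat full_subcat_sel by blast
qed

text \<open>Failure of cancellation in \<open>C\<close> is witnessed by the kernel of
  \<open>f\<close>, whose domain is a subobject of \<open>X\<close> and hence a test object inside
  \<open>N\<close>.\<close>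

lemma mono_arr_full:
  assumes f: "f \<in> Hom C X Y" and XY: "X \<in> N" "Y \<in> N"
  shows "mono_arr D f \<longleftrightarrow> mono_arr C f"
proof
  have fD: "f \<in> Arr D" "Dom D f = X" using HomD[OF f] XY by auto
  show "mono_arr D f" if "mono_arr C f"
    unfolding mono_arr_def
  proof (intro conjI allI ballI impI fD(1))
    fix W g h assume "g \<in> Hom D W (Dom D f)" "h \<in> Hom D W (Dom D f)" and eq: "f \<cdot>\<^bsub>D\<^esub> g = f \<cdot>\<^bsub>D\<^esub> h"
    then have "g \<in> Hom C W X" "h \<in> Hom C W X" unfolding Hom_full_subcat fD(2) by auto
    then show "g = h" using mono_cancel[OF that f] eq by simp
  qed
  assume m: "mono_arr D f"
  show "mono_arr C f"
  proof (rule ccontr)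
    assume "\<not> mono_arr C f"
    then obtain K k where k: "k \<in> Hom C K X" "mono_arr C k" "zero_arr C (f \<cdot> k)" "nonzero_obj C K"
      using not_mono_kernelE[OF f] by metis
    obtain z where z: "z \<in> Hom C K X" "zero_arr C z" using zero_arr_exists HomD[OF k(1)] by metis
    have "f \<cdot> k = f \<cdot> z"
      by (rule zero_arr_unique[OF k(3) zero_arr_comp_left[OF z(2,1) f] Comp_in_Hom[OF k(1) f] Comp_in_Hom[OF z(1) f]])
    moreover have "k \<in> Hom D K (Dom D f)" "z \<in> Hom D K (Dom D f)"
      using k z N_sub[OF k(1,2)] XY fD by (simp_all add: Hom_full_subcat)
    ultimately have "k = z" using m unfolding mono_arr_def full_subcat_sel(6) by blast
    then show False using nonzero_obj_mono(1)[OF k(1,2,4)] z by blast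
  qed
qed

lemma epi_arr_full:
  assumes f: "f \<in> Hom C X Y" and XY: "X \<in> N" "Y \<in> N"
  shows "epi_arr D f \<longleftrightarrow> epi_arr C f"
proof
  have fD: "f \<in> Arr D" "Cod D f = Y" using HomD[OF f] XY by auto
  show "epi_arr D f" if "epi_arr C f"
    unfolding epi_arr_def
  proof (intro conjI allI ballI impI fD(1))
    fix Z g h assume "g \<in> Hom D (Cod D f) Z" "h \<in> Hom D (Cod D f) Z" and eq: "g \<cdot>\<^bsub>D\<^esub> f = h \<cdot>\<^bsub>D\<^esub> f"
    then have "g \<in> Hom C Y Z" "h \<in> Hom C Y Z" unfolding Hom_full_subcat fD(2) by auto
    then show "g = h" using epi_cancel[OF that f] eq by simp
  qed
  assume m: "epi_arr D f"
  obtain Q q where q: "q \<in> Hom C Y Q" "epi_arr C q" "zero_arr C (q \<cdot> f)"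
    "\<And>Z h. h \<in> Hom C Y Z \<Longrightarrow> zero_arr C (h \<cdot> f) \<Longrightarrow> \<exists>u \<in> Hom C Q Z. u \<cdot> q = h"
    using cokernelE[OF f] by metis
  obtain z where z: "z \<in> Hom C Y Q" "zero_arr C z" using zero_arr_exists HomD[OF q(1)] by metis
  have "q \<cdot> f = z \<cdot> f"
    by (rule zero_arr_unique[OF q(3) zero_arr_comp_right[OF z(2,1) f] Comp_in_Hom[OF f q(1)] Comp_in_Hom[OF f z(1)]])
  moreover have "q \<in> Hom D (Cod D f) Q" "z \<in> Hom D (Cod D f) Q"
    using q z N_quot[OF q(1,2)] XY fD by (simp_all add: Hom_full_subcat)
  ultimately have "q = z" using m unfolding epi_arr_def full_subcat_sel(6) by blast
  then have "zero_arr C h" if "h \<in> Hom C Y Z" "zero_arr C (h \<cdot> f)" for h Z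
    using q(4)[OF that] zero_arr_comp_left[OF z(2,1)] by blast
  then show "epi_arr C f" using epi_iff_zero[OF f] by blast
qed

lemma short_exact_fullI:
  assumes f: "f \<in> Hom C A B" "mono_arr C f" and g: "g \<in> Hom C B E" "is_cokernel C f g"
    and N: "A \<in> N" "B \<in> N" "E \<in> N"
  shows "short_exact D f g"
proof -
  have k: "is_kernel C g f" using mono_is_kernel_of_cokernel[OF f g(2)] .
  note HD = HomD(1-3)[OF f(1)] HomD(1-3)[OF g(1)]
  have AD: "f \<in> Arr D" "g \<in> Arr D" using HD N by auto
  have gf: "zero_arr D (g \<cdot> f)"
    using is_cokernelD(2)[OF g(2) f(1)] HomD(1-3)[OF Comp_in_Hom[OF f(1) g(1)]] N by (simp add: zero_arr_full)
  have "is_kernel D g f"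
    unfolding is_kernel_def
  proof (intro conjI allI ballI impI)
    fix W h assume h: "h \<in> Hom D W (Dom D g)" and z: "zero_arr D (g \<cdot>\<^bsub>D\<^esub> h)"
    then have hC: "h \<in> Hom C W B" "zero_arr C (g \<cdot> h)" "W \<in> N"
      using HD by (auto simp: Hom_full_subcat zero_arr_full)
    then obtain u where u: "u \<in> Hom C W A" "f \<cdot> u = h"
      using is_kernelD(4)[OF k g(1) hC(1)] HD by auto
    have "v = u" if "v \<in> Hom C W A" "f \<cdot> v = h" for v
      using mono_cancel[OF f(2,1) that(1) u(1)] that u by simp
    then show "\<exists>!u. u \<in> Hom D W (Dom D f) \<and> f \<cdot>\<^bsub>D\<^esub> u = h"
      using u HD N hC(3) by (auto simp: Hom_full_subcat)
  qed (use AD HD gf in auto)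
  moreover have "is_cokernel D f g"
    unfolding is_cokernel_def
  proof (intro conjI allI ballI impI)
    fix Z h assume h: "h \<in> Hom D (Cod D f) Z" and z: "zero_arr D (h \<cdot>\<^bsub>D\<^esub> f)"
    then have hC: "h \<in> Hom C B Z" "zero_arr C (h \<cdot> f)" "Z \<in> N"
      using HD by (auto simp: Hom_full_subcat zero_arr_full)
    then obtain u where u: "u \<in> Hom C E Z" "u \<cdot> g = h"
      using is_cokernelD(4)[OF g(2) f(1) hC(1)] HD by auto
    have "v = u" if "v \<in> Hom C E Z" "v \<cdot> g = h" for v
      using epi_cancel[OF is_cokernelD(3)[OF g(2) f(1)] g(1) that(1) u(1)] that u by simp
    then show "\<exists>!u. u \<in> Hom D (Cod D g) Z \<and> u \<cdot>\<^bsub>D\<^esub> g = h"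
      using u HD N hC(3) by (auto simp: Hom_full_subcat)
  qed (use AD HD gf in auto)
  ultimately show ?thesis by (simp add: short_exact_def)
qed

text \<open>The cokernel \<open>c\<close> of \<open>f\<close> formed in \<open>C\<close> is a
  quotient of \<open>B\<close>, so its target is in \<open>N\<close> and \<open>c\<close> factors
  through \<open>g\<close>. A test arrow with target outside \<open>N\<close> factors first through
  \<open>c\<close> and then through \<open>g\<close>.\<close>

lemma is_cokernel_fullD:
  assumes "is_cokernel D f g"
  obtains A B E where "f \<in> Hom C A B" "g \<in> Hom C B E" "A \<in> N" "B \<in> N" "E \<in> N" "is_cokernel C f g"
proof -
  define A B E where "A = Dom C f" and "B = Cod C f" and "E = Cod C g"
  have f: "f \<in> Hom C A B" and g: "g \<in> Hom C B E" and N: "A \<in> N" "B \<in> N" "E \<in> N"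
    and gf: "zero_arr C (g \<cdot> f)"
    using assms unfolding is_cokernel_def A_def B_def E_def by (auto simp: Hom_def zero_arr_full)
  have univ: "\<exists>!u. u \<in> Hom C E Z \<and> u \<cdot> g = h"
    if "h \<in> Hom C B Z" "zero_arr C (h \<cdot> f)" "Z \<in> N" for h Z
  proof -
    have "h \<in> Hom D (Cod D f) Z" "zero_arr D (h \<cdot>\<^bsub>D\<^esub> f)"
      using that N HomD[OF Comp_in_Hom[OF f that(1)]] by (auto simp: Hom_full_subcat zero_arr_full B_def)
    then have "\<exists>!u. u \<in> Hom D (Cod D g) Z \<and> u \<cdot>\<^bsub>D\<^esub> g = h" using assms unfolding is_cokernel_def by blast
    then show ?thesis using N that by (simp add: Hom_full_subcat E_def)
  qed
  have "epi_arr D g"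
    unfolding epi_arr_def
  proof (intro conjI allI ballI impI)
    show "g \<in> Arr D" using assms by (simp add: is_cokernel_def)
    fix Z h h' assume "h \<in> Hom D (Cod D g) Z" "h' \<in> Hom D (Cod D g) Z" and eq: "h \<cdot>\<^bsub>D\<^esub> g = h' \<cdot>\<^bsub>D\<^esub> g"
    then have h: "h \<in> Hom C E Z" "h' \<in> Hom C E Z" "Z \<in> N" by (auto simp: Hom_full_subcat E_def)
    have "zero_arr C ((h \<cdot> g) \<cdot> f)" using zero_arr_assoc(2)[OF f g h(1) gf] .
    then show "h = h'" using univ[OF Comp_in_Hom[OF g h(1)] _ h(3)] h eq by auto
  qed
  then have g_epi: "epi_arr C g" using epi_arr_full[OF g N(2,3)] by blast
  have "is_cokernel C f g"
  proof (rule is_cokernelI[OF f g g_epi gf])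
    fix Z h assume h: "h \<in> Hom C B Z" "zero_arr C (h \<cdot> f)"
    obtain Q c where c: "c \<in> Hom C B Q" "epi_arr C c" "zero_arr C (c \<cdot> f)"
      "\<And>Z h. h \<in> Hom C B Z \<Longrightarrow> zero_arr C (h \<cdot> f) \<Longrightarrow> \<exists>u \<in> Hom C Q Z. u \<cdot> c = h"
      using cokernelE[OF f] by metis
    obtain u where u: "u \<in> Hom C E Q" "u \<cdot> g = c"
      using univ[OF c(1,3) N_quot[OF c(1,2) N(2)]] by blast
    obtain w where w: "w \<in> Hom C Q Z" "w \<cdot> c = h" using c(4)[OF h] by blast
    show "\<exists>u \<in> Hom C E Z. u \<cdot> g = h"
      using Comp_in_Hom[OF u(1) w(1)] Comp_assoc[OF g u(1) w(1)] u w by auto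
  qed
  then show ?thesis using that f g N by blast
qed

text \<open>The universal property tests only against objects of \<open>N\<close>, while
  \<open>Y\<close> is arbitrary. Replacing \<open>u\<close> by its image brings the target back into
  \<open>N\<close>, since the image is a quotient of \<open>P\<close>.\<close>

lemma coproduct_full_jointly_epi:
  assumes P: "is_coproduct D I F P \<iota>" and u: "u \<in> Hom C P Y" "\<And>i. i \<in> I \<Longrightarrow> zero_arr C (u \<cdot> \<iota> i)"
  shows "zero_arr C u"
proof -
  have PN: "P \<in> N" and \<iota>D: "\<And>i. i \<in> I \<Longrightarrow> \<iota> i \<in> Hom D (F i) P"
    using P by (auto simp: is_coproduct_def)
  then have \<iota>: "\<And>i. i \<in> I \<Longrightarrow> \<iota> i \<in> Hom C (F i) P" and FN: "\<And>i. i \<in> I \<Longrightarrow> F i \<in> N"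
    by (simp_all add: Hom_full_subcat)
  obtain J e m where e: "e \<in> Hom C P J" "epi_arr C e" and m: "m \<in> Hom C J Y" "mono_arr C m" "m \<cdot> e = u"
    using imageE[OF u(1)] by metis
  have JN: "J \<in> N" using N_quot[OF e PN] .
  have ez: "zero_arr C (e \<cdot> \<iota> i)" if i: "i \<in> I" for i
    using mono_zero_cancel[OF m(2,1) Comp_in_Hom[OF \<iota>[OF i] e(1)]] Comp_assoc[OF \<iota>[OF i] e(1) m(1)] m u(2)[OF i]
    by simp
  obtain z where z: "z \<in> Hom C P J" "zero_arr C z" using zero_arr_exists HomD[OF e(1)] by metis
  have eq: "z \<cdot> \<iota> i = e \<cdot> \<iota> i" if i: "i \<in> I" for i
    by (rule zero_arr_unique[OF zero_arr_comp_right[OF z(2,1) \<iota>[OF i]] ez[OF i]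
        Comp_in_Hom[OF \<iota>[OF i] z(1)] Comp_in_Hom[OF \<iota>[OF i] e(1)]])
  have "\<forall>i \<in> I. e \<cdot> \<iota> i \<in> Hom D (F i) J"
    using Comp_in_Hom[OF \<iota> e(1)] FN JN by (simp add: Hom_full_subcat)
  then have "\<exists>!v. v \<in> Hom D P J \<and> (\<forall>i \<in> I. v \<cdot>\<^bsub>D\<^esub> \<iota> i = e \<cdot> \<iota> i)"
    by (intro is_coproductD[OF P]) (simp_all add: JN)
  then have "\<exists>!v. v \<in> Hom C P J \<and> (\<forall>i \<in> I. v \<cdot> \<iota> i = e \<cdot> \<iota> i)"
    by (simp add: Hom_full_subcat_eq[OF PN JN])
  then have "e = z" using e(1) z(1) eq by blast
  then show ?thesis using zero_arr_comp_left[OF z(2,1) m(1)] m by simp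
qed

lemma serre_within_of_serre_subcategory:
  assumes "serre_subcategory D \<X>"
  shows "serre_within C N \<X>"
proof -
  note serre = assms[unfolded serre_subcategory_def]
  have sN: "\<X> \<subseteq> N" using serre by simp
  have zero: "\<forall>Z. zero_obj D Z \<longrightarrow> Z \<in> \<X>"
    using serre by (elim conjE)
  have sub: "\<forall>f. mono_arr D f \<and> Cod D f \<in> \<X> \<longrightarrow> Dom D f \<in> \<X>"
    using serre by (elim conjE)
  have quot: "\<forall>f. epi_arr D f \<and> Dom D f \<in> \<X> \<longrightarrow> Cod D f \<in> \<X>"
    using serre by (elim conjE)
  have ext: "\<forall>f g. short_exact D f g \<and> Dom D f \<in> \<X> \<and> Cod D g \<in> \<X> \<longrightarrow> Cod D f \<in> \<X>"
    using serre by (elim conjE)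
  have "K \<in> \<X>" if k: "k \<in> Hom C K Y" "mono_arr C k" and Y: "Y \<in> \<X>" for k K Y
  proof -
    have "Y \<in> N" using sN Y by blast
    then have "mono_arr D k" using mono_arr_full[OF k(1)] N_sub[OF k] k(2) by blast
    then show ?thesis using sub[rule_format, of k] Y HomD(2,3)[OF k(1)] by simp
  qed
  moreover have "Q \<in> \<X>" if e: "e \<in> Hom C Y Q" "epi_arr C e" and Y: "Y \<in> \<X>" for e Q Y
  proof -
    have "Y \<in> N" using sN Y by blast
    then have "epi_arr D e" using epi_arr_full[OF e(1)] N_quot[OF e] e(2) by blast
    then show ?thesis using quot[rule_format, of e] Y HomD(2,3)[OF e(1)] by simp
  qed
  moreover have "B \<in> \<X>" if f: "f \<in> Hom C A B" "mono_arr C f" and g: "g \<in> Hom C B E" "is_cokernel C f g"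
    and X: "A \<in> \<X>" "E \<in> \<X>" "B \<in> N" for f g A B E
  proof -
    have "short_exact D f g" using short_exact_fullI[OF f g] sN X by blast
    then have "Cod D f \<in> \<X>" using ext[rule_format, of f g] X HomD(2)[OF f(1)] HomD(3)[OF g(1)] by simp
    then show ?thesis using HomD(3)[OF f(1)] by simp
  qed
  moreover have "Z \<in> \<X>" if "zero_obj C Z" for Z using zero that zero_obj_full by blast
  ultimately show ?thesis using sN unfolding serre_within_def by blast
qed

text \<open>Each closure condition is an inequality of supports: they shrink on subquotients, and
  for extensions and jointly epimorphic families they are bounded by a union.\<close>

lemma serre_subcategory_of_Supp:
  "serre_subcategory D {M \<in> N. Supp C M \<subseteq> T}"
  unfolding serre_subcategory_def
proof (intro conjI allI impI)
  show "{M \<in> N. Supp C M \<subseteq> T} \<subseteq> Obj D" by auto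
  fix X Y assume *: "X \<in> {M \<in> N. Supp C M \<subseteq> T} \<and> iso_obj D X Y"
  then obtain f where f: "f \<in> Hom D X Y" "iso_arr D f" by (auto simp: iso_obj_def)
  then have YN: "Y \<in> N" and fC: "f \<in> Hom C X Y" by (simp_all add: Hom_full_subcat)
  have "iso_arr C f"
    using f(2) HomD(1-3)[OF fC] by (auto simp: iso_arr_def Hom_full_subcat)
  then have "iso_obj C X Y" using fC by (auto simp: iso_obj_def)
  then show "Y \<in> {M \<in> N. Supp C M \<subseteq> T}" using * YN Supp_iso by auto
next
  fix Z assume "zero_obj D Z"
  then show "Z \<in> {M \<in> N. Supp C M \<subseteq> T}" using zero_obj_full N_zero Supp_zero_obj by auto
next
  fix I :: "nat set" and F P \<iota>
  assume *: "finite I \<and> (\<forall>i \<in> I. F i \<in> {M \<in> N. Supp C M \<subseteq> T}) \<and> is_coproduct D I F P \<iota>"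
  then have PN: "P \<in> N" and \<iota>: "\<And>i. i \<in> I \<Longrightarrow> \<iota> i \<in> Hom C (F i) P"
    by (auto simp: is_coproduct_def Hom_full_subcat)
  have "Supp C P \<subseteq> (\<Union>i \<in> I. Supp C (F i))"
    using Supp_jointly_epi_finite[of I \<iota> F P] * \<iota> PN N_Obj coproduct_full_jointly_epi[of I F P \<iota>] by blast
  then show "P \<in> {M \<in> N. Supp C M \<subseteq> T}" using * PN by auto
next
  fix f assume *: "mono_arr D f \<and> Cod D f \<in> {M \<in> N. Supp C M \<subseteq> T}"
  then have f: "f \<in> Hom C (Dom C f) (Cod C f)" and N: "Dom C f \<in> N" "Cod C f \<in> N"
    by (auto simp: mono_arr_def Hom_def)
  then have "mono_arr C f" using * mono_arr_full by blast
  then have "Supp C (Dom C f) \<subseteq> Supp C (Cod C f)" using Supp_subquotient[OF subquotient_mono[OF f]] by blast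
  then show "Dom D f \<in> {M \<in> N. Supp C M \<subseteq> T}" using * N by auto
next
  fix f assume *: "epi_arr D f \<and> Dom D f \<in> {M \<in> N. Supp C M \<subseteq> T}"
  then have f: "f \<in> Hom C (Dom C f) (Cod C f)" and N: "Dom C f \<in> N" "Cod C f \<in> N"
    by (auto simp: epi_arr_def Hom_def)
  then have "epi_arr C f" using * epi_arr_full by blast
  then have "Supp C (Cod C f) \<subseteq> Supp C (Dom C f)" using Supp_subquotient[OF subquotient_epi[OF f]] by blast
  then show "Cod D f \<in> {M \<in> N. Supp C M \<subseteq> T}" using * N by auto
next
  fix f g assume *: "short_exact D f g \<and> Dom D f \<in> {M \<in> N. Supp C M \<subseteq> T} \<and> Cod D g \<in> {M \<in> N. Supp C M \<subseteq> T}"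
  then obtain A B E where f: "f \<in> Hom C A B" and g: "g \<in> Hom C B E" "is_cokernel C f g" and B: "B \<in> N"
    using is_cokernel_fullD unfolding short_exact_def by metis
  have "Supp C B \<subseteq> Supp C A \<union> Supp C E" using Supp_extension[OF f g] .
  then show "Cod D f \<in> {M \<in> N. Supp C M \<subseteq> T}" using * B HomD[OF f] HomD[OF g(1)] by auto
qed

end

lemma (in abelian_category) subquotient_closed_Obj: "subquotient_closed C (Obj C)"
  by unfold_locales (use HomD in \<open>auto simp: zero_obj_def\<close>)

lemma (in abelian_category) noetherian_zero_obj:
  assumes "zero_obj C Z"
  shows "noetherian C Z"
proof (rule noetherianI)
  show "Z \<in> Obj C" using assms by (simp add: zero_obj_def)
  fix m K assume m: "\<And>i :: nat. m i \<in> Hom C (K i) Z" "\<And>i. mono_arr C (m i)"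
  have "sub_le C (m i) (m j)" for i j
  proof -
    obtain z where z: "z \<in> Hom C (K i) (K j)" using zero_arr_exists HomD(4)[OF m(1)] by metis
    then have "m j \<cdot> z = m i" using zero_obj_Hom_unique(1)[OF assms Comp_in_Hom[OF z m(1)] m(1)] by blast
    then show ?thesis using z sub_le_iff[OF m(1) m(1)] by blast
  qed
  then show "\<exists>N. \<forall>i \<ge> N. sub_le C (m i) (m N)" by blast
qed

lemma (in abelian_category) subquotient_closed_noetherian: "subquotient_closed C {M. noetherian C M}"
proof unfold_locales
  show "{M. noetherian C M} \<subseteq> Obj C" using noetherian_Obj by blast
  show "Z \<in> {M. noetherian C M}" if "zero_obj C Z" for Z using noetherian_zero_obj[OF that] by simp
  show "K \<in> {M. noetherian C M}" if "k \<in> Hom C K X" "mono_arr C k" "X \<in> {M. noetherian C M}" for k K X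
    using noetherian_subobject[OF _ that(1,2)] that(3) by simp
  show "Q \<in> {M. noetherian C M}" if "e \<in> Hom C X Q" "epi_arr C e" "X \<in> {M. noetherian C M}" for e X Q
    using noetherian_quotient[OF _ that(1,2)] that(3) by simp
qed

section \<open>Autoequivalences\<close>

text \<open>Autoequivalence with its inverse named, in a form symmetric in both functors, so that
  every fact about \<open>F\<close> can be reused for \<open>F'\<close>.\<close>

definition quasi_inverse :: "('o, 'a) cat \<Rightarrow> ('o, 'a) endo \<Rightarrow> ('o, 'a) endo \<Rightarrow> bool" where
  "quasi_inverse C F F' \<longleftrightarrow> endofunctor C F \<and> endofunctor C F' \<and>
    nat_iso C (comp_endo F' F) id_endo \<and> nat_iso C (comp_endo F F') id_endo"

lemma quasi_inverse_sym: "quasi_inverse C F F' \<Longrightarrow> quasi_inverse C F' F"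
  by (auto simp: quasi_inverse_def)

lemma autoequivalence_iff: "autoequivalence C F \<longleftrightarrow> (\<exists>F'. quasi_inverse C F F')"
  by (auto simp: autoequivalence_def quasi_inverse_def)

lemma endofunctorD:
  assumes "endofunctor C F"
  shows "X \<in> Obj C \<Longrightarrow> on_obj F X \<in> Obj C"
    and "f \<in> Hom C X Y \<Longrightarrow> on_arr F f \<in> Hom C (on_obj F X) (on_obj F Y)"
    and "X \<in> Obj C \<Longrightarrow> on_arr F (Ident C X) = Ident C (on_obj F X)"
    and "f \<in> Hom C X Y \<Longrightarrow> g \<in> Hom C Y Z \<Longrightarrow> on_arr F (g \<cdot>\<^bsub>C\<^esub> f) = on_arr F g \<cdot>\<^bsub>C\<^esub> on_arr F f"
  using assms unfolding endofunctor_def by blast+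

lemma nat_iso_obj: "nat_iso C F F' \<Longrightarrow> X \<in> Obj C \<Longrightarrow> iso_obj C (on_obj F X) (on_obj F' X)"
  unfolding nat_iso_def iso_obj_def by blast

lemma (in category) nat_iso_refl:
  assumes "endofunctor C F"
  shows "nat_iso C F F"
  unfolding nat_iso_def
proof (intro exI[of _ "\<lambda>X. Ident C (on_obj F X)"] conjI ballI allI)
  note FD = endofunctorD[OF assms]
  fix X assume "X \<in> Obj C"
  then have I: "Ident C (on_obj F X) \<in> Hom C (on_obj F X) (on_obj F X)" using FD(1) Ident_in_Hom by blast
  then show "Ident C (on_obj F X) \<in> Hom C (on_obj F X) (on_obj F X)" .
  show "iso_arr C (Ident C (on_obj F X))" using iso_arr_iff[OF I] I Comp_Ident[OF I] by blast
next
  fix X Y f assume "f \<in> Hom C X Y"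
  then have f: "on_arr F f \<in> Hom C (on_obj F X) (on_obj F Y)" using endofunctorD(2)[OF assms] by blast
  show "Ident C (on_obj F Y) \<cdot> on_arr F f = on_arr F f \<cdot> Ident C (on_obj F X)"
    using Comp_Ident[OF f] Ident_Comp[OF f] by simp
qed

lemma (in category) iso_obj_endofunctor:
  assumes F: "endofunctor C F" and XY: "iso_obj C X Y"
  shows "iso_obj C (on_obj F X) (on_obj F Y)"
proof -
  note FD = endofunctorD[OF F]
  obtain f g where f: "f \<in> Hom C X Y" and g: "g \<in> Hom C Y X" "g \<cdot> f = Ident C X" "f \<cdot> g = Ident C Y"
    using XY iso_arr_iff unfolding iso_obj_def by blast
  have "on_arr F g \<cdot> on_arr F f = Ident C (on_obj F X)" "on_arr F f \<cdot> on_arr F g = Ident C (on_obj F Y)"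
    using FD(4)[OF f g(1)] FD(4)[OF g(1) f] FD(3) g HomD[OF f] by auto
  then show ?thesis
    using FD(2)[OF f] FD(2)[OF g(1)] iso_arr_iff[OF FD(2)[OF f]] unfolding iso_obj_def by blast
qed

context abelian_category
begin

lemma zero_obj_iso: "zero_obj C X \<Longrightarrow> iso_obj C X Y \<Longrightarrow> zero_obj C Y"
proof -
  assume X: "zero_obj C X" "iso_obj C X Y"
  obtain f where "f \<in> Hom C Y X" "mono_arr C f" using iso_objE[OF iso_obj_sym[OF X(2)]] by metis
  then show "zero_obj C Y" using nonzero_obj_mono(2) X(1) HomD unfolding nonzero_obj_def by metis
qed

lemma monoform_iso: "monoform C X \<Longrightarrow> iso_obj C X Y \<Longrightarrow> monoform C Y"
  using iso_objE[OF iso_obj_sym] monoform_subobject zero_obj_iso iso_obj_sym monoform_nonzero HomD(4)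
  unfolding nonzero_obj_def by metis

lemma atom_iso:
  assumes "monoform C X" "iso_obj C X Y"
  shows "atom C X = atom C Y"
proof -
  obtain f where f: "f \<in> Hom C Y X" "mono_arr C f" using iso_objE[OF iso_obj_sym[OF assms(2)]] by metis
  show ?thesis
    using atom_subobject[OF assms(1) f] monoform_nonzero[OF monoform_iso[OF assms]] by simp
qed

context
  fixes F F'
  assumes FF': "quasi_inverse C F F'"
begin

lemma quasi_inverse_endofunctor: "endofunctor C F" "endofunctor C F'"
  using FF' by (auto simp: quasi_inverse_def)

lemmas functorD = endofunctorD[OF quasi_inverse_endofunctor(1)] endofunctorD[OF quasi_inverse_endofunctor(2)]

lemma quasi_inverse_unit:
  obtains \<eta> where "\<And>X. X \<in> Obj C \<Longrightarrow> \<eta> X \<in> Hom C (on_obj F' (on_obj F X)) X"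
    "\<And>X. X \<in> Obj C \<Longrightarrow> iso_arr C (\<eta> X)"
    "\<And>X Y f. f \<in> Hom C X Y \<Longrightarrow> \<eta> Y \<cdot> on_arr F' (on_arr F f) = f \<cdot> \<eta> X"
proof -
  have "nat_iso C (comp_endo F' F) id_endo" using FF' by (simp add: quasi_inverse_def)
  then obtain \<eta> where "\<forall>X \<in> Obj C. \<eta> X \<in> Hom C (on_obj F' (on_obj F X)) X \<and> iso_arr C (\<eta> X)"
    "\<forall>X Y. \<forall>f \<in> Hom C X Y. \<eta> Y \<cdot> on_arr F' (on_arr F f) = f \<cdot> \<eta> X"
    by (auto simp: nat_iso_def comp_endo_def id_endo_def)
  then show ?thesis using that by blast
qed

lemma quasi_inverse_iso_obj: "X \<in> Obj C \<Longrightarrow> iso_obj C (on_obj F' (on_obj F X)) X"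
  using quasi_inverse_unit unfolding iso_obj_def by metis

text \<open>By naturality \<open>f \<cdot> \<eta> X\<close> is determined by
  \<open>on_arr F f\<close>, and the isomorphism \<open>\<eta> X\<close> can be cancelled.\<close>

lemma quasi_inverse_faithful:
  assumes f: "f \<in> Hom C X Y" and g: "g \<in> Hom C X Y" and eq: "on_arr F f = on_arr F g"
  shows "f = g"
proof -
  obtain \<eta> where \<eta>: "\<And>X. X \<in> Obj C \<Longrightarrow> \<eta> X \<in> Hom C (on_obj F' (on_obj F X)) X"
    "\<And>X. X \<in> Obj C \<Longrightarrow> iso_arr C (\<eta> X)"
    "\<And>X Y f. f \<in> Hom C X Y \<Longrightarrow> \<eta> Y \<cdot> on_arr F' (on_arr F f) = f \<cdot> \<eta> X"
    by (fact quasi_inverse_unit)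
  have X: "X \<in> Obj C" using HomD f by blast
  have "f \<cdot> \<eta> X = g \<cdot> \<eta> X" using \<eta>(3)[OF f] \<eta>(3)[OF g] eq by simp
  then show ?thesis using epi_cancel[OF iso_imp_epi[OF \<eta>(2)[OF X] \<eta>(1)[OF X]] \<eta>(1)[OF X] f g] by blast
qed

lemma functor_reflects_mono:
  assumes f: "f \<in> Hom C X Y" and m: "mono_arr C (on_arr F f)"
  shows "mono_arr C f"
  unfolding mono_arr_iff[OF f]
proof (intro allI ballI impI)
  fix W g h assume g: "g \<in> Hom C W X" and h: "h \<in> Hom C W X" and "f \<cdot> g = f \<cdot> h"
  then have "on_arr F f \<cdot> on_arr F g = on_arr F f \<cdot> on_arr F h"
    using functorD(4)[OF g f] functorD(4)[OF h f] by simp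
  then have "on_arr F g = on_arr F h"
    using mono_cancel[OF m functorD(2)[OF f] functorD(2)[OF g] functorD(2)[OF h]] by blast
  then show "g = h" using quasi_inverse_faithful[OF g h] by blast
qed

lemma functor_reflects_epi:
  assumes f: "f \<in> Hom C X Y" and m: "epi_arr C (on_arr F f)"
  shows "epi_arr C f"
  unfolding epi_arr_iff[OF f]
proof (intro allI ballI impI)
  fix W g h assume g: "g \<in> Hom C Y W" and h: "h \<in> Hom C Y W" and "g \<cdot> f = h \<cdot> f"
  then have "on_arr F g \<cdot> on_arr F f = on_arr F h \<cdot> on_arr F f"
    using functorD(4)[OF f g] functorD(4)[OF f h] by simp
  then have "on_arr F g = on_arr F h"
    using epi_cancel[OF m functorD(2)[OF f] functorD(2)[OF g] functorD(2)[OF h]] by blast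
  then show "g = h" using quasi_inverse_faithful[OF g h] by blast
qed

lemma functor_reflects_zero_obj:
  assumes X: "X \<in> Obj C" and z: "zero_obj C (on_obj F X)"
  shows "zero_obj C X"
proof -
  note I = Ident_in_Hom[OF X]
  obtain u where u: "u \<in> Hom C X X" "zero_arr C u" using zero_arr_exists[OF X X] .
  have "on_arr F (Ident C X) = on_arr F u"
    using zero_obj_Hom_unique(1)[OF z functorD(2)[OF I] functorD(2)[OF u(1)]] .
  then show ?thesis using quasi_inverse_faithful[OF I u(1)] u zero_obj_iff_Ident[OF X] by simp
qed

lemma composite_mono_epi:
  assumes f: "f \<in> Hom C X Y"
  shows "mono_arr C f \<Longrightarrow> mono_arr C (on_arr F' (on_arr F f))"
    and "epi_arr C f \<Longrightarrow> epi_arr C (on_arr F' (on_arr F f))"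
proof -
  obtain \<eta> where \<eta>: "\<And>X. X \<in> Obj C \<Longrightarrow> \<eta> X \<in> Hom C (on_obj F' (on_obj F X)) X"
    "\<And>X. X \<in> Obj C \<Longrightarrow> iso_arr C (\<eta> X)"
    "\<And>X Y f. f \<in> Hom C X Y \<Longrightarrow> \<eta> Y \<cdot> on_arr F' (on_arr F f) = f \<cdot> \<eta> X"
    by (fact quasi_inverse_unit)
  have XY: "X \<in> Obj C" "Y \<in> Obj C" using HomD[OF f] by auto
  note \<eta>X = \<eta>(1)[OF XY(1)] and \<eta>Y = \<eta>(1)[OF XY(2)] and g = functorD(6)[OF functorD(2)[OF f]]
  show "mono_arr C (on_arr F' (on_arr F f))" if "mono_arr C f"
    using mono_of_comp[OF _ g \<eta>Y] \<eta>(3)[OF f] mono_comp[OF iso_imp_mono[OF \<eta>(2)[OF XY(1)] \<eta>X] that \<eta>X f]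
    by simp
  obtain \<theta> where \<theta>: "\<theta> \<in> Hom C Y (on_obj F' (on_obj F Y))" "\<theta> \<cdot> \<eta> Y = Ident C (on_obj F' (on_obj F Y))"
    "\<eta> Y \<cdot> \<theta> = Ident C Y"
    using \<eta>(2)[OF XY(2)] iso_arr_iff[OF \<eta>Y] by blast
  have "on_arr F' (on_arr F f) = \<theta> \<cdot> (f \<cdot> \<eta> X)"
    using Comp_assoc[OF g \<eta>Y \<theta>(1)] \<eta>(3)[OF f] \<theta>(2) Ident_Comp[OF g] by simp
  moreover have "epi_arr C \<theta>" using iso_imp_epi[OF _ \<theta>(1)] iso_arr_iff[OF \<theta>(1)] \<theta> \<eta>Y by blast
  ultimately show "epi_arr C (on_arr F' (on_arr F f))" if "epi_arr C f"
    using epi_comp[OF epi_comp[OF iso_imp_epi[OF \<eta>(2)[OF XY(1)] \<eta>X] that \<eta>X f] _ Comp_in_Hom[OF \<eta>X f] \<theta>(1)]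
    by simp
qed

end

context
  fixes F F'
  assumes FF': "quasi_inverse C F F'"
begin

lemmas FD = functorD[OF FF']
lemmas F'F = quasi_inverse_sym[OF FF']

text \<open>Preservation comes from reflection by the inverse: \<open>F'\<close> is faithful and so
  reflects monomorphisms, and applying \<open>F'\<close> after \<open>F\<close> gives a conjugate of
  \<open>f\<close>, which is mono.\<close>

lemma functor_mono:
  assumes "f \<in> Hom C X Y" "mono_arr C f"
  shows "mono_arr C (on_arr F f)"
  using functor_reflects_mono[OF F'F FD(2)[OF assms(1)]] composite_mono_epi(1)[OF FF' assms] by blast

lemma functor_epi:
  assumes "f \<in> Hom C X Y" "epi_arr C f"
  shows "epi_arr C (on_arr F f)"
  using functor_reflects_epi[OF F'F FD(2)[OF assms(1)]] composite_mono_epi(2)[OF FF' assms] by blast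

lemma functor_zero_obj:
  assumes "zero_obj C X"
  shows "zero_obj C (on_obj F X)"
proof -
  have X: "X \<in> Obj C" using assms by (simp add: zero_obj_def)
  show ?thesis
    using functor_reflects_zero_obj[OF F'F FD(1)[OF X]]
      zero_obj_iso[OF assms iso_obj_sym[OF quasi_inverse_iso_obj[OF FF' X]]] by blast
qed

lemma functor_nonzero_obj: "nonzero_obj C X \<Longrightarrow> nonzero_obj C (on_obj F X)"
  using functor_reflects_zero_obj[OF FF'] FD(1) by (auto simp: nonzero_obj_def)

lemma functor_zero_arr:
  assumes f: "f \<in> Hom C X Y" and z: "zero_arr C f"
  shows "zero_arr C (on_arr F f)"
proof -
  obtain Z g h where Z: "zero_obj C Z" "g \<in> Hom C X Z" "h \<in> Hom C Z Y" "f = h \<cdot> g"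
    using z HomD[OF f] unfolding zero_arr_def by blast
  have "zero_arr C (on_arr F g)" using zero_arr_zero_obj'[OF functor_zero_obj[OF Z(1)] FD(2)[OF Z(2)]] .
  then show ?thesis
    using zero_arr_comp_left[OF _ FD(2)[OF Z(2)] FD(2)[OF Z(3)]] FD(4)[OF Z(2,3)] Z(4) by simp
qed

lemma functor_reflects_zero_arr:
  assumes f: "f \<in> Hom C X Y" and z: "zero_arr C (on_arr F f)"
  shows "zero_arr C f"
proof -
  obtain u where u: "u \<in> Hom C X Y" "zero_arr C u" using zero_arr_exists HomD[OF f] by metis
  have "on_arr F f = on_arr F u"
    using zero_arr_unique[OF z functor_zero_arr[OF u] FD(2)[OF f] FD(2)[OF u(1)]] .
  then show ?thesis using quasi_inverse_faithful[OF FF' f u(1)] u by simp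
qed

lemma functor_common_subobject:
  assumes "common_subobject C X Y"
  shows "common_subobject C (on_obj F X) (on_obj F Y)"
proof -
  obtain K f g where "nonzero_obj C K" "f \<in> Hom C K X" "mono_arr C f" "g \<in> Hom C K Y" "mono_arr C g"
    using assms unfolding common_subobject_def by blast
  then show ?thesis
    unfolding common_subobject_def using functor_nonzero_obj FD(2) functor_mono by blast
qed

lemma functor_subquotient:
  assumes "subquotient C M H"
  shows "subquotient C (on_obj F M) (on_obj F H)"
proof -
  obtain L m e where m: "m \<in> Hom C L M" "mono_arr C m" and e: "e \<in> Hom C L H" "epi_arr C e"
    using assms by (rule subquotientE)
  show ?thesis
    by (rule subquotientI[OF FD(2)[OF m(1)] functor_mono[OF m] FD(2)[OF e(1)] functor_epi[OF e]])
qed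

end

text \<open>The arrow criterion is moved by \<open>F'\<close> to an object isomorphic to
  \<open>H\<close>, where it holds; \<open>F'\<close> reflects zero arrows and
  monomorphisms.\<close>

lemma functor_monoform:
  assumes FF': "quasi_inverse C F F'" and H: "monoform C H"
  shows "monoform C (on_obj F H)"
  unfolding monoform_iff
proof (intro conjI allI impI)
  show "nonzero_obj C (on_obj F H)" using functor_nonzero_obj[OF FF'] monoform_nonzero[OF H] by blast
  note F'F = quasi_inverse_sym[OF FF'] and GD = functorD[OF quasi_inverse_sym[OF FF']]
  have HO: "H \<in> Obj C" using monoform_nonzero[OF H] by (simp add: nonzero_obj_def)
  have H': "monoform C (on_obj F' (on_obj F H))"
    using monoform_iso[OF H iso_obj_sym[OF quasi_inverse_iso_obj[OF FF' HO]]] .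
  fix K k f assume "k \<in> Hom C K (on_obj F H) \<and> mono_arr C k \<and> f \<in> Hom C K (on_obj F H)"
  then have k: "k \<in> Hom C K (on_obj F H)" "mono_arr C k" and f: "f \<in> Hom C K (on_obj F H)" by auto
  have "zero_arr C (on_arr F' f) \<or> mono_arr C (on_arr F' f)"
    using H' GD(2)[OF k(1)] functor_mono[OF F'F k] GD(2)[OF f] unfolding monoform_iff by blast
  then show "zero_arr C f \<or> mono_arr C f"
    using functor_reflects_zero_arr[OF F'F f] functor_reflects_mono[OF F'F f] by blast
qed

text \<open>\<open>F'\<close> carries a chain in \<open>on_obj F M\<close> to a chain in an object
  isomorphic to \<open>M\<close>. Inclusions come back because they are vanishing conditions on
  cokernels and \<open>F'\<close> reflects zero arrows, so \<open>u\<close> itself never has to be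
  lifted along \<open>F'\<close>.\<close>

lemma functor_noetherian:
  assumes FF': "quasi_inverse C F F'" and M: "noetherian C M"
  shows "noetherian C (on_obj F M)"
proof (rule noetherianI)
  note F'F = quasi_inverse_sym[OF FF'] and GD = functorD[OF quasi_inverse_sym[OF FF']]
  have MO: "M \<in> Obj C" using noetherian_Obj[OF M] .
  then show "on_obj F M \<in> Obj C" using functorD(1)[OF FF'] by blast
  obtain e where e: "e \<in> Hom C M (on_obj F' (on_obj F M))" "epi_arr C e"
    using iso_objE[OF iso_obj_sym[OF quasi_inverse_iso_obj[OF FF' MO]]] by metis
  have noeth: "noetherian C (on_obj F' (on_obj F M))" using noetherian_quotient[OF M e] .
  fix m K assume m: "\<And>i :: nat. m i \<in> Hom C (K i) (on_obj F M)" "\<And>i. mono_arr C (m i)"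
    "\<And>i. sub_le C (m i) (m (Suc i))"
  have Gm: "on_arr F' (m i) \<in> Hom C (on_obj F' (K i)) (on_obj F' (on_obj F M))" "mono_arr C (on_arr F' (m i))" for i
    using GD(2)[OF m(1)] functor_mono[OF F'F m(1,2)] by auto
  have le1: "sub_le C (on_arr F' (m i)) (on_arr F' (m j))" if le: "sub_le C (m i) (m j)" for i j
  proof -
    obtain u where u: "u \<in> Hom C (K i) (K j)" "m j \<cdot> u = m i"
      using le sub_le_iff[OF m(1) m(1)] by blast
    then have "on_arr F' (m j) \<cdot> on_arr F' u = on_arr F' (m i)" using GD(4)[OF u(1) m(1)] by simp
    then show ?thesis using sub_le_iff[OF Gm(1) Gm(1)] GD(2)[OF u(1)] by blast
  qed
  have le2: "sub_le C (m i) (m j)" if le: "sub_le C (on_arr F' (m i)) (on_arr F' (m j))" for i j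
  proof -
    obtain u where u: "u \<in> Hom C (on_obj F' (K i)) (on_obj F' (K j))" "on_arr F' (m j) \<cdot> u = on_arr F' (m i)"
      using le sub_le_iff[OF Gm(1) Gm(1)] by blast
    obtain Q c where c: "c \<in> Hom C (on_obj F M) Q" "zero_arr C (c \<cdot> m j)" "is_cokernel C (m j) c"
      using cokernelE[OF m(1)] by metis
    have "zero_arr C (on_arr F' c \<cdot> on_arr F' (m j))"
      using functor_zero_arr[OF F'F Comp_in_Hom[OF m(1) c(1)] c(2)] GD(4)[OF m(1) c(1)] by simp
    then have "zero_arr C (on_arr F' c \<cdot> on_arr F' (m i))"
      using zero_arr_assoc(1)[OF u(1) Gm(1) GD(2)[OF c(1)]] u(2) by simp
    then have "zero_arr C (c \<cdot> m i)"
      using functor_reflects_zero_arr[OF F'F Comp_in_Hom[OF m(1) c(1)]] GD(4)[OF m(1) c(1)] by simp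
    then show ?thesis using sub_le_iff_zero[OF m(1) m(1) m(2) c(3)] by blast
  qed
  obtain N where "\<And>i. i \<ge> N \<Longrightarrow> sub_le C (on_arr F' (m i)) (on_arr F' (m N))"
    using noetherian_stable[of "on_obj F' (on_obj F M)" "\<lambda>i. on_arr F' (m i)" "\<lambda>i. on_obj F' (K i)"]
      noeth Gm le1 m(3) by blast
  then show "\<exists>N. \<forall>i \<ge> N. sub_le C (m i) (m N)" using le2 by blast
qed

end

section \<open>Group actions and orbits of atoms\<close>

locale category_with_action = abelian_category C + group G
  for C :: "('o, 'a) cat" (structure) and G :: "('g, 'm) monoid_scheme" +
  fixes \<rho> :: "'g \<Rightarrow> ('o, 'a) endo set"
  assumes action: "category_action G C \<rho>"
begin

lemma action_class:
  assumes "g \<in> carrier G"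
  obtains F where "autoequivalence C F" "\<rho> g = autoeq_rel C `` {F}"
proof -
  have "\<rho> g \<in> {F. autoequivalence C F} // autoeq_rel C"
    using action assms unfolding category_action_def hom_def autoeq_group_def by auto
  then show ?thesis using that by (auto elim: quotientE)
qed

lemma action_representative: "g \<in> carrier G \<Longrightarrow> (SOME F. F \<in> \<rho> g) \<in> \<rho> g"
proof -
  assume "g \<in> carrier G"
  then obtain F where F: "autoequivalence C F" "\<rho> g = autoeq_rel C `` {F}" by (rule action_class)
  then have "F \<in> \<rho> g" using nat_iso_refl by (auto simp: autoeq_rel_def autoequivalence_def)
  then show ?thesis by (rule someI)
qed

text \<open>The representative selected in \<open>act\<close> is naturally isomorphic to every
  member of its class, so statements up to isomorphism may be checked on any member.\<close>

lemma action_member: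
  assumes g: "g \<in> carrier G" and F: "F \<in> \<rho> g"
  shows "autoequivalence C F" "X \<in> Obj C \<Longrightarrow> iso_obj C (on_obj F X) (act \<rho> g X)"
proof -
  obtain E where E: "\<rho> g = autoeq_rel C `` {E}" using action_class[OF g] by metis
  then have EF: "nat_iso C E F" and EA: "nat_iso C E (SOME F. F \<in> \<rho> g)"
    using F action_representative[OF g] by (auto simp: autoeq_rel_def)
  show "autoequivalence C F" using F E by (auto simp: autoeq_rel_def)
  show "iso_obj C (on_obj F X) (act \<rho> g X)" if "X \<in> Obj C"
    using iso_obj_trans[OF iso_obj_sym[OF nat_iso_obj[OF EF that]] nat_iso_obj[OF EA that]]
    by (simp add: act_def)
qed

lemma act_functor:
  assumes "g \<in> carrier G"
  obtains F F' where "quasi_inverse C F F'" "\<And>X. act \<rho> g X = on_obj F X"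
  using action_member(1)[OF assms action_representative[OF assms]] autoequivalence_iff that
  by (metis act_def)

lemma act_Obj: "g \<in> carrier G \<Longrightarrow> X \<in> Obj C \<Longrightarrow> act \<rho> g X \<in> Obj C"
  using act_functor functorD(1) by metis

lemma act_iso_obj:
  assumes g: "g \<in> carrier G" and XY: "iso_obj C X Y"
  shows "iso_obj C (act \<rho> g X) (act \<rho> g Y)"
proof -
  obtain F F' where F: "quasi_inverse C F F'" "\<And>X. act \<rho> g X = on_obj F X" using act_functor[OF g] by metis
  show ?thesis using iso_obj_endofunctor[OF quasi_inverse_endofunctor(1)[OF F(1)] XY] F(2) by simp
qed

lemma act_reflects_iso_obj:
  assumes g: "g \<in> carrier G" and X: "X \<in> Obj C" "Y \<in> Obj C" and XY: "iso_obj C (act \<rho> g X) (act \<rho> g Y)"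
  shows "iso_obj C X Y"
proof -
  obtain F F' where F: "quasi_inverse C F F'" "\<And>X. act \<rho> g X = on_obj F X" using act_functor[OF g] by metis
  have "iso_obj C (on_obj F' (on_obj F X)) (on_obj F' (on_obj F Y))"
    using iso_obj_endofunctor[OF quasi_inverse_endofunctor(2)[OF F(1)]] XY F(2) by simp
  then show ?thesis
    using iso_obj_trans iso_obj_sym quasi_inverse_iso_obj[OF F(1) X(1)] quasi_inverse_iso_obj[OF F(1) X(2)]
    by blast
qed

lemma act_monoform: "g \<in> carrier G \<Longrightarrow> monoform C H \<Longrightarrow> monoform C (act \<rho> g H)"
  using act_functor functor_monoform by metis

lemma act_noetherian: "g \<in> carrier G \<Longrightarrow> noetherian C M \<Longrightarrow> noetherian C (act \<rho> g M)"
  using act_functor functor_noetherian by metis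

lemma act_subquotient: "g \<in> carrier G \<Longrightarrow> subquotient C M H \<Longrightarrow> subquotient C (act \<rho> g M) (act \<rho> g H)"
  using act_functor functor_subquotient by metis

lemma act_common_subobject:
  "g \<in> carrier G \<Longrightarrow> common_subobject C X Y \<Longrightarrow> common_subobject C (act \<rho> g X) (act \<rho> g Y)"
  using act_functor functor_common_subobject by metis

text \<open>The class of a product consists of functors naturally isomorphic to composites of
  members of the two classes. The selected representative is one of them, and replacing the factors
  by their own representatives costs only isomorphisms.\<close>

lemma act_mult:
  assumes g: "g \<in> carrier G" and h: "h \<in> carrier G" and X: "X \<in> Obj C"
  shows "iso_obj C (act \<rho> (g \<otimes>\<^bsub>G\<^esub> h) X) (act \<rho> g (act \<rho> h X))"
proof -
  note gh = m_closed[OF g h]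
  have "\<rho> (g \<otimes>\<^bsub>G\<^esub> h) = (\<Union>F \<in> \<rho> g. \<Union>F' \<in> \<rho> h. autoeq_rel C `` {comp_endo F F'})"
    using action g h unfolding category_action_def hom_def autoeq_group_def by auto
  then obtain E F where E: "E \<in> \<rho> g" and F: "F \<in> \<rho> h"
    and iso: "nat_iso C (comp_endo E F) (SOME F. F \<in> \<rho> (g \<otimes>\<^bsub>G\<^esub> h))"
    using action_representative[OF gh] by (auto simp: autoeq_rel_def)
  have FX: "iso_obj C (on_obj F X) (act \<rho> h X)" using action_member(2)[OF h F X] .
  have "endofunctor C F" using action_member(1)[OF h F] by (simp add: autoequivalence_def)
  then have FO: "on_obj F X \<in> Obj C" using X by (rule endofunctorD(1))
  have "iso_obj C (on_obj E (on_obj F X)) (act \<rho> (g \<otimes>\<^bsub>G\<^esub> h) X)"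
    using nat_iso_obj[OF iso X] by (simp add: comp_endo_def act_def)
  moreover have "iso_obj C (on_obj E (on_obj F X)) (act \<rho> g (on_obj F X))"
    using action_member(2)[OF g E FO] .
  moreover have "iso_obj C (act \<rho> g (on_obj F X)) (act \<rho> g (act \<rho> h X))"
    using act_iso_obj[OF g FX] .
  ultimately show ?thesis using iso_obj_trans iso_obj_sym by blast
qed

text \<open>A homomorphism is known here by multiplicativity alone. Applied to the product of the
  unit with itself it relates one application of the unit to two, and one of them is cancelled
  because the action reflects isomorphism.\<close>

lemma act_one:
  assumes X: "X \<in> Obj C"
  shows "iso_obj C (act \<rho> \<one>\<^bsub>G\<^esub> X) X"
proof -
  have "iso_obj C (act \<rho> \<one>\<^bsub>G\<^esub> X) (act \<rho> \<one>\<^bsub>G\<^esub> (act \<rho> \<one>\<^bsub>G\<^esub> X))"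
    using act_mult[OF one_closed one_closed X] by simp
  then show ?thesis using act_reflects_iso_obj[OF one_closed X act_Obj[OF one_closed X]] iso_obj_sym by blast
qed

lemma monoform_Obj: "monoform C H \<Longrightarrow> H \<in> Obj C"
  using monoform_nonzero by (simp add: nonzero_obj_def)

lemma atom_act_atom:
  assumes g: "g \<in> carrier G" and H: "monoform C H"
  shows "atom_act C \<rho> g (atom C H) = atom C (act \<rho> g H)"
proof -
  have "atom C (act \<rho> g H') = atom C (act \<rho> g H)" if "H' \<in> atom C H" for H'
    using that act_common_subobject[OF g] common_subobject_sym
      atom_eq_iff[OF act_monoform[OF g] act_monoform[OF g H]] by (auto simp: atom_def)
  moreover have "H \<in> atom C H" using H common_subobject_refl monoform_nonzero by (auto simp: atom_def)
  ultimately show ?thesis unfolding atom_act_def by blast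
qed

lemma SpecE:
  assumes "\<alpha> \<in> Spec C"
  obtains H where "monoform C H" "\<alpha> = atom C H"
  using assms by (auto simp: Spec_def)

lemma Supp_Spec: "Supp C M \<subseteq> Spec C"
  by (auto simp: Supp_def Spec_def)

lemma atom_act_one: "\<alpha> \<in> Spec C \<Longrightarrow> atom_act C \<rho> \<one>\<^bsub>G\<^esub> \<alpha> = \<alpha>"
  using SpecE atom_act_atom[OF one_closed] atom_iso[OF _ iso_obj_sym] act_one monoform_Obj by metis

lemma atom_act_mult:
  assumes g: "g \<in> carrier G" and h: "h \<in> carrier G" and \<alpha>: "\<alpha> \<in> Spec C"
  shows "atom_act C \<rho> (g \<otimes>\<^bsub>G\<^esub> h) \<alpha> = atom_act C \<rho> g (atom_act C \<rho> h \<alpha>)"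
proof -
  obtain H where H: "monoform C H" "\<alpha> = atom C H" using SpecE[OF \<alpha>] by metis
  show ?thesis
    using atom_act_atom[OF m_closed[OF g h] H(1)] atom_act_atom[OF h H(1)]
      atom_act_atom[OF g act_monoform[OF h H(1)]] H(2)
      atom_iso[OF act_monoform[OF m_closed[OF g h] H(1)] act_mult[OF g h monoform_Obj[OF H(1)]]] by simp
qed

lemma Supp_act: "g \<in> carrier G \<Longrightarrow> \<alpha> \<in> Supp C M \<Longrightarrow> atom_act C \<rho> g \<alpha> \<in> Supp C (act \<rho> g M)"
  using atom_act_atom act_monoform act_subquotient by (auto simp: Supp_def)

lemma mem_orbit_map_iff: "\<beta> \<in> orbit_map G C \<rho> \<alpha> \<longleftrightarrow> (\<exists>g \<in> carrier G. \<beta> = atom_act C \<rho> g \<alpha>)"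
  by (auto simp: orbit_map_def orbit_def)

lemma self_in_orbit_map: "\<alpha> \<in> Spec C \<Longrightarrow> \<alpha> \<in> orbit_map G C \<rho> \<alpha>"
  using mem_orbit_map_iff one_closed atom_act_one by metis

lemma orbit_map_atom_act:
  assumes g: "g \<in> carrier G" and \<alpha>: "\<alpha> \<in> Spec C"
  shows "orbit_map G C \<rho> (atom_act C \<rho> g \<alpha>) = orbit_map G C \<rho> \<alpha>"
proof (intro Set.set_eqI iffI)
  fix \<beta> assume "\<beta> \<in> orbit_map G C \<rho> (atom_act C \<rho> g \<alpha>)"
  then obtain h where "h \<in> carrier G" "\<beta> = atom_act C \<rho> h (atom_act C \<rho> g \<alpha>)"
    using mem_orbit_map_iff by blast
  then show "\<beta> \<in> orbit_map G C \<rho> \<alpha>" using mem_orbit_map_iff atom_act_mult[OF _ g \<alpha>] m_closed[OF _ g] by metis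
next
  fix \<beta> assume "\<beta> \<in> orbit_map G C \<rho> \<alpha>"
  then obtain h where h: "h \<in> carrier G" "\<beta> = atom_act C \<rho> h \<alpha>" using mem_orbit_map_iff by blast
  \<comment> \<open>\<open>\<beta>\<close> is reached from the translated atom by first undoing
    \<open>g\<close> and then applying \<open>h\<close>.\<close>
  have k: "h \<otimes>\<^bsub>G\<^esub> inv\<^bsub>G\<^esub> g \<in> carrier G" using h g by simp
  have "(h \<otimes>\<^bsub>G\<^esub> inv\<^bsub>G\<^esub> g) \<otimes>\<^bsub>G\<^esub> g = h" using h g by (simp add: m_assoc)
  then have "\<beta> = atom_act C \<rho> (h \<otimes>\<^bsub>G\<^esub> inv\<^bsub>G\<^esub> g) (atom_act C \<rho> g \<alpha>)"
    using atom_act_mult[OF k g \<alpha>] h by simp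
  then show "\<beta> \<in> orbit_map G C \<rho> (atom_act C \<rho> g \<alpha>)" using mem_orbit_map_iff k by blast
qed

text \<open>An atom of the translate of \<open>M\<close> is moved by the inverse of \<open>g\<close>
  into the support of an object isomorphic to \<open>M\<close>, and its orbit does not
  change.\<close>

lemma SuppG_act:
  assumes g: "g \<in> carrier G" and M: "M \<in> Obj C"
  shows "SuppG G C \<rho> (act \<rho> g M) \<subseteq> SuppG G C \<rho> M"
proof
  fix x assume "x \<in> SuppG G C \<rho> (act \<rho> g M)"
  then obtain \<alpha> where \<alpha>: "\<alpha> \<in> Supp C (act \<rho> g M)" "x = orbit_map G C \<rho> \<alpha>" by (auto simp: SuppG_def)
  have ig: "inv\<^bsub>G\<^esub> g \<in> carrier G" using g by simp
  have "iso_obj C (act \<rho> (inv\<^bsub>G\<^esub> g \<otimes>\<^bsub>G\<^esub> g) M) (act \<rho> (inv\<^bsub>G\<^esub> g) (act \<rho> g M))"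
    using act_mult[OF ig g M] .
  then have "iso_obj C (act \<rho> \<one>\<^bsub>G\<^esub> M) (act \<rho> (inv\<^bsub>G\<^esub> g) (act \<rho> g M))" using g by simp
  then have "Supp C (act \<rho> (inv\<^bsub>G\<^esub> g) (act \<rho> g M)) = Supp C M"
    using Supp_iso act_one[OF M] by metis
  then have "atom_act C \<rho> (inv\<^bsub>G\<^esub> g) \<alpha> \<in> Supp C M" using Supp_act[OF ig \<alpha>(1)] by simp
  then show "x \<in> SuppG G C \<rho> M"
    using orbit_map_atom_act[OF ig, of \<alpha>] Supp_Spec \<alpha> unfolding SuppG_def by (metis image_eqI subsetD)
qed

text \<open>\<open>G\<close>-closedness makes the union of supports a union of whole orbits: an atom
  in the orbit of \<open>\<beta>\<close> lies in the support of a translate of \<open>X\<close>,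
  which is again in \<open>\<X>\<close>.\<close>

lemma orbit_map_in_SuppG_sub_iff:
  assumes "G_closed G \<rho> \<X>" "\<alpha> \<in> Spec C"
  shows "orbit_map G C \<rho> \<alpha> \<in> SuppG_sub G C \<rho> \<X> \<longleftrightarrow> \<alpha> \<in> (\<Union>X \<in> \<X>. Supp C X)"
proof
  assume "orbit_map G C \<rho> \<alpha> \<in> SuppG_sub G C \<rho> \<X>"
  then obtain X \<beta> where X: "X \<in> \<X>" "\<beta> \<in> Supp C X" "orbit_map G C \<rho> \<alpha> = orbit_map G C \<rho> \<beta>"
    by (auto simp: SuppG_sub_def SuppG_def)
  then obtain g where "g \<in> carrier G" "\<alpha> = atom_act C \<rho> g \<beta>"
    using self_in_orbit_map[OF assms(2)] mem_orbit_map_iff by metis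
  then have "\<alpha> \<in> Supp C (act \<rho> g X)" "act \<rho> g X \<in> \<X>"
    using Supp_act X assms(1) by (simp_all add: G_closed_def)
  then show "\<alpha> \<in> (\<Union>X \<in> \<X>. Supp C X)" by blast
qed (auto simp: SuppG_sub_def SuppG_def)

lemma Supp_subset_of_SuppG_subset:
  assumes "G_closed G \<rho> \<X>" "SuppG G C \<rho> M \<subseteq> SuppG_sub G C \<rho> \<X>"
  shows "Supp C M \<subseteq> (\<Union>X \<in> \<X>. Supp C X)"
  using assms orbit_map_in_SuppG_sub_iff Supp_Spec unfolding SuppG_def by blast

lemma topspace_Spec_top: "topspace (Spec_top C) = Spec C"
proof -
  have "\<alpha> \<in> (\<Union>M \<in> Obj C. Supp C M)" if \<alpha>: "\<alpha> \<in> Spec C" for \<alpha>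
  proof -
    obtain H where H: "monoform C H" "\<alpha> = atom C H" using SpecE[OF \<alpha>] by metis
    have HO: "H \<in> Obj C" using monoform_Obj[OF H(1)] .
    then show ?thesis
      using SuppI[OF H(1) subquotient_mono[OF Ident_in_Hom[OF HO] mono_Ident[OF HO]]] H(2) by blast
  qed
  then show ?thesis using Supp_Spec by (auto simp: Spec_top_def)
qed

lemma openin_SuppG_sub:
  assumes "G_closed G \<rho> \<X>" "\<X> \<subseteq> Obj C"
  shows "openin (SpecG_top G C \<rho>) (SuppG_sub G C \<rho> \<X>)"
proof -
  have "{\<alpha> \<in> topspace (Spec_top C). orbit_map G C \<rho> \<alpha> \<in> SuppG_sub G C \<rho> \<X>} = (\<Union>X \<in> \<X>. Supp C X)"
    using orbit_map_in_SuppG_sub_iff[OF assms(1)] Supp_Spec unfolding topspace_Spec_top by blast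
  moreover have "openin (Spec_top C) (\<Union>X \<in> \<X>. Supp C X)"
  proof (rule openin_Union)
    fix S assume "S \<in> Supp C ` \<X>"
    then show "openin (Spec_top C) S"
      using assms(2) unfolding Spec_top_def by (auto intro: topology_generated_by_Basis)
  qed
  moreover have "SuppG_sub G C \<rho> \<X> \<subseteq> SpecG G C \<rho>"
    using Supp_Spec by (auto simp: SuppG_sub_def SuppG_def SpecG_def)
  ultimately show ?thesis unfolding openin_SpecG_top by simp
qed

text \<open>Restates the condition on orbits as a bound on ordinary supports, the form in which the
  Serre conditions have been verified.\<close>

lemma SuppG_inv_eq:
  "N \<subseteq> Obj C \<Longrightarrow> SuppG_inv G C \<rho> \<Phi> \<inter> N = {M \<in> N. Supp C M \<subseteq> {\<alpha>. orbit_map G C \<rho> \<alpha> \<in> \<Phi>}}"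
  by (auto simp: SuppG_inv_def SuppG_def)

lemma G_closed_SuppG_inv:
  assumes "\<And>g M. g \<in> carrier G \<Longrightarrow> M \<in> N \<Longrightarrow> act \<rho> g M \<in> N"
  shows "G_closed G \<rho> (SuppG_inv G C \<rho> \<Phi> \<inter> N)"
  using assms SuppG_act act_Obj unfolding G_closed_def SuppG_inv_def by blast

end

section \<open>The correspondence with open sets of orbits\<close>

locale locally_noetherian_with_action =
  locally_noetherian_category C \<kappa> + category_with_action C G \<rho>
  for C :: "('o, 'a) cat" (structure) and \<kappa> :: "'u rel"
    and G :: "('g, 'm) monoid_scheme" and \<rho> :: "'g \<Rightarrow> ('o, 'a) endo set"
begin

text \<open>The topology is given as generated by supports, so that they form a basis has to be
  proved; the induction runs over the generation of \<open>U\<close>.\<close>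

lemma Spec_top_noetherian_basis:
  assumes "openin (Spec_top C) U" "\<alpha> \<in> U"
  obtains M where "noetherian C M" "\<alpha> \<in> Supp C M" "Supp C M \<subseteq> U"
proof -
  have "generate_topology_on (Supp C ` Obj C) U"
    using assms(1) by (simp add: Spec_top_def openin_topology_generated_by_iff)
  then have "\<forall>\<alpha> \<in> U. \<exists>M \<in> Obj C. \<alpha> \<in> Supp C M \<and> Supp C M \<subseteq> U"
  proof (induction rule: generate_topology_on.induct)
    case (Int a b)
    show ?case
    proof
      fix \<alpha> assume "\<alpha> \<in> a \<inter> b"
      then obtain M N where M: "\<alpha> \<in> Supp C M" "Supp C M \<subseteq> a" and N: "\<alpha> \<in> Supp C N" "Supp C N \<subseteq> b"
        using Int.IH by blast
      obtain H where H: "monoform C H" "subquotient C M H" "\<alpha> = atom C H"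
        using M(1) by (auto simp: Supp_def)
      obtain H' where H': "monoform C H'" "subquotient C N H'" "\<alpha> = atom C H'"
        using N(1) by (auto simp: Supp_def)
      \<comment> \<open>Two monoform representatives of one atom share a nonzero \<open>K\<close>.
        It represents the same atom, and its support lies in both given supports.\<close>
      have "common_subobject C H H'" using atom_eq_iff[OF H(1) H'(1)] H(3) H'(3) by simp
      then obtain K f g where K: "nonzero_obj C K" and f: "f \<in> Hom C K H" "mono_arr C f"
        and g: "g \<in> Hom C K H'" "mono_arr C g"
        unfolding common_subobject_def by blast
      have KO: "K \<in> Obj C" using HomD(4)[OF f(1)] .
      have "Supp C K \<subseteq> Supp C M" "Supp C K \<subseteq> Supp C N"
        using Supp_subquotient subquotient_trans[OF H(2) subquotient_mono[OF f]]
          subquotient_trans[OF H'(2) subquotient_mono[OF g]] by auto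
      moreover have "\<alpha> \<in> Supp C K"
        using SuppI[OF monoform_subobject[OF H(1) f K] subquotient_mono[OF Ident_in_Hom[OF KO] mono_Ident[OF KO]]]
          atom_subobject[OF H(1) f K] H(3) by simp
      ultimately show "\<exists>M \<in> Obj C. \<alpha> \<in> Supp C M \<and> Supp C M \<subseteq> a \<inter> b" using M N KO by blast
    qed
  next
    case (UN K)
    show ?case
    proof
      fix \<alpha> assume "\<alpha> \<in> \<Union>K"
      then obtain k where "k \<in> K" "\<alpha> \<in> k" by blast
      then show "\<exists>M \<in> Obj C. \<alpha> \<in> Supp C M \<and> Supp C M \<subseteq> \<Union>K" using UN.IH by blast
    qed
  qed auto
  then obtain M where M: "\<alpha> \<in> Supp C M" "Supp C M \<subseteq> U" using assms(2) by blast
  obtain H where H: "monoform C H" "subquotient C M H" "\<alpha> = atom C H"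
    using M(1) by (auto simp: Supp_def)
  \<comment> \<open>Shrinking the representative to a noetherian subobject keeps the atom and can
    only decrease the support.\<close>
  obtain K k where k: "k \<in> Hom C K H" "mono_arr C k" "nonzero_obj C K" "noetherian C K"
    using nonzero_noetherian_subobject[OF monoform_nonzero[OF H(1)]] by metis
  have KO: "K \<in> Obj C" using HomD(4)[OF k(1)] .
  have "\<alpha> \<in> Supp C K"
    using SuppI[OF monoform_subobject[OF H(1) k(1-3)] subquotient_mono[OF Ident_in_Hom[OF KO] mono_Ident[OF KO]]]
      atom_subobject[OF H(1) k(1-3)] H(3) by simp
  moreover have "Supp C K \<subseteq> U"
    using Supp_subquotient[OF subquotient_trans[OF H(2) subquotient_mono[OF k(1,2)]]] M(2) by blast
  ultimately show ?thesis using that k(4) by blast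
qed

text \<open>The basis of noetherian supports means that the noetherian members alone already recover
  the open set, so \<open>N\<close> may be any class containing them.\<close>

lemma SuppG_sub_SuppG_inv:
  assumes \<Phi>: "openin (SpecG_top G C \<rho>) \<Phi>" and N: "\<And>M. noetherian C M \<Longrightarrow> M \<in> N"
  shows "SuppG_sub G C \<rho> (SuppG_inv G C \<rho> \<Phi> \<inter> N) = \<Phi>"
proof
  show "SuppG_sub G C \<rho> (SuppG_inv G C \<rho> \<Phi> \<inter> N) \<subseteq> \<Phi>" by (auto simp: SuppG_sub_def SuppG_inv_def)
  show "\<Phi> \<subseteq> SuppG_sub G C \<rho> (SuppG_inv G C \<rho> \<Phi> \<inter> N)"
  proof
    fix x assume x: "x \<in> \<Phi>"
    have \<Phi>': "\<Phi> \<subseteq> SpecG G C \<rho>" "openin (Spec_top C) {\<alpha> \<in> Spec C. orbit_map G C \<rho> \<alpha> \<in> \<Phi>}"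
      using \<Phi> unfolding openin_SpecG_top topspace_Spec_top by auto
    then obtain \<alpha> where \<alpha>: "\<alpha> \<in> Spec C" "x = orbit_map G C \<rho> \<alpha>" using x by (auto simp: SpecG_def)
    then obtain M where M: "noetherian C M" "\<alpha> \<in> Supp C M"
      "Supp C M \<subseteq> {\<alpha> \<in> Spec C. orbit_map G C \<rho> \<alpha> \<in> \<Phi>}"
      using Spec_top_noetherian_basis[OF \<Phi>'(2), of \<alpha>] x by blast
    then have "M \<in> SuppG_inv G C \<rho> \<Phi> \<inter> N" using N noetherian_Obj by (auto simp: SuppG_inv_def SuppG_def)
    then show "x \<in> SuppG_sub G C \<rho> (SuppG_inv G C \<rho> \<Phi> \<inter> N)"
      using M(2) \<alpha>(2) unfolding SuppG_sub_def SuppG_def by blast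
  qed
qed

lemma SuppG_inv_SuppG_sub:
  assumes \<X>: "G_closed G \<rho> \<X>" "\<X> \<subseteq> N" "N \<subseteq> Obj C"
    and det: "\<And>M. M \<in> N \<Longrightarrow> Supp C M \<subseteq> (\<Union>X \<in> \<X>. Supp C X) \<Longrightarrow> M \<in> \<X>"
  shows "SuppG_inv G C \<rho> (SuppG_sub G C \<rho> \<X>) \<inter> N = \<X>"
proof
  show "\<X> \<subseteq> SuppG_inv G C \<rho> (SuppG_sub G C \<rho> \<X>) \<inter> N"
    using \<X> by (auto simp: SuppG_inv_def SuppG_sub_def)
  show "SuppG_inv G C \<rho> (SuppG_sub G C \<rho> \<X>) \<inter> N \<subseteq> \<X>"
    using det Supp_subset_of_SuppG_subset[OF \<X>(1)] unfolding SuppG_inv_def by blast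
qed

lemma SuppG_inv_Int_Obj: "SuppG_inv G C \<rho> \<Phi> \<inter> Obj C = SuppG_inv G C \<rho> \<Phi>"
  by (auto simp: SuppG_inv_def)

lemma localizing_SuppG_inv: "localizing_subcategory \<kappa> C (SuppG_inv G C \<rho> \<Phi>)"
proof -
  let ?T = "{\<alpha>. orbit_map G C \<rho> \<alpha> \<in> \<Phi>}"
  have eq: "SuppG_inv G C \<rho> \<Phi> = {M \<in> Obj C. Supp C M \<subseteq> ?T}"
    using SuppG_inv_eq[OF order_refl] SuppG_inv_Int_Obj by simp
  have "serre_subcategory C {M \<in> Obj C. Supp C M \<subseteq> ?T}"
    using subquotient_closed.serre_subcategory_of_Supp[OF subquotient_closed_Obj] full_subcat_Obj by simp
  moreover have "P \<in> {M \<in> Obj C. Supp C M \<subseteq> ?T}"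
    if I: "small \<kappa> I" and F: "\<forall>i \<in> I. F i \<in> {M \<in> Obj C. Supp C M \<subseteq> ?T}" and P: "is_coproduct C I F P \<iota>"
    for I :: "'u set" and F P \<iota>
  proof -
    have "P \<in> Obj C" and \<iota>: "\<And>i. i \<in> I \<Longrightarrow> \<iota> i \<in> Hom C (F i) P" using P by (auto simp: is_coproduct_def)
    moreover have "Supp C P \<subseteq> (\<Union>i \<in> I. Supp C (F i))"
      using Supp_jointly_epi[of I \<iota> F P] I \<iota> coproduct_jointly_epi[OF P] by blast
    ultimately show ?thesis using F by blast
  qed
  ultimately show ?thesis unfolding localizing_subcategory_def eq by blast
qed

text \<open>Noetherian subobjects of \<open>M\<close> inherit the bound on supports and lie in
  \<open>\<X>\<close> by the noetherian case with \<open>N = Obj C\<close>; closure under coproducts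
  and quotients does the rest.\<close>

lemma localizing_determined_by_Supp:
  assumes \<X>: "localizing_subcategory \<kappa> C \<X>" and M: "M \<in> Obj C" "Supp C M \<subseteq> (\<Union>X \<in> \<X>. Supp C X)"
  shows "M \<in> \<X>"
proof (rule localizing_determined_by_noetherian_subobjects[OF \<X> M(1)])
  have "serre_within C (Obj C) \<X>"
    using subquotient_closed.serre_within_of_serre_subcategory[OF subquotient_closed_Obj] full_subcat_Obj \<X>
    by (simp add: localizing_subcategory_def)
  then show "K \<in> \<X>" if "k \<in> Hom C K M" "mono_arr C k" "noetherian C K" for K k
    using noetherian_in_serre_within[OF that(3)] noetherian_Obj
      Supp_subquotient[OF subquotient_mono[OF that(1,2)]] M(2) by blast
qed

lemma localizing_Obj: "localizing_subcategory \<kappa> C \<X> \<Longrightarrow> \<X> \<subseteq> Obj C"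
  by (simp add: localizing_subcategory_def serre_subcategory_def)

lemma closed_localizing_inverse:
  shows "\<X> \<in> closed_localizing \<kappa> G C \<rho> \<Longrightarrow> SuppG_sub G C \<rho> \<X> \<in> SpecG_opens G C \<rho>"
    and "\<X> \<in> closed_localizing \<kappa> G C \<rho> \<Longrightarrow> SuppG_inv G C \<rho> (SuppG_sub G C \<rho> \<X>) = \<X>"
    and "\<Phi> \<in> SpecG_opens G C \<rho> \<Longrightarrow> SuppG_inv G C \<rho> \<Phi> \<in> closed_localizing \<kappa> G C \<rho>"
    and "\<Phi> \<in> SpecG_opens G C \<rho> \<Longrightarrow> SuppG_sub G C \<rho> (SuppG_inv G C \<rho> \<Phi>) = \<Phi>"
proof -
  assume \<X>: "\<X> \<in> closed_localizing \<kappa> G C \<rho>"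
  then have loc: "localizing_subcategory \<kappa> C \<X>" and G: "G_closed G \<rho> \<X>" by (auto simp: closed_localizing_def)
  show "SuppG_sub G C \<rho> \<X> \<in> SpecG_opens G C \<rho>"
    using openin_SuppG_sub[OF G localizing_Obj[OF loc]] by (simp add: SpecG_opens_def)
  have "SuppG_inv G C \<rho> (SuppG_sub G C \<rho> \<X>) \<inter> Obj C = \<X>"
    by (rule SuppG_inv_SuppG_sub[OF G localizing_Obj[OF loc] order_refl localizing_determined_by_Supp[OF loc]])
  then show "SuppG_inv G C \<rho> (SuppG_sub G C \<rho> \<X>) = \<X>" using SuppG_inv_Int_Obj by simp
next
  assume \<Phi>: "\<Phi> \<in> SpecG_opens G C \<rho>"
  show "SuppG_inv G C \<rho> \<Phi> \<in> closed_localizing \<kappa> G C \<rho>"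
    using localizing_SuppG_inv G_closed_SuppG_inv[of "Obj C" \<Phi>, OF act_Obj] SuppG_inv_Int_Obj
    by (simp add: closed_localizing_def)
  show "SuppG_sub G C \<rho> (SuppG_inv G C \<rho> \<Phi>) = \<Phi>"
    using SuppG_sub_SuppG_inv[of \<Phi> "Obj C", OF _ noetherian_Obj] \<Phi> SuppG_inv_Int_Obj
    by (simp add: SpecG_opens_def)
qed

lemma closed_serre_noeth_inverse:
  shows "\<X> \<in> closed_serre_noeth G C \<rho> \<Longrightarrow> SuppG_sub G C \<rho> \<X> \<in> SpecG_opens G C \<rho>"
    and "\<X> \<in> closed_serre_noeth G C \<rho> \<Longrightarrow> SuppG_inv G C \<rho> (SuppG_sub G C \<rho> \<X>) \<inter> {M. noetherian C M} = \<X>"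
    and "\<Phi> \<in> SpecG_opens G C \<rho> \<Longrightarrow> SuppG_inv G C \<rho> \<Phi> \<inter> {M. noetherian C M} \<in> closed_serre_noeth G C \<rho>"
    and "\<Phi> \<in> SpecG_opens G C \<rho> \<Longrightarrow> SuppG_sub G C \<rho> (SuppG_inv G C \<rho> \<Phi> \<inter> {M. noetherian C M}) = \<Phi>"
proof -
  let ?N = "{M. noetherian C M}"
  have N: "?N \<subseteq> Obj C" using noetherian_Obj by blast
  {
    assume \<X>: "\<X> \<in> closed_serre_noeth G C \<rho>"
    then have G: "G_closed G \<rho> \<X>" and serre: "serre_within C ?N \<X>"
      using subquotient_closed.serre_within_of_serre_subcategory[OF subquotient_closed_noetherian]
      by (auto simp: closed_serre_noeth_def noeth_def)
    have sN: "\<X> \<subseteq> ?N" using serre_withinD(1)[OF serre] .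
    show "SuppG_sub G C \<rho> \<X> \<in> SpecG_opens G C \<rho>"
      using openin_SuppG_sub[OF G subset_trans[OF sN N]] by (simp add: SpecG_opens_def)
    show "SuppG_inv G C \<rho> (SuppG_sub G C \<rho> \<X>) \<inter> ?N = \<X>"
    proof (rule SuppG_inv_SuppG_sub[OF G sN N])
      show "M \<in> \<X>" if "M \<in> ?N" "Supp C M \<subseteq> (\<Union>X \<in> \<X>. Supp C X)" for M
        using noetherian_in_serre_within[OF _ serre _ that(2)] that(1) by simp
    qed
  next
    assume \<Phi>: "\<Phi> \<in> SpecG_opens G C \<rho>"
    have "serre_subcategory (noeth C) (SuppG_inv G C \<rho> \<Phi> \<inter> ?N)"
      unfolding SuppG_inv_eq[OF N] noeth_def
      using subquotient_closed.serre_subcategory_of_Supp[OF subquotient_closed_noetherian] .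
    moreover have "G_closed G \<rho> (SuppG_inv G C \<rho> \<Phi> \<inter> ?N)"
      by (rule G_closed_SuppG_inv) (simp add: act_noetherian)
    ultimately show "SuppG_inv G C \<rho> \<Phi> \<inter> ?N \<in> closed_serre_noeth G C \<rho>"
      by (simp add: closed_serre_noeth_def)
    show "SuppG_sub G C \<rho> (SuppG_inv G C \<rho> \<Phi> \<inter> ?N) = \<Phi>"
      using SuppG_sub_SuppG_inv[of \<Phi> ?N] \<Phi> by (simp add: SpecG_opens_def)
  }
qed

lemma bij_betw_closed_localizing:
  "bij_betw (SuppG_sub G C \<rho>) (closed_localizing \<kappa> G C \<rho>) (SpecG_opens G C \<rho>)"
  "bij_betw (SuppG_inv G C \<rho>) (SpecG_opens G C \<rho>) (closed_localizing \<kappa> G C \<rho>)"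
  by (rule bij_betw_byWitness[where f' = "SuppG_inv G C \<rho>"], use closed_localizing_inverse in auto)
    (rule bij_betw_byWitness[where f' = "SuppG_sub G C \<rho>"], use closed_localizing_inverse in auto)

lemma bij_betw_closed_serre_noeth:
  "bij_betw (SuppG_sub G C \<rho>) (closed_serre_noeth G C \<rho>) (SpecG_opens G C \<rho>)"
  by (rule bij_betw_byWitness[where f' = "\<lambda>\<Phi>. SuppG_inv G C \<rho> \<Phi> \<inter> {M. noetherian C M}"])
    (use closed_serre_noeth_inverse in auto)

end

theorem lemma3p2:
  fixes C :: "('o, 'a) cat" and \<kappa> :: "'u rel"
    and G :: "('g, 'm) monoid_scheme" and \<rho> :: "'g \<Rightarrow> ('o, 'a) endo set"
  assumes "locally_noetherian_category C \<kappa>"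
    and "group G"
    and "category_action G C \<rho>"
  shows "(\<exists>f. bij_betw f (closed_localizing \<kappa> G C \<rho>) (closed_serre_noeth G C \<rho>)) \<and>
    (\<exists>f. bij_betw f (closed_serre_noeth G C \<rho>) (SpecG_opens G C \<rho>)) \<and>
    bij_betw (SuppG_sub G C \<rho>) (closed_localizing \<kappa> G C \<rho>) (SpecG_opens G C \<rho>) \<and>
    bij_betw (SuppG_inv G C \<rho>) (SpecG_opens G C \<rho>) (closed_localizing \<kappa> G C \<rho>) \<and>
    (\<forall>\<X> \<in> closed_localizing \<kappa> G C \<rho>. SuppG_inv G C \<rho> (SuppG_sub G C \<rho> \<X>) = \<X>) \<and>
    (\<forall>\<Phi> \<in> SpecG_opens G C \<rho>. SuppG_sub G C \<rho> (SuppG_inv G C \<rho> \<Phi>) = \<Phi>)"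
proof -
  interpret locally_noetherian_category C \<kappa> by (rule assms(1))
  interpret group G by (rule assms(2))
  interpret locally_noetherian_with_action C \<kappa> G \<rho>
    by unfold_locales (rule assms(3))
  \<comment> \<open>Composed through the open sets: a localizing subcategory goes to the Serre
    subcategory of noetherian objects with the same \<open>SuppG_sub\<close>.\<close>
  have "\<exists>f. bij_betw f (closed_localizing \<kappa> G C \<rho>) (closed_serre_noeth G C \<rho>)"
    using bij_betw_trans[OF bij_betw_closed_localizing(1) bij_betw_inv_into[OF bij_betw_closed_serre_noeth]]
    by blast
  then show ?thesis
    using bij_betw_closed_localizing bij_betw_closed_serre_noeth closed_localizing_inverse(2,4) by blast
qed

end
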